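(* The tree $\sigma Y$ is $Z$-embeddable (that is, there exists a strictly increasing map from $\sigma Y$ to $Z$), but every increasing function $\rho:\sigma Y\longrightarrow Z$ has a $Z$-bad point. In particular, $\mathscr{C}_0(\sigma Y)$ does not admit a G\^{a}teaux smooth norm.
   Context: Trees. A tree is a partially ordered set $(\Upsilon,\preccurlyeq)$ such that for each $t\in\Upsilon$ the set of predecessors $(0,t]=\{s\in\Upsilon : s\preccurlyeq t\}$ is well-ordered; here $0$ is only a notational device, not an element of $\Upsilon$. The set of immediate successors of $t$ is denoted $t^+$. The interval topology on $\Upsilon$ is the coarsest topology for which all sets $(0,t]$, $t\in\Upsilon$, are both open and closed. $\mathscr{C}_0(\Upsilon)$ is the Banach space of continuous real-valued functions on $\Upsilon$ (with the interval topology) vanishing at infinity, with canonical norm the supremum norm. Kurepa's construction. For a linear order $\Sigma$, $\sigma\Sigma=\{A\subseteq\Sigma : A\text{ is well-ordered}\}$, ordered by $A\preccurlyeq B$ if and only if $A$ is an initial segment of $B$. This is a tree whose interval topology is Hausdorff and locally compact. Norms. A norm on a Banach space $X$ always means a norm equivalent to the canonical one. A norm $\|\cdot\|$ is G\^{a}teaux smooth if for every $x\in X\setminus\{0\}$ there is a functional $\|x\|'\in X^*$ with $\lim_{\lambda\to 0}\frac{\|x+\lambda h\|-\|x\|}{\lambda}=\|x\|'(h)$ for all $h\in X$. Monotone maps. A map $\rho:P\to Q$ between partial orders is increasing (respectively strictly increasing) if $\rho(s)\preccurlyeq\rho(t)$ (respectively $\rho(s)\prec\rho(t)$) whenever $s\prec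 t$. $P$ is $Q$-embeddable if there is a strictly increasing map from $P$ to $Q$. The orders $Y$ and $Z$. Let $\omega_1$ be the first uncountable ordinal. $Z$ is the set of all increasing (i.e. non-decreasing), continuous transfinite sequences $x=(x_\xi)_{\xi\leq\beta}$ of real numbers, where $0\leq\beta<\omega_1$, such that $x$ is strictly increasing on $[0,\beta)$. $Y$ is the set of all strictly increasing, continuous transfinite sequences $x=(x_\xi)_{\xi\leq\beta}$ of real numbers, $0\leq\beta<\omega_1$. Both are linearly ordered by: $x<y$ if and only if either $y$ strictly extends $x$, or there is an ordinal $\alpha$ such that $x_\xi=y_\xi$ for $\xi<\alpha$ and $y_\alpha<x_\alpha$. $Z$-bad points. Given a tree $\Upsilon$ and an increasing $\rho:\Upsilon\to Z$, a point $t\in\Upsilon$ is $Z$-bad for $\rho$ if there is a sequence of distinct points $(u_n)\subseteq t^+$ such that $\rho(u_n)\to\rho(t)$ in the order topology of $Z$. *)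

theory Defs
  imports "HOL-Analysis.Analysis" "HOL-Library.Countable_Set_Type"
begin

unbundle cardinal_syntax

section \<open>The first uncountable ordinal\<close>

text \<open>
  The elements of \<open>omega1\<close> play the role of the countable ordinals.
  The facts \<open>countable_atMost_omega1\<close> and \<open>uncountable_UNIV_omega1\<close> below determine this
  well-order up to isomorphism.
\<close>

lemma Field_cardSuc_natLeq_uncountable: "\<not> countable (Field (cardSuc natLeq))"
proof
  assume "countable (Field (cardSuc natLeq))"
  then have "|Field (cardSuc natLeq)| \<le>o natLeq"
    by (simp add: countable_card_le_natLeq)
  moreover have "cardSuc natLeq =o |Field (cardSuc natLeq)|"
    using card_of_Field_ordIso[OF cardSuc_Card_order[OF natLeq_Card_order]]
    by (rule ordIso_symmetric)
  ultimately have "cardSuc natLeq \<le>o natLeq"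
    by (rule ordIso_ordLeq_trans[rotated])
  then show False
    using cardSuc_greater[OF natLeq_Card_order] not_ordLess_ordLeq by blast
qed

typedef omega1 = "Field (cardSuc natLeq)"
  using Field_cardSuc_natLeq_uncountable by (metis countable_empty ex_in_conv)

lemma well_order_cardSuc_natLeq:
  "well_order_on (Field (cardSuc natLeq)) (cardSuc natLeq)"
  using cardSuc_Card_order[OF natLeq_Card_order] card_order_on_well_order_on by blast

instantiation omega1 :: wellorder
begin

definition less_eq_omega1 :: "omega1 \<Rightarrow> omega1 \<Rightarrow> bool" where
  "a \<le> b \<longleftrightarrow> (Rep_omega1 a, Rep_omega1 b) \<in> cardSuc natLeq"

definition less_omega1 :: "omega1 \<Rightarrow> omega1 \<Rightarrow> bool" where
  "a < b \<longleftrightarrow> (Rep_omega1 a, Rep_omega1 b) \<in> cardSuc natLeq - Id"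

instance
proof -
  let ?r = "cardSuc natLeq"
  have lin: "linear_order_on (Field ?r) ?r" and wf: "wf (?r - Id)"
    using well_order_cardSuc_natLeq by (auto simp: well_order_on_def)
  have refl: "refl_on (Field ?r) ?r" and tr: "trans ?r" and asym: "antisym ?r"
    and tot: "total_on (Field ?r) ?r"
    using lin by (auto simp: order_on_defs)
  show "OFCLASS(omega1, wellorder_class)"
  proof
    fix x y z :: omega1
    show "(x < y) = (x \<le> y \<and> \<not> y \<le> x)"
      using asym refl Rep_omega1[of x]
      by (auto simp: less_omega1_def less_eq_omega1_def antisym_def refl_on_def)
    show "x \<le> x"
      using refl Rep_omega1[of x] by (auto simp: less_eq_omega1_def refl_on_def)
    show "x \<le> y \<Longrightarrow> y \<le> z \<Longrightarrow> x \<le> z"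
      using tr by (auto simp: less_eq_omega1_def trans_def)
    show "x \<le> y \<Longrightarrow> y \<le> x \<Longrightarrow> x = y"
      using asym by (auto simp: less_eq_omega1_def antisym_def Rep_omega1_inject[symmetric])
    show "x \<le> y \<or> y \<le> x"
      using tot refl Rep_omega1[of x] Rep_omega1[of y]
      unfolding less_eq_omega1_def total_on_def refl_on_def by metis
  next
    fix P :: "omega1 \<Rightarrow> bool" and a :: omega1
    assume step: "\<And>x. (\<And>y. y < x \<Longrightarrow> P y) \<Longrightarrow> P x"
    have "wf (inv_image (?r - Id) Rep_omega1)"
      using wf by (rule wf_inv_image)
    then show "P a"
    proof (induction a rule: wf_induct_rule)
      case (less x)
      show ?case
        by (rule step, rule less) (simp add: less_omega1_def inv_image_def Rep_omega1_inject)
    qed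
  qed
qed

end

lemma uncountable_UNIV_omega1: "uncountable (UNIV :: omega1 set)"
proof
  assume "countable (UNIV :: omega1 set)"
  then have "countable (range Rep_omega1)" by simp
  then show False
    using Field_cardSuc_natLeq_uncountable
    by (simp add: type_definition.Rep_range[OF type_definition_omega1])
qed

lemma countable_atMost_omega1: "countable {..a :: omega1}"
proof -
  let ?r = "cardSuc natLeq"
  have "|underS ?r (Rep_omega1 a)| <o ?r"
    using cardSuc_Card_order[OF natLeq_Card_order] Rep_omega1 by (rule card_of_underS)
  then have "|underS ?r (Rep_omega1 a)| \<le>o natLeq"
    using cardSuc_ordLeq_ordLess[OF natLeq_Card_order card_of_Card_order] by blast
  then have "countable (underS ?r (Rep_omega1 a))"
    by (simp add: countable_card_le_natLeq)
  moreover have "Rep_omega1 ` {..<a} \<subseteq> underS ?r (Rep_omega1 a)"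
    by (auto simp: less_omega1_def underS_def Rep_omega1_inject)
  ultimately have "countable (Rep_omega1 ` {..<a})"
    by (rule countable_subset[rotated])
  then have "countable {..<a}"
    by (rule countable_image_inj_on) (simp add: inj_on_def Rep_omega1_inject)
  moreover have "{..a} = insert a {..<a}" by auto
  ultimately show ?thesis by simp
qed

instantiation omega1 :: linorder_topology
begin

definition open_omega1 :: "omega1 set \<Rightarrow> bool" where
  "open_omega1 = generate_topology (range lessThan \<union> range greaterThan)"

instance
  by standard (simp add: open_omega1_def)

end


unbundle no cardinal_syntax


section \<open>The linear orders \<open>Y\<close> and \<open>Z\<close>\<close>

text \<open>
  A sequence of reals \<open>x\<^sub>\<xi>\<close>, \<open>\<xi> \<le> \<beta>\<close>, is a partial map on \<open>omega1\<close> whose domain is \<open>{..\<beta>}\<close>.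
\<close>

type_synonym rseq = "omega1 \<rightharpoonup> real"

definition seq_less :: "rseq \<Rightarrow> rseq \<Rightarrow> bool" where
  "seq_less x y \<longleftrightarrow>
     (x \<subseteq>\<^sub>m y \<and> x \<noteq> y) \<or>
     (\<exists>\<alpha> \<in> dom x \<inter> dom y. (\<forall>\<xi><\<alpha>. x \<xi> = y \<xi>) \<and> the (y \<alpha>) < the (x \<alpha>))"

typedef Z =
  "{x :: rseq. \<exists>\<beta>. dom x = {..\<beta>} \<and>
     continuous_on {..\<beta>} (\<lambda>\<xi>. the (x \<xi>)) \<and>
     mono_on {..\<beta>} (\<lambda>\<xi>. the (x \<xi>)) \<and>
     strict_mono_on {..<\<beta>} (\<lambda>\<xi>. the (x \<xi>))}"
proof -
  obtain b :: omega1 where b: "\<And>a. b \<le> a"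
    using Least_le[of "\<lambda>_. True"] by blast
  then have "{..b} = {b}" "{..<b} = {}" by (auto simp: order.antisym leD)
  then show ?thesis
    by (intro exI[of _ "[b \<mapsto> 0]"] CollectI exI[of _ b])
       (auto simp: mono_on_def strict_mono_on_def)
qed

typedef Y =
  "{x :: rseq. \<exists>\<beta>. dom x = {..\<beta>} \<and>
     continuous_on {..\<beta>} (\<lambda>\<xi>. the (x \<xi>)) \<and>
     strict_mono_on {..\<beta>} (\<lambda>\<xi>. the (x \<xi>))}"
proof -
  obtain b :: omega1 where b: "\<And>a. b \<le> a"
    using Least_le[of "\<lambda>_. True"] by blast
  then have "{..b} = {b}" by (auto simp: order.antisym)
  then show ?thesis
    by (intro exI[of _ "[b \<mapsto> 0]"] CollectI exI[of _ b])
       (auto simp: strict_mono_on_def)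
qed

lemma seq_less_iff_first_difference:
  assumes "dom x = {..\<beta>}" "dom y = {..\<gamma>}"
  shows "seq_less x y \<longleftrightarrow>
    (\<exists>\<alpha>. (\<forall>\<xi><\<alpha>. x \<xi> = y \<xi>) \<and>
      (\<exists>b. y \<alpha> = Some b \<and> (x \<alpha> = None \<or> (\<exists>a. x \<alpha> = Some a \<and> b < a))))"
    (is "_ \<longleftrightarrow> ?R")
proof
  assume "seq_less x y"
  then consider (ext) "x \<subseteq>\<^sub>m y" "x \<noteq> y"
    | (diff) \<alpha> where "\<alpha> \<in> dom x" "\<alpha> \<in> dom y" "\<forall>\<xi><\<alpha>. x \<xi> = y \<xi>" "the (y \<alpha>) < the (x \<alpha>)"
    unfolding seq_less_def by blast
  then show ?R
  proof cases
    case ext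
    then have ex: "\<exists>\<alpha>. x \<alpha> \<noteq> y \<alpha>" by blast
    define \<alpha> where "\<alpha> = (LEAST \<alpha>. x \<alpha> \<noteq> y \<alpha>)"
    have ne: "x \<alpha> \<noteq> y \<alpha>" unfolding \<alpha>_def using ex by (rule LeastI_ex)
    have below: "\<forall>\<xi><\<alpha>. x \<xi> = y \<xi>" unfolding \<alpha>_def using not_less_Least by blast
    have "x \<alpha> = None" using ext(1) ne by (auto simp: map_le_def dom_def)
    then show ?R using ne below by (metis not_None_eq)
  next
    case (diff \<alpha>)
    then show ?R by (intro exI[of _ \<alpha>]) auto
  qed
next
  assume ?R
  then obtain \<alpha> b where below: "\<forall>\<xi><\<alpha>. x \<xi> = y \<xi>" and b: "y \<alpha> = Some b"
    and x: "x \<alpha> = None \<or> (\<exists>a. x \<alpha> = Some a \<and> b < a)" by blast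
  from x show "seq_less x y"
  proof
    assume "x \<alpha> = None"
    then have "\<not> \<alpha> \<le> \<beta>" using assms(1) by auto
    then have "x \<subseteq>\<^sub>m y" using below assms(1) by (auto simp: map_le_def)
    moreover have "x \<noteq> y" using \<open>x \<alpha> = None\<close> b by auto
    ultimately show ?thesis by (simp add: seq_less_def)
  next
    assume "\<exists>a. x \<alpha> = Some a \<and> b < a"
    then show ?thesis unfolding seq_less_def using below b
      by (intro disjI2 bexI[of _ \<alpha>]) auto
  qed
qed

lemma seq_less_irrefl: "\<not> seq_less x x"
  by (simp add: seq_less_def)

lemma seq_less_trans:
  assumes "\<exists>\<beta>. dom x = {..\<beta>}" "\<exists>\<beta>. dom y = {..\<beta>}" "\<exists>\<beta>. dom z = {..\<beta>}"
    and "seq_less x y" "seq_less y z"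
  shows "seq_less x z"
proof -
  obtain \<beta> \<gamma> \<delta> where d: "dom x = {..\<beta>}" "dom y = {..\<gamma>}" "dom z = {..\<delta>}"
    using assms by blast
  obtain \<alpha> b where xy: "\<forall>\<xi><\<alpha>. x \<xi> = y \<xi>" "y \<alpha> = Some b"
    "x \<alpha> = None \<or> (\<exists>a. x \<alpha> = Some a \<and> b < a)"
    using assms(4) seq_less_iff_first_difference[OF d(1,2)] by blast
  obtain \<alpha>' c where yz: "\<forall>\<xi><\<alpha>'. y \<xi> = z \<xi>" "z \<alpha>' = Some c"
    "y \<alpha>' = None \<or> (\<exists>a. y \<alpha>' = Some a \<and> c < a)"
    using assms(5) seq_less_iff_first_difference[OF d(2,3)] by blast
  consider "\<alpha> < \<alpha>'" | "\<alpha> = \<alpha>'" | "\<alpha>' < \<alpha>" by fastforce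
  then have "\<exists>\<zeta>. (\<forall>\<xi><\<zeta>. x \<xi> = z \<xi>) \<and>
      (\<exists>b. z \<zeta> = Some b \<and> (x \<zeta> = None \<or> (\<exists>a. x \<zeta> = Some a \<and> b < a)))"
  proof cases
    case 1
    then show ?thesis using xy yz by (intro exI[of _ \<alpha>]) auto
  next
    case 2
    then show ?thesis using xy yz by (intro exI[of _ \<alpha>]) auto
  next
    case 3
    then show ?thesis using xy yz by (intro exI[of _ \<alpha>']) auto
  qed
  then show ?thesis using seq_less_iff_first_difference[OF d(1,3)] by blast
qed

lemma seq_less_total:
  assumes "\<exists>\<beta>. dom x = {..\<beta>}" "\<exists>\<beta>. dom y = {..\<beta>}" "x \<noteq> y"
  shows "seq_less x y \<or> seq_less y x"
proof -
  obtain \<beta> \<gamma> where d: "dom x = {..\<beta>}" "dom y = {..\<gamma>}"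
    using assms by blast
  have ex: "\<exists>\<alpha>. x \<alpha> \<noteq> y \<alpha>" using assms(3) by blast
  define \<alpha> where "\<alpha> = (LEAST \<alpha>. x \<alpha> \<noteq> y \<alpha>)"
  have ne: "x \<alpha> \<noteq> y \<alpha>" unfolding \<alpha>_def using ex by (rule LeastI_ex)
  have below: "\<forall>\<xi><\<alpha>. x \<xi> = y \<xi>" unfolding \<alpha>_def using not_less_Least by blast
  consider b where "x \<alpha> = None" "y \<alpha> = Some b" | a where "x \<alpha> = Some a" "y \<alpha> = None"
    | a b where "x \<alpha> = Some a" "y \<alpha> = Some b" "b < a"
    | a b where "x \<alpha> = Some a" "y \<alpha> = Some b" "a < b"
    using ne by (cases "x \<alpha>"; cases "y \<alpha>") (auto simp: neq_iff)
  then show ?thesis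
  proof cases
    case 1
    then show ?thesis
      using below
      unfolding seq_less_iff_first_difference[OF d] seq_less_iff_first_difference[OF d(2,1)]
      by (intro disjI1 exI[of _ \<alpha>]) simp
  next
    case 2
    then show ?thesis
      using below
      unfolding seq_less_iff_first_difference[OF d] seq_less_iff_first_difference[OF d(2,1)]
      by (intro disjI2 exI[of _ \<alpha>]) simp
  next
    case 3
    then show ?thesis
      using below
      unfolding seq_less_iff_first_difference[OF d] seq_less_iff_first_difference[OF d(2,1)]
      by (intro disjI1 exI[of _ \<alpha>]) simp
  next
    case 4
    then show ?thesis
      using below
      unfolding seq_less_iff_first_difference[OF d] seq_less_iff_first_difference[OF d(2,1)]
      by (intro disjI2 exI[of _ \<alpha>]) simp
  qed
qed

lemma dom_Rep_Z: "\<exists>\<beta>. dom (Rep_Z x) = {..\<beta>}"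
  using Rep_Z[of x] by blast

lemma dom_Rep_Y: "\<exists>\<beta>. dom (Rep_Y x) = {..\<beta>}"
  using Rep_Y[of x] by blast

instantiation Z :: linorder
begin

definition less_Z :: "Z \<Rightarrow> Z \<Rightarrow> bool" where
  "x < y \<longleftrightarrow> seq_less (Rep_Z x) (Rep_Z y)"

definition less_eq_Z :: "Z \<Rightarrow> Z \<Rightarrow> bool" where
  "less_eq_Z x y \<longleftrightarrow> x < y \<or> x = y"

instance
proof
  fix x y z :: Z
  note tr = seq_less_trans[OF dom_Rep_Z dom_Rep_Z dom_Rep_Z]
  note ord = less_eq_Z_def less_Z_def
  show "(x < y) = (x \<le> y \<and> \<not> y \<le> x)"
    unfolding ord using tr[of x y x] seq_less_irrefl by blast
  show "x \<le> x" by (simp add: ord)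
  show "x \<le> y \<Longrightarrow> y \<le> z \<Longrightarrow> x \<le> z"
    unfolding ord using tr[of x y z] by blast
  show "x \<le> y \<Longrightarrow> y \<le> x \<Longrightarrow> x = y"
    unfolding ord using tr[of x y x] seq_less_irrefl by blast
  show "x \<le> y \<or> y \<le> x"
    unfolding ord using seq_less_total[OF dom_Rep_Z dom_Rep_Z, of x y]
    by (auto simp: Rep_Z_inject)
qed

end

instantiation Z :: linorder_topology
begin

definition open_Z :: "Z set \<Rightarrow> bool" where
  "open_Z = generate_topology (range lessThan \<union> range greaterThan)"

instance
  by standard (simp add: open_Z_def)

end

instantiation Y :: linorder
begin

definition less_Y :: "Y \<Rightarrow> Y \<Rightarrow> bool" where
  "x < y \<longleftrightarrow> seq_less (Rep_Y x) (Rep_Y y)"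

definition less_eq_Y :: "Y \<Rightarrow> Y \<Rightarrow> bool" where
  "less_eq_Y x y \<longleftrightarrow> x < y \<or> x = y"

instance
proof
  fix x y z :: Y
  note tr = seq_less_trans[OF dom_Rep_Y dom_Rep_Y dom_Rep_Y]
  note ord = less_eq_Y_def less_Y_def
  show "(x < y) = (x \<le> y \<and> \<not> y \<le> x)"
    unfolding ord using tr[of x y x] seq_less_irrefl by blast
  show "x \<le> x" by (simp add: ord)
  show "x \<le> y \<Longrightarrow> y \<le> z \<Longrightarrow> x \<le> z"
    unfolding ord using tr[of x y z] by blast
  show "x \<le> y \<Longrightarrow> y \<le> x \<Longrightarrow> x = y"
    unfolding ord using tr[of x y x] seq_less_irrefl by blast
  show "x \<le> y \<or> y \<le> x"
    unfolding ord using seq_less_total[OF dom_Rep_Y dom_Rep_Y, of x y]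
    by (auto simp: Rep_Y_inject)
qed

end


section \<open>Trees\<close>

definition (in order) well_ordered :: "'a set \<Rightarrow> bool" where
  "well_ordered A \<longleftrightarrow> well_order_on A {(x, y). x \<in> A \<and> y \<in> A \<and> x \<le> y}"

class tree = order +
  assumes well_ordered_atMost: "well_ordered {..t}"

definition imm_succs :: "'a::tree \<Rightarrow> 'a set" where
  "imm_succs t = {u. t < u \<and> \<not> (\<exists>v. t < v \<and> v < u)}"

class interval_topology_tree = tree + topological_space +
  assumes open_interval_topology:
    "open = generate_topology (range atMost \<union> range (\<lambda>t. - {..t}))"

definition Z_bad :: "('a::tree \<Rightarrow> Z) \<Rightarrow> 'a \<Rightarrow> bool" where
  "Z_bad \<rho> t \<longleftrightarrow>
     (\<exists>u :: nat \<Rightarrow> 'a. inj u \<and> range u \<subseteq> imm_succs t \<and> (\<lambda>n. \<rho> (u n)) \<longlonglongrightarrow> \<rho> t)"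


section \<open>The tree of well-ordered subsets of a linear order\<close>

definition initial_segment :: "'a::order set \<Rightarrow> 'a set \<Rightarrow> bool" where
  "initial_segment A B \<longleftrightarrow> A \<subseteq> B \<and> (\<forall>a\<in>A. \<forall>b\<in>B. b \<le> a \<longrightarrow> b \<in> A)"

text \<open>The empty set is well-ordered, so it is the root of \<open>'a sigma\<close>.\<close>

typedef (overloaded) 'a sigma = "{A :: 'a::linorder set. well_ordered A}"
proof -
  have "well_ordered ({} :: 'a set)"
    by (simp add: well_ordered_def order_on_defs well_order_on_def)
  then show ?thesis by blast
qed

instantiation sigma :: (linorder) order
begin

definition less_eq_sigma :: "'a sigma \<Rightarrow> 'a sigma \<Rightarrow> bool" where
  "A \<le> B \<longleftrightarrow> initial_segment (Rep_sigma A) (Rep_sigma B)"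

definition less_sigma :: "'a sigma \<Rightarrow> 'a sigma \<Rightarrow> bool" where
  "less_sigma A B \<longleftrightarrow> A \<le> B \<and> A \<noteq> B"

instance
proof
  fix x y z :: "'a sigma"
  show "x \<le> x" by (simp add: less_eq_sigma_def initial_segment_def)
  show "x \<le> y \<Longrightarrow> y \<le> z \<Longrightarrow> x \<le> z"
    unfolding less_eq_sigma_def initial_segment_def by (meson subset_iff)
  have anti: "x \<le> y \<Longrightarrow> y \<le> x \<Longrightarrow> x = y"
    unfolding less_eq_sigma_def initial_segment_def
    by (metis Rep_sigma_inject subset_antisym)
  then show "x \<le> y \<Longrightarrow> y \<le> x \<Longrightarrow> x = y" .
  show "(x < y) = (x \<le> y \<and> \<not> y \<le> x)"
    using anti \<open>x \<le> x\<close> unfolding less_sigma_def by metis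
qed

end

lemma well_ordered_iff_least:
  fixes A :: "'a::order set"
  shows "well_ordered A \<longleftrightarrow> (\<forall>B\<subseteq>A. B \<noteq> {} \<longrightarrow> (\<exists>b\<in>B. \<forall>c\<in>B. b \<le> c))"
proof
  assume L: "well_ordered A"
  let ?r = "{(x, y). x \<in> A \<and> y \<in> A \<and> x \<le> y}"
  from L have wf: "wf (?r - Id)" and tot: "total_on A ?r"
    by (auto simp: well_ordered_def well_order_on_def order_on_defs)
  show "\<forall>B\<subseteq>A. B \<noteq> {} \<longrightarrow> (\<exists>b\<in>B. \<forall>c\<in>B. b \<le> c)"
  proof (intro allI impI)
    fix B assume B: "B \<subseteq> A" "B \<noteq> {}"
    then obtain b where b: "b \<in> B" "\<And>c. (c, b) \<in> ?r - Id \<Longrightarrow> c \<notin> B"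
      using wf unfolding wf_eq_minimal by blast
    have "b \<le> c" if "c \<in> B" for c
    proof (cases "c = b")
      case False
      have "b \<in> A" "c \<in> A" using B(1) b(1) that by blast+
      then have "b \<le> c \<or> c \<le> b"
        using tot False unfolding total_on_def by blast
      moreover have "\<not> c \<le> b"
        using b(2)[of c] that False \<open>b \<in> A\<close> \<open>c \<in> A\<close> by blast
      ultimately show ?thesis by blast
    qed simp
    then show "\<exists>b\<in>B. \<forall>c\<in>B. b \<le> c" using b(1) by blast
  qed
next
  assume R: "\<forall>B\<subseteq>A. B \<noteq> {} \<longrightarrow> (\<exists>b\<in>B. \<forall>c\<in>B. b \<le> c)"
  let ?r = "{(x, y). x \<in> A \<and> y \<in> A \<and> x \<le> y}"
  have "total_on A ?r"
  proof (rule total_onI)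
    fix x y assume "x \<in> A" "y \<in> A" "x \<noteq> y"
    then show "(x, y) \<in> ?r \<or> (y, x) \<in> ?r"
      using R[rule_format, of "{x, y}"] by auto
  qed
  moreover have "wf (?r - Id)"
    unfolding wf_eq_minimal
  proof (intro allI impI)
    fix Q and q :: 'a assume q: "q \<in> Q"
    show "\<exists>z\<in>Q. \<forall>y. (y, z) \<in> ?r - Id \<longrightarrow> y \<notin> Q"
    proof (cases "Q \<inter> A = {}")
      case True
      then show ?thesis using q by blast
    next
      case False
      then obtain b where "b \<in> Q \<inter> A" "\<forall>c\<in>Q \<inter> A. b \<le> c"
        using R[rule_format, of "Q \<inter> A"] by blast
      then show ?thesis by (intro bexI[of _ b]) (auto intro: order.antisym)
    qed
  qed
  moreover have "refl_on A ?r" "?r \<subseteq> A \<times> A" by (auto simp: refl_on_def)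
  moreover have "trans ?r" by (rule transI) auto
  moreover have "antisym ?r" by (rule antisymI) auto
  ultimately show "well_ordered A"
    unfolding well_ordered_def well_order_on_def linear_order_on_def partial_order_on_def
      preorder_on_def by blast
qed

lemma sigma_le_subset: "A \<le> B \<Longrightarrow> x \<in> Rep_sigma A \<Longrightarrow> x \<in> Rep_sigma B"
  unfolding less_eq_sigma_def initial_segment_def by blast

lemma sigma_le_down:
  "A \<le> B \<Longrightarrow> a \<in> Rep_sigma A \<Longrightarrow> b \<in> Rep_sigma B \<Longrightarrow> b \<le> a \<Longrightarrow> b \<in> Rep_sigma A"
  unfolding less_eq_sigma_def initial_segment_def by blast

lemma sigma_le_linear_below:
  fixes A B t :: "'a::linorder sigma"
  assumes "A \<le> t" "B \<le> t" and sub: "\<And>x. x \<in> Rep_sigma A \<Longrightarrow> x \<in> Rep_sigma B"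
  shows "A \<le> B"
  unfolding less_eq_sigma_def initial_segment_def
proof (intro conjI subsetI ballI impI)
  show "x \<in> Rep_sigma B" if "x \<in> Rep_sigma A" for x using that by (rule sub)
  show "b \<in> Rep_sigma A" if "a \<in> Rep_sigma A" "b \<in> Rep_sigma B" "b \<le> a" for a b
    using sigma_le_down[OF assms(1) that(1) sigma_le_subset[OF assms(2) that(2)] that(3)] .
qed

instance sigma :: (linorder) tree
proof
  fix t :: "'a sigma"
  show "well_ordered {..t}"
    unfolding well_ordered_iff_least
  proof (intro allI impI)
    fix \<B> :: "'a sigma set"
    assume sub: "\<B> \<subseteq> {..t}" and ne: "\<B> \<noteq> {}"
    have le: "B \<le> t" if "B \<in> \<B>" for B using that sub by blast
    let ?D = "{x \<in> Rep_sigma t. \<exists>B\<in>\<B>. x \<notin> Rep_sigma B}"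
    show "\<exists>B\<in>\<B>. \<forall>C\<in>\<B>. B \<le> C"
    proof (cases "?D = {}")
      case True
      obtain B where B: "B \<in> \<B>" using ne by blast
      have "B \<le> C" if C: "C \<in> \<B>" for C
      proof (rule sigma_le_linear_below[OF le[OF B] le[OF C]])
        fix x assume "x \<in> Rep_sigma B"
        then have "x \<in> Rep_sigma t" by (rule sigma_le_subset[OF le[OF B]])
        then show "x \<in> Rep_sigma C" using True C by blast
      qed
      then show ?thesis using B by blast
    next
      case False
      have "well_ordered (Rep_sigma t)" using Rep_sigma[of t] by simp
      moreover have "?D \<subseteq> Rep_sigma t" by blast
      ultimately have "\<exists>d\<in>?D. \<forall>e\<in>?D. d \<le> e"
        using False unfolding well_ordered_iff_least by presburger
      then obtain d where d: "d \<in> ?D" and least: "\<And>e. e \<in> ?D \<Longrightarrow> d \<le> e" by blast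
      then obtain B where B: "B \<in> \<B>" "d \<notin> Rep_sigma B" and dt: "d \<in> Rep_sigma t" by blast
      have "B \<le> C" if C: "C \<in> \<B>" for C
      proof (rule sigma_le_linear_below[OF le[OF B(1)] le[OF C]])
        fix x assume x: "x \<in> Rep_sigma B"
        have xt: "x \<in> Rep_sigma t" using x by (rule sigma_le_subset[OF le[OF B(1)]])
        have "\<not> d \<le> x" using sigma_le_down[OF le[OF B(1)] x dt] B(2) by blast
        then show "x \<in> Rep_sigma C" using least[of x] xt C by blast
      qed
      then show ?thesis using B(1) by blast
    qed
  qed
qed

instantiation sigma :: (linorder) interval_topology_tree
begin

definition open_sigma :: "'a sigma set \<Rightarrow> bool" where
  "open_sigma = generate_topology (range atMost \<union> range (\<lambda>t. - {..t}))"

instance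
proof (intro_classes, goal_cases)
  case 1
  then show ?case
    unfolding open_sigma_def by (rule generate_topology.UNIV)
next
  case (2 S T)
  then show ?case
    unfolding open_sigma_def by (rule generate_topology.Int)
next
  case (3 K)
  then show ?case
    unfolding open_sigma_def by (auto intro: generate_topology.UN)
next
  case 4
  show ?case by (rule open_sigma_def)
qed

end


section \<open>Continuous functions vanishing at infinity\<close>

definition vanishes_at_infinity :: "('a::topological_space \<Rightarrow> real) \<Rightarrow> bool" where
  "vanishes_at_infinity f \<longleftrightarrow> (\<forall>e>0. \<exists>K. compact K \<and> (\<forall>t. t \<notin> K \<longrightarrow> \<bar>f t\<bar> < e))"

lemma vanishes_at_infinityE:
  assumes "vanishes_at_infinity f" "0 < e"
  obtains K where "compact K" "\<And>t. t \<notin> K \<Longrightarrow> \<bar>f t\<bar> < e"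
  using assms unfolding vanishes_at_infinity_def by blast

lemma vanishes_at_infinity_0: "vanishes_at_infinity (\<lambda>_. 0)"
  unfolding vanishes_at_infinity_def by (intro allI impI exI[of _ "{}"]) simp

lemma vanishes_at_infinity_add:
  assumes "vanishes_at_infinity f" "vanishes_at_infinity g"
  shows "vanishes_at_infinity (\<lambda>t. f t + g t)"
  unfolding vanishes_at_infinity_def
proof (intro allI impI)
  fix e :: real assume "0 < e"
  then have e2: "0 < e / 2" by simp
  obtain K where K: "compact K" "\<And>t. t \<notin> K \<Longrightarrow> \<bar>f t\<bar> < e / 2"
    using vanishes_at_infinityE[OF assms(1) e2] by blast
  obtain L where L: "compact L" "\<And>t. t \<notin> L \<Longrightarrow> \<bar>g t\<bar> < e / 2"
    using vanishes_at_infinityE[OF assms(2) e2] by blast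
  have "\<bar>f t + g t\<bar> < e" if "t \<notin> K \<union> L" for t
  proof -
    have "\<bar>f t\<bar> < e / 2" "\<bar>g t\<bar> < e / 2" using K(2)[of t] L(2)[of t] that by auto
    then show ?thesis by linarith
  qed
  then show "\<exists>K. compact K \<and> (\<forall>t. t \<notin> K \<longrightarrow> \<bar>f t + g t\<bar> < e)"
    using compact_Un[OF K(1) L(1)] by blast
qed

lemma vanishes_at_infinity_scale:
  assumes "vanishes_at_infinity f"
  shows "vanishes_at_infinity (\<lambda>t. c * f t)"
  unfolding vanishes_at_infinity_def
proof (intro allI impI)
  fix e :: real assume "0 < e"
  then have e': "0 < e / (\<bar>c\<bar> + 1)" by simp
  obtain K where K: "compact K" "\<And>t. t \<notin> K \<Longrightarrow> \<bar>f t\<bar> < e / (\<bar>c\<bar> + 1)"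
    using vanishes_at_infinityE[OF assms e'] by blast
  have "\<bar>c * f t\<bar> < e" if "t \<notin> K" for t
  proof -
    have "\<bar>c * f t\<bar> \<le> (\<bar>c\<bar> + 1) * \<bar>f t\<bar>"
      by (simp add: abs_mult mult_right_mono)
    also have "\<dots> < e"
      using K(2)[OF that] by (simp add: pos_less_divide_eq mult.commute)
    finally show ?thesis .
  qed
  then show "\<exists>K. compact K \<and> (\<forall>t. t \<notin> K \<longrightarrow> \<bar>c * f t\<bar> < e)"
    using K(1) by blast
qed

text \<open>
  By the next lemma, starting from the type of bounded continuous functions, whose norm is the
  supremum norm, excludes nothing.
\<close>

lemma vanishes_at_infinity_bcontfun:
  fixes f :: "'a::topological_space \<Rightarrow> real"
  assumes cont: "continuous_on UNIV f" and van: "vanishes_at_infinity f"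
  shows "f \<in> bcontfun"
proof -
  obtain K where K: "compact K" "\<And>t. t \<notin> K \<Longrightarrow> \<bar>f t\<bar> < 1"
    using vanishes_at_infinityE[OF van zero_less_one] by blast
  have "compact (f ` K)"
    using continuous_on_subset[OF cont subset_UNIV] K(1) by (rule compact_continuous_image)
  then have "bounded (f ` K)" by (rule compact_imp_bounded)
  then obtain B where B: "\<And>t. t \<in> K \<Longrightarrow> \<bar>f t\<bar> \<le> B"
    unfolding bounded_iff by auto
  have "norm (f t) \<le> max B 1" for t
    using B[of t] K(2)[of t] by (cases "t \<in> K") auto
  with cont show ?thesis by (rule bcontfun_normI)
qed

typedef (overloaded) 'a C0 =
  "{f :: 'a::topological_space \<Rightarrow>\<^sub>C real. vanishes_at_infinity (apply_bcontfun f)}"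
proof -
  have "apply_bcontfun (0 :: 'a \<Rightarrow>\<^sub>C real) = (\<lambda>_. 0)" by auto
  then have "(0 :: 'a \<Rightarrow>\<^sub>C real) \<in> {f. vanishes_at_infinity (apply_bcontfun f)}"
    using vanishes_at_infinity_0 by simp
  then show ?thesis by blast
qed

lemma vanishes_Rep_C0: "vanishes_at_infinity (apply_bcontfun (Rep_C0 f))"
  using Rep_C0[of f] by simp

instantiation C0 :: (topological_space) real_normed_vector
begin

definition zero_C0 :: "'a C0" where
  "zero_C0 = Abs_C0 0"

definition plus_C0 :: "'a C0 \<Rightarrow> 'a C0 \<Rightarrow> 'a C0" where
  "plus_C0 f g = Abs_C0 (Rep_C0 f + Rep_C0 g)"

definition scaleR_C0 :: "real \<Rightarrow> 'a C0 \<Rightarrow> 'a C0" where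
  "scaleR_C0 c f = Abs_C0 (c *\<^sub>R Rep_C0 f)"

definition uminus_C0 :: "'a C0 \<Rightarrow> 'a C0" where
  "uminus_C0 f = Abs_C0 (- Rep_C0 f)"

definition minus_C0 :: "'a C0 \<Rightarrow> 'a C0 \<Rightarrow> 'a C0" where
  "minus_C0 f g = Abs_C0 (Rep_C0 f - Rep_C0 g)"

definition norm_C0 :: "'a C0 \<Rightarrow> real" where
  "norm_C0 f = norm (Rep_C0 f)"

definition dist_C0 :: "'a C0 \<Rightarrow> 'a C0 \<Rightarrow> real" where
  "dist_C0 f g = dist (Rep_C0 f) (Rep_C0 g)"

definition sgn_C0 :: "'a C0 \<Rightarrow> 'a C0" where
  "sgn_C0 f = inverse (norm f) *\<^sub>R f"

definition uniformity_C0 :: "('a C0 \<times> 'a C0) filter" where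
  "uniformity_C0 = (INF e\<in>{0<..}. principal {(f, g). dist f g < e})"

definition open_C0 :: "'a C0 set \<Rightarrow> bool" where
  "open_C0 U \<longleftrightarrow> (\<forall>f\<in>U. \<forall>\<^sub>F (f', g) in uniformity. f' = f \<longrightarrow> g \<in> U)"

lemma Rep_C0_zero: "Rep_C0 (0 :: 'a C0) = 0"
proof -
  have "apply_bcontfun (0 :: 'a \<Rightarrow>\<^sub>C real) = (\<lambda>_. 0)" by auto
  then show ?thesis
    unfolding zero_C0_def by (intro Abs_C0_inverse) (simp add: vanishes_at_infinity_0)
qed

lemma Rep_C0_plus: "Rep_C0 (f + g :: 'a C0) = Rep_C0 f + Rep_C0 g"
proof -
  have "apply_bcontfun (Rep_C0 f + Rep_C0 g) =
      (\<lambda>t. apply_bcontfun (Rep_C0 f) t + apply_bcontfun (Rep_C0 g) t)" by auto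
  then show ?thesis
    unfolding plus_C0_def
    by (intro Abs_C0_inverse) (simp add: vanishes_at_infinity_add vanishes_Rep_C0)
qed

lemma Rep_C0_scaleR: "Rep_C0 (c *\<^sub>R f :: 'a C0) = c *\<^sub>R Rep_C0 f"
proof -
  have "apply_bcontfun (c *\<^sub>R Rep_C0 f) = (\<lambda>t. c * apply_bcontfun (Rep_C0 f) t)" by auto
  then show ?thesis
    unfolding scaleR_C0_def
    by (intro Abs_C0_inverse) (simp add: vanishes_at_infinity_scale vanishes_Rep_C0)
qed

lemma uminus_C0_scaleR: "- f = (-1) *\<^sub>R (f :: 'a C0)"
  by (simp add: uminus_C0_def scaleR_C0_def)

lemma minus_C0_plus: "f - g = f + - (g :: 'a C0)"
  by (simp add: minus_C0_def plus_C0_def uminus_C0_scaleR Rep_C0_scaleR)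

lemma Rep_C0_uminus: "Rep_C0 (- f :: 'a C0) = - Rep_C0 f"
  by (simp add: uminus_C0_scaleR Rep_C0_scaleR)

lemma Rep_C0_minus: "Rep_C0 (f - g :: 'a C0) = Rep_C0 f - Rep_C0 g"
  by (simp add: minus_C0_plus Rep_C0_plus Rep_C0_uminus)

lemmas Rep_C0_simps = Rep_C0_zero Rep_C0_plus Rep_C0_scaleR Rep_C0_uminus Rep_C0_minus

instance
proof
  fix f g h :: "'a C0" and a b :: real
  note eqI = Rep_C0_inject[THEN iffD1]
  show "f + g + h = f + (g + h)" by (rule eqI) (simp only: Rep_C0_simps add.assoc)
  show "f + g = g + f" by (rule eqI) (simp only: Rep_C0_simps add.commute)
  show "0 + f = f" by (rule eqI) (simp only: Rep_C0_simps add_0)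
  show "- f + f = 0" by (rule eqI) (simp only: Rep_C0_simps left_minus)
  show "f - g = f + - g" by (rule minus_C0_plus)
  show "a *\<^sub>R (f + g) = a *\<^sub>R f + a *\<^sub>R g"
    by (rule eqI) (simp only: Rep_C0_simps scaleR_add_right)
  show "(a + b) *\<^sub>R f = a *\<^sub>R f + b *\<^sub>R f"
    by (rule eqI) (simp only: Rep_C0_simps scaleR_add_left)
  show "a *\<^sub>R b *\<^sub>R f = (a * b) *\<^sub>R f" by (rule eqI) (simp only: Rep_C0_simps scaleR_scaleR)
  show "1 *\<^sub>R f = f" by (rule eqI) (simp only: Rep_C0_simps scaleR_one)
  show "dist f g = norm (f - g)"
    by (simp only: dist_C0_def norm_C0_def Rep_C0_simps dist_norm)
  show "sgn f = inverse (norm f) *\<^sub>R f" by (rule sgn_C0_def)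
  show "(uniformity :: ('a C0 \<times> 'a C0) filter) = (INF e\<in>{0<..}. principal {(x, y). dist x y < e})"
    by (rule uniformity_C0_def)
  show "open U = (\<forall>x\<in>U. \<forall>\<^sub>F (x', y) in uniformity. x' = x \<longrightarrow> y \<in> U)" for U :: "'a C0 set"
    by (rule open_C0_def)
  show "(norm f = 0) = (f = 0)"
    by (simp only: norm_C0_def norm_eq_zero Rep_C0_zero[symmetric] Rep_C0_inject)
  show "norm (f + g) \<le> norm f + norm g"
    by (simp only: norm_C0_def Rep_C0_simps norm_triangle_ineq)
  show "norm (a *\<^sub>R f) = \<bar>a\<bar> * norm f"
    by (simp only: norm_C0_def Rep_C0_simps norm_scaleR)
qed

end

instance C0 :: (topological_space) banach
proof
  fix X :: "nat \<Rightarrow> 'a C0"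
  assume X: "Cauchy X"
  let ?F = "\<lambda>n. apply_bcontfun (Rep_C0 (X n))"
  have "uniformly_Cauchy_on UNIV ?F"
    unfolding uniformly_Cauchy_on_def
  proof (intro allI impI)
    fix e :: real assume "e > 0"
    then obtain M where M: "\<forall>m\<ge>M. \<forall>n\<ge>M. dist (X m) (X n) < e"
      using X unfolding Cauchy_def by blast
    have "dist (?F m t) (?F n t) < e" if "m \<ge> M" "n \<ge> M" for m n t
    proof (rule dist_fun_lt_imp_dist_val_lt)
      show "dist (Rep_C0 (X m)) (Rep_C0 (X n)) < e"
        using M that unfolding dist_C0_def by blast
    qed
    then show "\<exists>M. \<forall>x\<in>UNIV. \<forall>m\<ge>M. \<forall>n\<ge>M. dist (?F m x) (?F n x) < e" by blast
  qed
  then obtain l where l: "uniform_limit UNIV ?F l sequentially"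
    using Cauchy_uniformly_convergent unfolding uniformly_convergent_on_def by blast
  obtain L where lL: "l = apply_bcontfun L" and lim: "(\<lambda>n. Rep_C0 (X n)) \<longlonglongrightarrow> L"
    using uniform_limit_bcontfunE[OF l sequentially_bot] by metis
  have "vanishes_at_infinity (apply_bcontfun L)"
    unfolding vanishes_at_infinity_def
  proof (intro allI impI)
    fix e :: real assume "e > 0"
    then have e2: "0 < e / 2" by simp
    obtain n where n: "dist (Rep_C0 (X n)) L < e / 2"
      using tendstoD[OF lim e2] unfolding eventually_sequentially by blast
    obtain K where K: "compact K" "\<And>t. t \<notin> K \<Longrightarrow> \<bar>?F n t\<bar> < e / 2"
      using vanishes_at_infinityE[OF vanishes_Rep_C0 e2] by blast
    have "\<bar>apply_bcontfun L t\<bar> < e" if "t \<notin> K" for t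
    proof -
      have "\<bar>?F n t - apply_bcontfun L t\<bar> < e / 2"
        using dist_fun_lt_imp_dist_val_lt[OF n, of t] unfolding dist_real_def .
      with K(2)[OF that] show ?thesis by linarith
    qed
    then show "\<exists>K. compact K \<and> (\<forall>t. t \<notin> K \<longrightarrow> \<bar>apply_bcontfun L t\<bar> < e)"
      using K(1) by blast
  qed
  then have RL: "Rep_C0 (Abs_C0 L) = L"
    by (intro Abs_C0_inverse) simp
  have "X \<longlonglongrightarrow> Abs_C0 L"
  proof (rule tendstoI)
    fix e :: real assume "e > 0"
    then show "\<forall>\<^sub>F n in sequentially. dist (X n) (Abs_C0 L) < e"
      using tendstoD[OF lim] unfolding dist_C0_def RL by blast
  qed
  then show "convergent X" unfolding convergent_def by blast
qed


section \<open>Equivalent norms and smoothness\<close>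

definition equivalent_norm :: "('a::real_normed_vector \<Rightarrow> real) \<Rightarrow> bool" where
  "equivalent_norm N \<longleftrightarrow>
     (\<forall>x. N x = 0 \<longleftrightarrow> x = 0) \<and>
     (\<forall>x y. N (x + y) \<le> N x + N y) \<and>
     (\<forall>a x. N (a *\<^sub>R x) = \<bar>a\<bar> * N x) \<and>
     (\<exists>c>0. \<exists>C>0. \<forall>x. c * norm x \<le> N x \<and> N x \<le> C * norm x)"

definition gateaux_smooth :: "('a::real_normed_vector \<Rightarrow> real) \<Rightarrow> bool" where
  "gateaux_smooth N \<longleftrightarrow>
     (\<forall>x. x \<noteq> 0 \<longrightarrow>
       (\<exists>D :: 'a \<Rightarrow>\<^sub>L real. \<forall>h.
         ((\<lambda>r. (N (x + r *\<^sub>R h) - N x) / r) \<longlongrightarrow> blinfun_apply D h) (at 0)))"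

end

theory Submission
  imports Defs
begin

text \<open>
  Let \<open>\<rho>\<close> be an increasing map from \<open>\<sigma>Y\<close> to \<open>Z\<close>, and choose by Zorn's lemma a maximal \<open>t\<close> all of whose
  elements are below \<open>\<rho> t\<close>. If \<open>y \<in> Y\<close> lies above \<open>\<rho> t\<close>, then \<open>\<rho> (t \<union> {y}) \<le> y\<close> by maximality
  (Kurepa's argument). As \<open>\<rho> t\<close> is the limit from above of a sequence in \<open>Y\<close>, the point \<open>t\<close> is \<open>Z\<close>-bad.
  On the other hand bounded subsets of \<open>Z\<close> have least upper bounds, and there are disjoint closed
  intervals \<open>[\<phi> y, \<psi> y]\<close> of \<open>Z\<close>, increasing with \<open>y \<in> Y\<close>; hence mapping \<open>t\<close> to the supremum of
  \<open>{\<psi> y | y \<in> t}\<close> is strictly increasing.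

  A norm \<open>N \<ge> c \<parallel>\<cdot>\<parallel>\<close> yields an increasing \<open>\<rho>\<close> as follows. For every \<open>t\<close> build a nondecreasing function
  \<open>F\<close> on \<open>(0,t]\<close> greedily: as soon as every extension of \<open>F\<close> beyond a point \<open>r\<close> has norm at least
  \<open>1 + c/2 F(r)\<close>, raise the value after \<open>r\<close> to the largest \<open>b\<close> for which the function that is
  equal to \<open>b\<close> on \<open>(r,t]\<close> has extensions beyond \<open>t\<close> of norm about \<open>1 + c/2 b\<close>; stop if \<open>b = F(r)\<close>.
  The values of \<open>F\<close>, with the last one doubled if the construction stopped, form \<open>\<rho> t \<in> Z\<close>. At
  Kurepa's point \<open>t\<close> the construction must have stopped, because the values are bounded. Averaging
  almost optimal extensions over infinitely many immediate successors of \<open>t\<close> shows that \<open>F\<close> itself has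
  norm \<open>1 + c/2 F(t)\<close>, and then the derivative of \<open>N\<close> at \<open>F\<close> in the direction of \<open>1\<^bsub>(r,t]\<^esub>\<close>
  would have to be both \<open>0\<close> and at least \<open>c/2\<close>.
\<close>

section \<open>Countable ordinals and the order of \<open>Z\<close>\<close>

definition is_lim :: "'a::order \<Rightarrow> bool" where
  "is_lim s \<longleftrightarrow> (\<exists>q. q < s) \<and> (\<forall>q<s. \<exists>p<s. q < p)"

lemma omega1_no_max: "\<exists>\<eta>. (\<xi>::omega1) < \<eta>"
proof (rule ccontr)
  assume "\<nexists>\<eta>. \<xi> < \<eta>"
  then have "(UNIV :: omega1 set) = {..\<xi>}" by (auto simp: not_less)
  then show False using countable_atMost_omega1[of \<xi>] uncountable_UNIV_omega1 by simp
qed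

lemma omega1_next:
  obtains \<sigma> where "(\<xi>::omega1) < \<sigma>" "\<And>\<eta>. \<eta> < \<sigma> \<longleftrightarrow> \<eta> \<le> \<xi>"
proof
  let ?s = "LEAST \<eta>. \<xi> < \<eta>"
  show "\<xi> < ?s" using LeastI_ex[OF omega1_no_max] .
  then show "\<eta> < ?s \<longleftrightarrow> \<eta> \<le> \<xi>" for \<eta>
    using not_less_Least[of \<eta> "\<lambda>\<eta>. \<xi> < \<eta>"] by (auto simp: not_less)
qed

text \<open>A rational between each value and the value at the next ordinal would inject
  \<open>omega1\<close> into the rationals. This is what forces the transfinite recursions below to
  stop at a countable stage.\<close>

lemma no_strict_mono_omega1_real:
  fixes f :: "omega1 \<Rightarrow> real"
  assumes "\<And>\<zeta> \<xi>. \<zeta> < \<xi> \<Longrightarrow> f \<zeta> < f \<xi>"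
  shows False
proof -
  have "\<exists>q::rat. f \<xi> < of_rat q \<and> (\<forall>\<eta>>\<xi>. of_rat q < f \<eta>)" for \<xi>
  proof -
    obtain \<sigma> where s: "\<xi> < \<sigma>" "\<And>\<eta>. \<eta> < \<sigma> \<longleftrightarrow> \<eta> \<le> \<xi>" by (rule omega1_next[of \<xi>]) blast
    obtain q where q: "f \<xi> < of_rat q" "of_rat q < f \<sigma>"
      using of_rat_dense[OF assms[OF s(1)]] by blast
    have "of_rat q < f \<eta>" if "\<xi> < \<eta>" for \<eta>
    proof (cases \<eta> \<sigma> rule: linorder_cases)
      case less
      then show ?thesis using s(2)[of \<eta>] that by simp
    next
      case equal
      then show ?thesis using q(2) by simp
    next
      case greater
      then show ?thesis using q(2) assms[OF greater] by linarith
    qed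
    then show ?thesis using q(1) by blast
  qed
  then obtain q :: "omega1 \<Rightarrow> rat"
    where q: "\<And>\<xi>. f \<xi> < of_rat (q \<xi>)" "\<And>\<xi> \<eta>. \<xi> < \<eta> \<Longrightarrow> of_rat (q \<xi>) < f \<eta>" by metis
  have lt: "q \<xi> < q \<eta>" if "\<xi> < \<eta>" for \<xi> \<eta>
    using q(2)[OF that] q(1)[of \<eta>] by (metis less_trans of_rat_less)
  have "inj q" by (rule injI) (metis lt less_irrefl linorder_neqE)
  then have "countable (UNIV :: omega1 set)" using countableI' by blast
  then show False using uncountable_UNIV_omega1 by blast
qed

text \<open>The sets \<open>{..\<xi>}\<close> are open in \<open>omega1\<close>, so only points to
  the left of \<open>\<xi>\<close> matter. Non-limit points are isolated, and at a limit
  monotonicity reduces convergence to finding a single good \<open>\<zeta>\<close>.\<close>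

lemma continuous_on_omega1_iff:
  fixes g :: "omega1 \<Rightarrow> real"
  assumes mono: "mono_on {..\<beta>} g"
  shows "continuous_on {..\<beta>} g \<longleftrightarrow>
    (\<forall>\<xi>\<le>\<beta>. is_lim \<xi> \<longrightarrow> (\<forall>e>0. \<exists>\<zeta><\<xi>. g \<xi> - e < g \<zeta>))"
proof
  assume cont: "continuous_on {..\<beta>} g"
  show "\<forall>\<xi>\<le>\<beta>. is_lim \<xi> \<longrightarrow> (\<forall>e>0. \<exists>\<zeta><\<xi>. g \<xi> - e < g \<zeta>)"
  proof (intro allI impI)
    fix \<xi> and e :: real assume \<xi>: "\<xi> \<le> \<beta>" "is_lim \<xi>" "0 < e"
    have "(g \<longlongrightarrow> g \<xi>) (at \<xi> within {..\<beta>})"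
      using cont \<xi>(1) unfolding continuous_on_def by blast
    then have "\<forall>\<^sub>F \<eta> in at \<xi> within {..\<beta>}. g \<xi> - e < g \<eta>"
      by (rule order_tendstoD) (use \<xi> in simp)
    then obtain S where S: "open S" "\<xi> \<in> S"
      "\<And>\<eta>. \<eta> \<in> S \<Longrightarrow> \<eta> \<noteq> \<xi> \<Longrightarrow> \<eta> \<le> \<beta> \<Longrightarrow> g \<xi> - e < g \<eta>"
      unfolding eventually_at_topological by auto
    obtain q where "q < \<xi>" using \<xi>(2) unfolding is_lim_def by blast
    then obtain b where b: "b < \<xi>" "{b<..\<xi>} \<subseteq> S" using open_left[OF S(1,2)] by blast
    obtain p where "p < \<xi>" "b < p" using \<xi>(2) b(1) unfolding is_lim_def by blast
    moreover have "p \<in> S" using calculation b by auto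
    ultimately show "\<exists>\<zeta><\<xi>. g \<xi> - e < g \<zeta>" using S(3)[of p] \<xi>(1) by auto
  qed
next
  assume lim: "\<forall>\<xi>\<le>\<beta>. is_lim \<xi> \<longrightarrow> (\<forall>e>0. \<exists>\<zeta><\<xi>. g \<xi> - e < g \<zeta>)"
  show "continuous_on {..\<beta>} g"
    unfolding continuous_on_def
  proof (intro ballI tendstoI)
    fix \<xi> and e :: real assume \<xi>: "\<xi> \<in> {..\<beta>}" and e: "0 < e"
    obtain \<sigma> where s: "\<xi> < \<sigma>" "\<And>\<eta>. \<eta> < \<sigma> \<longleftrightarrow> \<eta> \<le> \<xi>" by (rule omega1_next[of \<xi>]) blast
    have "\<exists>S. open S \<and> \<xi> \<in> S \<and> (\<forall>\<eta>\<in>S. \<eta> \<le> \<xi> \<and> (\<eta> \<noteq> \<xi> \<longrightarrow> dist (g \<eta>) (g \<xi>) < e))"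
    proof (cases "is_lim \<xi>")
      case True
      then obtain \<zeta> where z: "\<zeta> < \<xi>" "g \<xi> - e < g \<zeta>" using lim \<xi> e by auto
      have "dist (g \<eta>) (g \<xi>) < e" if "\<zeta> < \<eta>" "\<eta> \<le> \<xi>" for \<eta>
      proof -
        have "g \<zeta> \<le> g \<eta>" "g \<eta> \<le> g \<xi>"
          using that \<xi> z by (auto intro!: mono_onD[OF mono])
        then show ?thesis using z(2) by (simp add: dist_real_def)
      qed
      then show ?thesis using z s
        by (intro exI[of _ "{\<zeta><..} \<inter> {..<\<sigma>}"]) auto
    next
      case False
      then consider "\<And>q. \<not> q < \<xi>" | q where "q < \<xi>" "\<And>p. p < \<xi> \<Longrightarrow> \<not> q < p"
        unfolding is_lim_def by blast
      then show ?thesis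
      proof cases
        case 1
        then show ?thesis using s by (intro exI[of _ "{..<\<sigma>}"]) (auto simp: le_less)
      next
        case 2
        \<comment> \<open>Here \<open>q\<close> is the immediate predecessor of
          \<open>\<xi>\<close>, so this open interval contains \<open>\<xi>\<close> only.\<close>
        then show ?thesis using s
          by (intro exI[of _ "{q<..} \<inter> {..<\<sigma>}"]) (auto simp: le_less)
      qed
    qed
    then show "\<forall>\<^sub>F \<eta> in at \<xi> within {..\<beta>}. dist (g \<eta>) (g \<xi>) < e"
      unfolding eventually_at_topological by blast
  qed
qed

text \<open>Continuity is expressed as left continuity at limit ordinals.\<close>

definition isZ :: "rseq \<Rightarrow> omega1 \<Rightarrow> bool" where
  "isZ x \<beta> \<longleftrightarrow> dom x = {..\<beta>} \<and>
     (\<forall>\<zeta> \<xi>. \<zeta> < \<xi> \<longrightarrow> \<xi> < \<beta> \<longrightarrow> the (x \<zeta>) < the (x \<xi>)) \<and>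
     (\<forall>\<zeta><\<beta>. the (x \<zeta>) \<le> the (x \<beta>)) \<and>
     (\<forall>\<xi>\<le>\<beta>. is_lim \<xi> \<longrightarrow> (\<forall>e>0. \<exists>\<zeta><\<xi>. the (x \<xi>) - e < the (x \<zeta>)))"

lemma isZ_mono: "isZ x \<beta> \<Longrightarrow> \<zeta> \<le> \<xi> \<Longrightarrow> \<xi> \<le> \<beta> \<Longrightarrow> the (x \<zeta>) \<le> the (x \<xi>)"
  unfolding isZ_def by (metis le_less order_refl)

lemma isZ_iff: "(\<exists>\<beta>. isZ x \<beta>) \<longleftrightarrow> (\<exists>\<beta>. dom x = {..\<beta>} \<and>
     continuous_on {..\<beta>} (\<lambda>\<xi>. the (x \<xi>)) \<and>
     mono_on {..\<beta>} (\<lambda>\<xi>. the (x \<xi>)) \<and>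
     strict_mono_on {..<\<beta>} (\<lambda>\<xi>. the (x \<xi>)))"
proof -
  have "isZ x \<beta> \<longleftrightarrow> dom x = {..\<beta>} \<and>
     continuous_on {..\<beta>} (\<lambda>\<xi>. the (x \<xi>)) \<and>
     mono_on {..\<beta>} (\<lambda>\<xi>. the (x \<xi>)) \<and>
     strict_mono_on {..<\<beta>} (\<lambda>\<xi>. the (x \<xi>))" (is "_ \<longleftrightarrow> ?R") for \<beta>
  proof
    assume x: "isZ x \<beta>"
    have m: "mono_on {..\<beta>} (\<lambda>\<xi>. the (x \<xi>))"
      using isZ_mono[OF x] by (auto simp: mono_on_def)
    then show ?R using x unfolding continuous_on_omega1_iff[OF m] isZ_def strict_mono_on_def
      by auto
  next
    assume R: ?R
    then have m: "mono_on {..\<beta>} (\<lambda>\<xi>. the (x \<xi>))" by blast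
    show "isZ x \<beta>"
      using R unfolding continuous_on_omega1_iff[OF m] isZ_def strict_mono_on_def mono_on_def
      by auto
  qed
  then show ?thesis by simp
qed

lemma isZ_Rep_Z: obtains \<beta> where "isZ (Rep_Z z) \<beta>"
  using Rep_Z[of z] isZ_iff[of "Rep_Z z"] by auto

lemma Rep_Abs_Z: "isZ x \<beta> \<Longrightarrow> Rep_Z (Abs_Z x) = x"
  using isZ_iff[of x] by (intro Abs_Z_inverse) auto

definition isY :: "rseq \<Rightarrow> omega1 \<Rightarrow> bool" where
  "isY x \<beta> \<longleftrightarrow> isZ x \<beta> \<and> (\<forall>\<zeta><\<beta>. the (x \<zeta>) < the (x \<beta>))"

lemma isY_iff: "(\<exists>\<beta>. isY x \<beta>) \<longleftrightarrow> (\<exists>\<beta>. dom x = {..\<beta>} \<and>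
     continuous_on {..\<beta>} (\<lambda>\<xi>. the (x \<xi>)) \<and>
     strict_mono_on {..\<beta>} (\<lambda>\<xi>. the (x \<xi>)))"
proof -
  have "isY x \<beta> \<longleftrightarrow> dom x = {..\<beta>} \<and>
     continuous_on {..\<beta>} (\<lambda>\<xi>. the (x \<xi>)) \<and>
     strict_mono_on {..\<beta>} (\<lambda>\<xi>. the (x \<xi>))" (is "_ \<longleftrightarrow> ?R") for \<beta>
  proof
    assume x: "isY x \<beta>"
    then have x': "isZ x \<beta>" by (simp add: isY_def)
    have m: "mono_on {..\<beta>} (\<lambda>\<xi>. the (x \<xi>))"
      using isZ_mono[OF x'] by (auto simp: mono_on_def)
    have "strict_mono_on {..\<beta>} (\<lambda>\<xi>. the (x \<xi>))"
      using x unfolding isY_def isZ_def strict_mono_on_def by (auto simp: le_less)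
    then show ?R using x' unfolding continuous_on_omega1_iff[OF m] isZ_def by auto
  next
    assume R: ?R
    then have m: "mono_on {..\<beta>} (\<lambda>\<xi>. the (x \<xi>))"
      using strict_mono_on_imp_mono_on by blast
    have "the (x \<zeta>) < the (x \<xi>)" if "\<zeta> < \<xi>" "\<xi> \<le> \<beta>" for \<zeta> \<xi>
      using R that by (auto intro: strict_mono_onD)
    then show "isY x \<beta>"
      using R unfolding continuous_on_omega1_iff[OF m] isY_def isZ_def by (auto simp: less_imp_le)
  qed
  then show ?thesis by simp
qed

lemma isY_Rep_Y: obtains \<beta> where "isY (Rep_Y z) \<beta>"
  using Rep_Y[of z] isY_iff[of "Rep_Y z"] by auto

lemma Rep_Abs_Y: "isY x \<beta> \<Longrightarrow> Rep_Y (Abs_Y x) = x"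
  using isY_iff[of x] by (intro Abs_Y_inverse) auto

section \<open>The inclusion of \<open>Y\<close> in \<open>Z\<close>, first differences, and
  approximation from above by \<open>Y\<close>\<close>

definition Z_of_Y :: "Y \<Rightarrow> Z" where "Z_of_Y y = Abs_Z (Rep_Y y)"

lemma Rep_Z_of_Y: "Rep_Z (Z_of_Y y) = Rep_Y y"
proof -
  obtain \<beta> where "isY (Rep_Y y) \<beta>" by (rule isY_Rep_Y)
  then have "isZ (Rep_Y y) \<beta>" by (simp add: isY_def)
  then show ?thesis unfolding Z_of_Y_def by (rule Rep_Abs_Z)
qed

lemma Z_of_Y_less: "Z_of_Y x < Z_of_Y y \<longleftrightarrow> x < y"
  by (simp add: less_Z_def less_Y_def Rep_Z_of_Y)

text \<open>The order of \<open>Z\<close> with the value \<open>b\<close> of the larger sequence at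
  the place of parting made visible: it measures how far \<open>y\<close> lies above
  \<open>x\<close>, a larger \<open>b\<close> meaning a closer \<open>y\<close>.\<close>

definition first_diff :: "rseq \<Rightarrow> rseq \<Rightarrow> real \<Rightarrow> bool" where
  "first_diff x y b \<longleftrightarrow> (\<exists>\<alpha>. (\<forall>\<xi><\<alpha>. x \<xi> = y \<xi>) \<and> y \<alpha> = Some b \<and>
     (x \<alpha> = None \<or> (\<exists>a. x \<alpha> = Some a \<and> b < a)))"

lemma less_Z_iff: "z < w \<longleftrightarrow> (\<exists>b. first_diff (Rep_Z z) (Rep_Z w) b)"
proof -
  obtain \<beta> \<gamma> where d: "dom (Rep_Z z) = {..\<beta>}" "dom (Rep_Z w) = {..\<gamma>}"
    using dom_Rep_Z[of z] dom_Rep_Z[of w] by blast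
  show ?thesis
    unfolding less_Z_def seq_less_iff_first_difference[OF d] first_diff_def by metis
qed

definition cut_index :: "rseq \<Rightarrow> real \<Rightarrow> omega1" where
  "cut_index x c = (LEAST \<alpha>. \<alpha> \<notin> dom x \<or> c < the (x \<alpha>))"

text \<open>For \<open>x\<close> in \<open>Z\<close> these are the values below \<open>c\<close>,
  followed by the last value \<open>c\<close>. If \<open>c\<close> is not a value of
  \<open>x\<close>, the result lies above \<open>x\<close>, and nearer to it for larger
  \<open>c\<close>.\<close>

definition cut_at :: "rseq \<Rightarrow> real \<Rightarrow> rseq" where
  "cut_at x c = (\<lambda>\<xi>. if \<xi> < cut_index x c then x \<xi> else if \<xi> = cut_index x c then Some c else None)"

lemma cut_index_props:
  assumes x: "isZ x \<beta>" and c: "c \<notin> ran x"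
  shows "cut_index x c \<notin> dom x \<or> c < the (x (cut_index x c))"
    and "\<And>\<xi>. \<xi> < cut_index x c \<Longrightarrow> \<xi> \<in> dom x \<and> the (x \<xi>) < c"
proof -
  obtain \<sigma> where "\<beta> < \<sigma>" using omega1_no_max by blast
  then have "\<exists>\<alpha>. \<alpha> \<notin> dom x \<or> c < the (x \<alpha>)"
    using x unfolding isZ_def by (intro exI[of _ \<sigma>]) auto
  from LeastI_ex[OF this] show "cut_index x c \<notin> dom x \<or> c < the (x (cut_index x c))"
    unfolding cut_index_def .
  fix \<xi> assume "\<xi> < cut_index x c"
  then have "\<xi> \<in> dom x \<and> \<not> c < the (x \<xi>)"
    unfolding cut_index_def using not_less_Least by blast
  then show "\<xi> \<in> dom x \<and> the (x \<xi>) < c" using c by (auto simp: ran_def not_less le_less)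
qed

lemma first_diff_cut_at:
  assumes x: "isZ x \<beta>" and c: "c \<notin> ran x"
  shows "first_diff x (cut_at x c) c"
  unfolding first_diff_def
  using cut_index_props(1)[OF x c]
  by (intro exI[of _ "cut_index x c"]) (cases "x (cut_index x c)"; auto simp: cut_at_def)

text \<open>Condition \<open>v\<close> prevents a repeated last value of \<open>x\<close> from
  surviving below the cut: if \<open>c\<close> is smaller than the last value, every index that is
  kept lies below \<open>\<beta>\<close>.\<close>

lemma isY_cut_at:
  assumes x: "isZ x \<beta>" and c: "c \<notin> ran x" and v: "isY x \<beta> \<or> c < the (x \<beta>)"
  shows "isY (cut_at x c) (cut_index x c)"
proof -
  let ?a = "cut_index x c"
  note p = cut_index_props[OF x c]
  have dx: "dom x = {..\<beta>}" using x by (simp add: isZ_def)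
  have strict: "the (x \<zeta>) < the (x \<xi>)" if "\<zeta> < \<xi>" "\<xi> < ?a" for \<zeta> \<xi>
  proof (cases "isY x \<beta>")
    case True
    have "\<xi> \<le> \<beta>" using p(2)[OF that(2)] dx by auto
    then show ?thesis using True that(1) unfolding isY_def isZ_def by (auto simp: le_less)
  next
    case False
    have "\<xi> < \<beta>"
      using p(2)[OF that(2)] dx False v by (cases "\<xi> = \<beta>") auto
    then show ?thesis using x that(1) unfolding isZ_def by blast
  qed
  \<comment> \<open>No continuity is demanded at the cut index. Were it a limit, left continuity
    would give an earlier value above \<open>c\<close>, or an earlier index would already lie
    outside the domain.\<close>
  have nl: "\<not> is_lim ?a"
  proof
    assume l: "is_lim ?a"
    show False
    proof (cases "?a \<in> dom x")
      case True
      then have ca: "c < the (x ?a)" using p(1) by blast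
      moreover have "?a \<le> \<beta>" using True dx by auto
      ultimately obtain \<zeta> where "\<zeta> < ?a" "the (x ?a) - (the (x ?a) - c) < the (x \<zeta>)"
        using x l unfolding isZ_def by (metis diff_gt_0_iff_gt)
      then show False using p(2)[of \<zeta>] by auto
    next
      case False
      then have "\<beta> < ?a" using dx by auto
      then obtain q where "q < ?a" "\<beta> < q" using l unfolding is_lim_def by blast
      then show False using p(2)[of q] dx by auto
    qed
  qed
  have lim: "\<exists>\<zeta><\<xi>. the (x \<xi>) - e < the (x \<zeta>)" if "\<xi> < ?a" "is_lim \<xi>" "0 < e" for \<xi> e
  proof -
    have "\<xi> \<le> \<beta>" using p(2)[OF that(1)] dx by auto
    then show ?thesis using x that unfolding isZ_def by blast
  qed
  have lt: "the (x \<zeta>) < c" if "\<zeta> < ?a" for \<zeta> using p(2)[OF that] by blast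
  have dm: "dom (cut_at x c) = {..?a}"
    using p(2) by (auto simp: cut_at_def le_less dom_def split: if_splits)
  have cv: "the (cut_at x c \<xi>) = the (x \<xi>)" if "\<xi> < ?a" for \<xi> using that by (simp add: cut_at_def)
  have ca: "the (cut_at x c ?a) = c" by (simp add: cut_at_def)
  show ?thesis
    unfolding isY_def isZ_def
  proof (intro conjI allI impI dm)
    fix \<zeta> \<xi> assume "\<zeta> < \<xi>" "\<xi> < ?a"
    then show "the (cut_at x c \<zeta>) < the (cut_at x c \<xi>)" using strict cv by simp
  next
    fix \<zeta> assume "\<zeta> < ?a"
    then show "the (cut_at x c \<zeta>) \<le> the (cut_at x c ?a)" using lt cv ca by (simp add: less_imp_le)
  next
    fix \<zeta> assume "\<zeta> < ?a"
    then show "the (cut_at x c \<zeta>) < the (cut_at x c ?a)" using lt cv ca by simp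
  next
    fix \<xi> and e :: real assume a: "\<xi> \<le> ?a" "is_lim \<xi>" "0 < e"
    then have l: "\<xi> < ?a" using nl by (cases "\<xi> = ?a") auto
    obtain \<zeta> where "\<zeta> < \<xi>" "the (x \<xi>) - e < the (x \<zeta>)" using lim[OF l a(2,3)] by blast
    then show "\<exists>\<zeta><\<xi>. the (cut_at x c \<xi>) - e < the (cut_at x c \<zeta>)"
      using l cv by (intro exI[of _ \<zeta>]) auto
  qed
qed

text \<open>The place where \<open>x\<close> and \<open>w\<close> part cannot come after the cut:
  otherwise \<open>w\<close> would have a value above \<open>c\<close> at the cut index and later
  the smaller value \<open>b\<close>. If the two places coincide, \<open>b < c\<close>
  decides.\<close>

lemma cut_at_first_diff:
  assumes x: "isZ x \<beta>" and c: "c \<notin> ran x" and w: "isZ w \<gamma>" and d: "first_diff x w b" and bc: "b < c"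
  shows "first_diff (cut_at x c) w b"
proof -
  let ?a = "cut_index x c"
  note p = cut_index_props[OF x c]
  obtain \<alpha> where al: "\<forall>\<xi><\<alpha>. x \<xi> = w \<xi>" "w \<alpha> = Some b" "x \<alpha> = None \<or> (\<exists>a. x \<alpha> = Some a \<and> b < a)"
    using d unfolding first_diff_def by blast
  have "\<alpha> \<in> dom w" using al(2) by blast
  then have ag: "\<alpha> \<le> \<gamma>" using w unfolding isZ_def by simp
  have le: "\<not> ?a < \<alpha>"
  proof
    assume lt: "?a < \<alpha>"
    then have "?a \<in> dom w" using w ag unfolding isZ_def by auto
    then have "?a \<in> dom x" using al(1) lt by (auto simp: dom_def)
    then have "c < the (w ?a)" using p(1) al(1) lt by simp
    also have "\<dots> \<le> the (w \<alpha>)" using isZ_mono[OF w _ ag] lt by simp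
    finally show False using al(2) bc by simp
  qed
  then show ?thesis unfolding first_diff_def
    using al bc by (intro exI[of _ \<alpha>]) (auto simp: cut_at_def)
qed

text \<open>If \<open>w\<close> agreed with \<open>x\<close> at both indices of the repeated value
  and continued, it would not be strictly increasing before its last index. So cut values tending to
  a doubled last value from below are enough to approximate \<open>x\<close>.\<close>

lemma first_diff_doubled:
  assumes x: "isZ x \<beta>" and w: "isZ w \<gamma>" and d: "first_diff x w b" and n: "\<not> isY x \<beta>"
  shows "b < the (x \<beta>)"
proof -
  obtain \<zeta> where z: "\<zeta> < \<beta>" "the (x \<zeta>) \<ge> the (x \<beta>)" using n x unfolding isY_def by fastforce
  obtain \<alpha> where al: "\<forall>\<xi><\<alpha>. x \<xi> = w \<xi>" "w \<alpha> = Some b" "x \<alpha> = None \<or> (\<exists>a. x \<alpha> = Some a \<and> b < a)"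
    using d unfolding first_diff_def by blast
  have ag: "\<alpha> \<le> \<gamma>" using w al(2) unfolding isZ_def by (metis atMost_iff domI)
  show ?thesis
  proof (cases "\<alpha> \<le> \<beta>")
    case True
    then have "\<alpha> \<in> dom x" using x unfolding isZ_def by simp
    then have "b < the (x \<alpha>)" using al(3) by auto
    also have "\<dots> \<le> the (x \<beta>)" using isZ_mono[OF x True] by simp
    finally show ?thesis .
  next
    case False
    then have "the (w \<zeta>) < the (w \<beta>)" using w z(1) ag unfolding isZ_def by simp
    moreover have "w \<zeta> = x \<zeta>" "w \<beta> = x \<beta>" using al(1) False z(1) by auto
    ultimately show ?thesis using z(2) by simp
  qed
qed

text \<open>The points \<open>y n\<close> decrease to \<open>z\<close>: they are cuts at increasing
  values \<open>c n\<close>, which tend to infinity if \<open>z\<close> comes from \<open>Y\<close>,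
  and otherwise to the doubled last value from below.\<close>

lemma approximation_from_above:
  assumes z: "isZ (Rep_Z z) \<beta>"
  obtains c :: "nat \<Rightarrow> real" and y :: "nat \<Rightarrow> Y" where
    "\<And>n. z < Z_of_Y (y n)" "inj y"
    "\<And>n w b. first_diff (Rep_Z z) (Rep_Z w) b \<Longrightarrow> b < c n \<Longrightarrow> Z_of_Y (y n) < w"
    "\<And>b. isY (Rep_Z z) \<beta> \<or> b < the (Rep_Z z \<beta>) \<Longrightarrow> \<forall>\<^sub>F n in sequentially. b < c n"
    "\<And>n. isY (Rep_Z z) \<beta> \<or> c n < the (Rep_Z z \<beta>)"
proof -
  let ?x = "Rep_Z z" and ?l = "the (Rep_Z z \<beta>)"
  define L where "L n = (if isY ?x \<beta> then real n else ?l - inverse (real (Suc n)))" for n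
  have L: "strict_mono L"
    by (rule strict_monoI_Suc) (auto simp: L_def)
  have "countable (dom ?x)" using z countable_atMost_omega1 unfolding isZ_def by simp
  then have cr: "countable (ran ?x)"
  proof (rule countable_subset[rotated, OF countable_image])
    show "ran ?x \<subseteq> (\<lambda>\<xi>. the (?x \<xi>)) ` dom ?x" by (force simp: ran_def)
  qed
  \<comment> \<open>A cut value must avoid the range of the sequence, which is countable, while an
    open interval is not.\<close>
  have "\<exists>c. L n < c \<and> c < L (Suc n) \<and> c \<notin> ran ?x" for n
  proof -
    have "uncountable {L n<..<L (Suc n)}"
      using L by (simp add: uncountable_open_interval strict_mono_Suc_iff)
    then have "\<not> {L n<..<L (Suc n)} \<subseteq> ran ?x" using cr countable_subset by blast
    then show ?thesis by auto
  qed
  then obtain c where c: "\<And>n. L n < c n" "\<And>n. c n < L (Suc n)" "\<And>n. c n \<notin> ran ?x" by metis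
  have cl: "isY ?x \<beta> \<or> c n < ?l" for n
    using c(2)[of n] by (auto simp: L_def intro: less_trans)
  have cm: "c m < c n" if "m < n" for m n
  proof -
    have "c m < L (Suc m)" by (rule c)
    also have "\<dots> \<le> L n" using L that by (simp add: strict_mono_less_eq)
    also have "\<dots> < c n" by (rule c)
    finally show ?thesis .
  qed
  define y where "y n = Abs_Y (cut_at ?x (c n))" for n
  have y: "Rep_Z (Z_of_Y (y n)) = cut_at ?x (c n)" for n
    unfolding Rep_Z_of_Y y_def using isY_cut_at[OF z c(3) cl] by (rule Rep_Abs_Y)
  have less: "Z_of_Y (y n) < w" if "first_diff ?x (Rep_Z w) b" "b < c n" for n w b
  proof -
    obtain \<gamma> where "isZ (Rep_Z w) \<gamma>" by (rule isZ_Rep_Z)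
    then show ?thesis unfolding less_Z_iff y using cut_at_first_diff[OF z c(3) _ that] by blast
  qed
  have up: "z < Z_of_Y (y n)" for n
    unfolding less_Z_iff y using first_diff_cut_at[OF z c(3)] by blast
  have dec: "y n < y m" if "m < n" for m n
    using less[of "Z_of_Y (y m)" "c m" n] cm[OF that] first_diff_cut_at[OF z c(3)] y Z_of_Y_less by simp
  have "inj y" by (rule injI) (metis dec less_irrefl linorder_neqE_nat)
  moreover have "\<forall>\<^sub>F n in sequentially. b < c n" if b: "isY ?x \<beta> \<or> b < ?l" for b
  proof -
    have "\<exists>n. b < L n"
    proof (cases "isY ?x \<beta>")
      case True
      then show ?thesis using reals_Archimedean2[of b] by (simp add: L_def)
    next
      case False
      then show ?thesis using reals_Archimedean[of "?l - b"] b by (auto simp: L_def algebra_simps)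
    qed
    then obtain n where n: "b < L n" by blast
    have "b < c m" if "n \<le> m" for m
      using n c(1)[of m] L that by (meson less_le_trans less_trans strict_mono_less_eq)
    then show ?thesis unfolding eventually_sequentially by blast
  qed
  ultimately show ?thesis using that[of y c] up less cl by blast
qed

section \<open>Well-ordered subsets of \<open>Y\<close>\<close>

text \<open>Well-founded recursion as an existence statement. It serves sequences over
  \<open>omega1\<close> as well as functions on a tree.\<close>

lemma ex_recursive_solution:
  fixes G :: "('a::order \<Rightarrow> 'b) \<Rightarrow> 'a \<Rightarrow> 'b"
  assumes wf: "wf {(x::'a, y). x < y}"
    and local: "\<And>f g x. (\<And>z. z < x \<Longrightarrow> f z = g z) \<Longrightarrow> G f x = G g x"
  shows "\<exists>f. \<forall>x. f x = G f x"
proof -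
  have "adm_wf {(x::'a, y). x < y} G"
    unfolding adm_wf_def
  proof (intro allI impI)
    fix f g :: "'a \<Rightarrow> 'b" and x
    assume "\<forall>z. (z, x) \<in> {(x, y). x < y} \<longrightarrow> f z = g z"
    then show "G f x = G g x" by (intro local) simp
  qed
  note eq = fun_cong[OF wfrec_fixpoint[OF wf this]]
  show ?thesis
    by (rule exI[of _ "wfrec {(x::'a, y). x < y} G"], rule allI, rule eq)
qed

section \<open>Adding a top element, unions of chains, and Kurepa's argument\<close>

definition add_top :: "'a::linorder sigma \<Rightarrow> 'a \<Rightarrow> 'a sigma" where
  "add_top t y = Abs_sigma (insert y (Rep_sigma t))"

lemma Rep_add_top:
  assumes top: "\<And>x. x \<in> Rep_sigma t \<Longrightarrow> x < y"
  shows "Rep_sigma (add_top t y) = insert y (Rep_sigma t)"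
proof -
  have wo: "\<forall>B\<subseteq>Rep_sigma t. B \<noteq> {} \<longrightarrow> (\<exists>b\<in>B. \<forall>c\<in>B. b \<le> c)"
    using Rep_sigma[of t] by (simp add: well_ordered_iff_least)
  have "well_ordered (insert y (Rep_sigma t))"
    unfolding well_ordered_iff_least
  proof (intro allI impI)
    fix B assume B: "B \<subseteq> insert y (Rep_sigma t)" "B \<noteq> {}"
    show "\<exists>b\<in>B. \<forall>c\<in>B. b \<le> c"
    proof (cases "B \<inter> Rep_sigma t = {}")
      case True
      then show ?thesis using B by blast
    next
      case False
      then obtain b where "b \<in> B \<inter> Rep_sigma t" "\<forall>c\<in>B \<inter> Rep_sigma t. b \<le> c"
        using wo[rule_format, of "B \<inter> Rep_sigma t"] by blast
      then show ?thesis using B(1) top[of b] by (intro bexI[of _ b]) auto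
    qed
  qed
  then show ?thesis unfolding add_top_def by (simp add: Abs_sigma_inverse)
qed

lemma add_top_imm_succ:
  assumes top: "\<And>x. x \<in> Rep_sigma t \<Longrightarrow> x < y"
  shows "add_top t y \<in> imm_succs t"
proof -
  note R = Rep_add_top[OF top]
  have y: "y \<notin> Rep_sigma t" using top by blast
  have "t \<le> add_top t y"
    unfolding less_eq_sigma_def initial_segment_def using R top by fastforce
  moreover have "t \<noteq> add_top t y" using R y by (metis insertI1)
  moreover have False if v: "t < v" "v < add_top t y" for v
  proof -
    have sub: "Rep_sigma t \<subseteq> Rep_sigma v" "Rep_sigma v \<subseteq> insert y (Rep_sigma t)"
      using v R sigma_le_subset by (metis less_imp_le subsetI)+
    have "Rep_sigma v = Rep_sigma t \<or> Rep_sigma v = insert y (Rep_sigma t)"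
      using sub by blast
    then show False using v by (auto simp: R[symmetric] Rep_sigma_inject)
  qed
  ultimately show ?thesis unfolding imm_succs_def less_sigma_def by blast
qed

lemma sigma_chain_upper_bound:
  fixes C :: "'a::linorder sigma set"
  assumes chain: "\<And>s t. s \<in> C \<Longrightarrow> t \<in> C \<Longrightarrow> s \<le> t \<or> t \<le> s"
  obtains u where "\<And>t. t \<in> C \<Longrightarrow> t \<le> u" "Rep_sigma u = (\<Union>t\<in>C. Rep_sigma t)"
proof -
  let ?U = "\<Union>t\<in>C. Rep_sigma t"
  have down: "b \<in> Rep_sigma t" if t: "t \<in> C" "a \<in> Rep_sigma t" "b \<in> ?U" "b \<le> a" for t a b
  proof -
    obtain s where s: "s \<in> C" "b \<in> Rep_sigma s" using t(3) by blast
    then show ?thesis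
      using chain[OF t(1) s(1)] sigma_le_subset[of s t] sigma_le_down[of t s] t by blast
  qed
  have "well_ordered ?U"
    unfolding well_ordered_iff_least
  proof (intro allI impI)
    fix B assume B: "B \<subseteq> ?U" "B \<noteq> {}"
    then obtain b t where b: "b \<in> B" "b \<in> Rep_sigma t" "t \<in> C" by blast
    have "\<forall>B\<subseteq>Rep_sigma t. B \<noteq> {} \<longrightarrow> (\<exists>b\<in>B. \<forall>c\<in>B. b \<le> c)"
      using Rep_sigma[of t] by (simp add: well_ordered_iff_least)
    from this[rule_format, of "B \<inter> Rep_sigma t"] obtain m
      where m: "m \<in> B \<inter> Rep_sigma t" "\<And>c. c \<in> B \<inter> Rep_sigma t \<Longrightarrow> m \<le> c"
      using b by blast
    \<comment> \<open>An element of the union that is not in \<open>t\<close> lies above all of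
      \<open>t\<close>, so the minimum found inside \<open>t\<close> is the minimum of
      \<open>B\<close>.\<close>
    have "m \<le> c" if "c \<in> B" for c
      using m down[OF b(3), of m c] that B(1) by (meson IntD2 IntI linear subsetD)
    then show "\<exists>b\<in>B. \<forall>c\<in>B. b \<le> c" using m(1) by blast
  qed
  then have R: "Rep_sigma (Abs_sigma ?U) = ?U" by (simp add: Abs_sigma_inverse)
  have "t \<le> Abs_sigma ?U" if "t \<in> C" for t
    unfolding less_eq_sigma_def initial_segment_def R using down[OF that] that by blast
  then show ?thesis using that[of "Abs_sigma ?U"] R by blast
qed

text \<open>Take \<open>t\<close> maximal among the nodes whose members are all mapped below
  \<open>\<rho> t\<close>. If \<open>\<rho> (add_top t y)\<close> exceeded \<open>\<iota> y\<close>,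
  then \<open>add_top t y\<close> would belong to the same family. The lemma is used with the
  inclusion of \<open>Y\<close> in \<open>Z\<close> as \<open>\<iota>\<close>, once for an arbitrary
  \<open>\<rho>\<close> and once for the one obtained from a norm.\<close>

lemma kurepa_maximal:
  fixes \<rho> :: "'a::linorder sigma \<Rightarrow> 'b::linorder" and \<iota> :: "'a \<Rightarrow> 'b"
  assumes \<rho>: "mono \<rho>" and \<iota>: "strict_mono \<iota>"
  obtains t where "\<And>y x. \<rho> t < \<iota> y \<Longrightarrow> x \<in> Rep_sigma t \<Longrightarrow> x < y"
    "\<And>y. \<rho> t < \<iota> y \<Longrightarrow> \<rho> (add_top t y) \<le> \<iota> y"
proof -
  define A where "A = {t. \<forall>x\<in>Rep_sigma t. \<iota> x < \<rho> t}"
  have "\<exists>m\<in>A. \<forall>t\<in>A. m \<le> t \<longrightarrow> t = m"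
  proof (rule predicate_Zorn)
    show "partial_order_on A (relation_of (\<le>) A)"
      by (rule partial_order_on_relation_ofI) auto
    fix C assume "C \<in> Chains (relation_of (\<le>) A)"
    then have C: "\<And>s t. s \<in> C \<Longrightarrow> t \<in> C \<Longrightarrow> s \<in> A \<and> (s \<le> t \<or> t \<le> s)"
      unfolding Chains_def relation_of_def by blast
    then obtain u where u: "\<And>t. t \<in> C \<Longrightarrow> t \<le> u" "Rep_sigma u = (\<Union>t\<in>C. Rep_sigma t)"
      using sigma_chain_upper_bound[of C] by metis
    have "u \<in> A"
      unfolding A_def
    proof (intro CollectI ballI)
      fix x assume "x \<in> Rep_sigma u"
      then obtain t where t: "t \<in> C" "x \<in> Rep_sigma t" unfolding u(2) by blast
      then have "\<iota> x < \<rho> t" using C[OF t(1) t(1)] unfolding A_def by blast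
      also have "\<dots> \<le> \<rho> u" using u(1)[OF t(1)] \<rho> by (rule monoD[rotated])
      finally show "\<iota> x < \<rho> u" .
    qed
    then show "\<exists>u\<in>A. \<forall>a\<in>C. a \<le> u" using u(1) by blast
  qed
  then obtain t where t: "t \<in> A" "\<And>s. s \<in> A \<Longrightarrow> t \<le> s \<Longrightarrow> s = t" by blast
  have below: "x < y" if "\<rho> t < \<iota> y" "x \<in> Rep_sigma t" for x y
  proof -
    have "\<iota> x < \<iota> y" using t(1) that unfolding A_def by force
    then show ?thesis using \<iota> by (simp add: strict_mono_less)
  qed
  have "\<rho> (add_top t y) \<le> \<iota> y" if y: "\<rho> t < \<iota> y" for y
  proof (rule ccontr)
    assume n: "\<not> \<rho> (add_top t y) \<le> \<iota> y"
    note R = Rep_add_top[of t y, OF below[OF y]]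
    have lt: "t < add_top t y"
      using add_top_imm_succ[of t y, OF below[OF y]] unfolding imm_succs_def by blast
    have "\<rho> t \<le> \<rho> (add_top t y)" using lt \<rho> by (simp add: monoD)
    moreover have "\<forall>x\<in>Rep_sigma t. \<iota> x < \<rho> t" using t(1) by (simp add: A_def)
    ultimately have "add_top t y \<in> A"
      using n unfolding A_def by (auto simp: R intro: less_le_trans)
    from t(2)[OF this less_imp_le[OF lt]] show False using lt by simp
  qed
  then show ?thesis using that below by blast
qed

lemma strict_mono_Z_of_Y: "strict_mono Z_of_Y"
  by (simp add: strict_mono_def Z_of_Y_less)

text \<open>At Kurepa's node \<open>t\<close> the successors satisfy
  \<open>\<rho> t \<le> \<rho> (add_top t (y n)) \<le> Z_of_Y (y n)\<close>, and these upper bounds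
  come down to \<open>\<rho> t\<close>.\<close>

lemma mono_has_Z_bad_point:
  fixes \<rho> :: "Y sigma \<Rightarrow> Z"
  assumes "mono \<rho>"
  shows "\<exists>t. Z_bad \<rho> t"
proof -
  obtain t where t: "\<And>y x. \<rho> t < Z_of_Y y \<Longrightarrow> x \<in> Rep_sigma t \<Longrightarrow> x < y"
    "\<And>y. \<rho> t < Z_of_Y y \<Longrightarrow> \<rho> (add_top t y) \<le> Z_of_Y y"
    using kurepa_maximal[OF assms strict_mono_Z_of_Y] by metis
  obtain \<beta> where \<beta>: "isZ (Rep_Z (\<rho> t)) \<beta>" by (rule isZ_Rep_Z)
  obtain c y where y: "\<And>n. \<rho> t < Z_of_Y (y n)" "inj y"
    and less: "\<And>n w b. first_diff (Rep_Z (\<rho> t)) (Rep_Z w) b \<Longrightarrow> b < c n \<Longrightarrow> Z_of_Y (y n) < w"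
    and c: "\<And>b. isY (Rep_Z (\<rho> t)) \<beta> \<or> b < the (Rep_Z (\<rho> t) \<beta>) \<Longrightarrow> \<forall>\<^sub>F n in sequentially. b < c n"
    by (rule approximation_from_above[OF \<beta>]) blast
  define u where "u n = add_top t (y n)" for n
  have top: "x < y n" if "x \<in> Rep_sigma t" for x n using t(1)[OF y(1) that] .
  have R: "Rep_sigma (u n) = insert (y n) (Rep_sigma t)" for n
    unfolding u_def by (rule Rep_add_top[OF top])
  have im: "u n \<in> imm_succs t" for n
    unfolding u_def by (rule add_top_imm_succ[OF top])
  have "inj u"
  proof (rule injI)
    fix m n assume "u m = u n"
    then have "y m \<in> insert (y n) (Rep_sigma t)" using R by (metis insertI1)
    then have "y m = y n" using top by blast
    then show "m = n" using y(2) by (simp add: inj_eq)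
  qed
  moreover have "(\<lambda>n. \<rho> (u n)) \<longlonglongrightarrow> \<rho> t"
  proof (rule order_tendstoI)
    fix w assume "w < \<rho> t"
    moreover have "\<rho> t \<le> \<rho> (u n)" for n
      using im[of n] by (intro monoD[OF assms] less_imp_le) (simp add: imm_succs_def)
    ultimately show "\<forall>\<^sub>F n in sequentially. w < \<rho> (u n)"
      by (intro always_eventually) (auto intro: less_le_trans)
  next
    fix w assume "\<rho> t < w"
    then obtain b where b: "first_diff (Rep_Z (\<rho> t)) (Rep_Z w) b" unfolding less_Z_iff by blast
    obtain \<gamma> where "isZ (Rep_Z w) \<gamma>" by (rule isZ_Rep_Z)
    then have "isY (Rep_Z (\<rho> t)) \<beta> \<or> b < the (Rep_Z (\<rho> t) \<beta>)"
      using first_diff_doubled[OF \<beta> _ b] by blast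
    from c[OF this] show "\<forall>\<^sub>F n in sequentially. \<rho> (u n) < w"
    proof eventually_elim
      case (elim n)
      have "\<rho> (u n) \<le> Z_of_Y (y n)" unfolding u_def using t(2) y(1) .
      then show ?case using less[OF b elim] by (rule le_less_trans)
    qed
  qed
  ultimately show ?thesis unfolding Z_bad_def using im by blast
qed

section \<open>Least upper bounds in \<open>Z\<close>\<close>

text \<open>Smaller values mean larger sequences, so the supremum is built greedily: at each index
  take the infimum of the values of those members of \<open>S\<close> that agree with what has been
  built so far. The bounds \<open>l\<close> and \<open>u\<close> keep infima and limit values
  finite.\<close>

lemma Z_lub:
  fixes S :: "Z set"
  assumes ne: "S \<noteq> {}" and bd: "\<And>z. z \<in> S \<Longrightarrow> ran (Rep_Z z) \<subseteq> {l..u}"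
  shows "\<exists>s. (\<forall>z\<in>S. z \<le> s) \<and> (\<forall>w. (\<forall>z\<in>S. z \<le> w) \<longrightarrow> s \<le> w)"
proof -
  define P where "P e \<xi> = {z \<in> S. \<xi> \<in> dom (Rep_Z z) \<and> (\<forall>\<zeta><\<xi>. Rep_Z z \<zeta> = e \<zeta>)}" for e \<xi>
  define G where "G e \<xi> = (if P e \<xi> = {} then None else Some (INF z\<in>P e \<xi>. the (Rep_Z z \<xi>)))" for e \<xi>
  have "\<exists>e. \<forall>\<xi>. e \<xi> = G e \<xi>"
  proof (rule ex_recursive_solution)
    show "wf {(x::omega1, y). x < y}" by (rule wf)
    show "G f x = G g x" if "\<And>z. z < x \<Longrightarrow> f z = g z" for f g x
    proof -
      have "P f x = P g x" unfolding P_def using that by auto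
      then show ?thesis by (simp add: G_def)
    qed
  qed
  then obtain e where e: "\<And>\<xi>. e \<xi> = G e \<xi>" by blast
  have dome: "\<xi> \<in> dom e \<longleftrightarrow> P e \<xi> \<noteq> {}" for \<xi>
    using e[of \<xi>] by (auto simp: G_def split: if_splits)
  have domE: "\<exists>z. z \<in> P e \<xi>" if "\<xi> \<in> dom e" for \<xi>
    using that unfolding dome by (simp add: ex_in_conv)
  have PD: "z \<in> S" "\<xi> \<in> dom (Rep_Z z)" "\<And>\<zeta>. \<zeta> < \<xi> \<Longrightarrow> Rep_Z z \<zeta> = e \<zeta>" if "z \<in> P e \<xi>" for z \<xi>
    using that by (auto simp: P_def)
  have Pval: "l \<le> the (Rep_Z z \<xi>)" "the (Rep_Z z \<xi>) \<le> u" if "z \<in> P e \<xi>" for z \<xi>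
    using bd[OF PD(1)[OF that]] PD(2)[OF that] by (auto simp: ran_def)
  have bdd: "bdd_below ((\<lambda>z. the (Rep_Z z \<xi>)) ` P e \<xi>)" for \<xi>
    using Pval(1) by (intro bdd_belowI[of _ l]) auto
  have val: "the (e \<xi>) = (INF z\<in>P e \<xi>. the (Rep_Z z \<xi>))" if "P e \<xi> \<noteq> {}" for \<xi>
    using e[of \<xi>] that by (simp add: G_def)
  have e_le: "the (e \<xi>) \<le> the (Rep_Z z \<xi>)" if "z \<in> P e \<xi>" for z \<xi>
  proof -
    have "P e \<xi> \<noteq> {}" using that by blast
    from val[OF this] show ?thesis using cINF_lower[OF bdd that] by simp
  qed
  have e_u: "the (e \<xi>) \<le> u" if "\<xi> \<in> dom e" for \<xi>
  proof -
    from domE[OF that] obtain z where z: "z \<in> P e \<xi>" ..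
    show ?thesis using e_le[OF z] Pval(2)[OF z] by linarith
  qed
  have domZ: "\<zeta> \<in> dom (Rep_Z z)" if "\<zeta> \<le> \<xi>" "\<xi> \<in> dom (Rep_Z z)" for \<zeta> \<xi> z
  proof -
    obtain \<beta> where "dom (Rep_Z z) = {..\<beta>}" using dom_Rep_Z[of z] by blast
    then show ?thesis using that by simp
  qed
  have down: "\<zeta> \<in> dom e" if "\<zeta> < \<xi>" "\<xi> \<in> dom e" for \<zeta> \<xi>
  proof -
    from domE[OF that(2)] obtain z where z: "z \<in> P e \<xi>" ..
    have "Rep_Z z \<zeta> = e \<zeta>" using PD(3)[OF z that(1)] .
    moreover have "\<zeta> \<in> dom (Rep_Z z)"
      using domZ[OF less_imp_le[OF that(1)] PD(2)[OF z]] .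
    ultimately show ?thesis by (simp add: dom_def)
  qed
  have strictZ: "the (Rep_Z z \<zeta>) < the (Rep_Z z \<xi>)" if "\<zeta> < \<xi>" "\<xi> < \<eta>" "\<eta> \<in> dom (Rep_Z z)" for \<zeta> \<xi> \<eta> z
  proof -
    obtain \<beta> where b: "isZ (Rep_Z z) \<beta>" by (rule isZ_Rep_Z)
    then have "\<eta> \<le> \<beta>" using that(3) unfolding isZ_def by auto
    then show ?thesis using b that unfolding isZ_def by auto
  qed
  have limZ: "\<exists>\<zeta><\<xi>. the (Rep_Z z \<xi>) - d < the (Rep_Z z \<zeta>)"
    if "\<xi> \<in> dom (Rep_Z z)" "is_lim \<xi>" "0 < d" for z \<xi> d
  proof -
    obtain \<beta> where b: "isZ (Rep_Z z) \<beta>" by (rule isZ_Rep_Z)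
    then have "\<xi> \<le> \<beta>" using that(1) unfolding isZ_def by auto
    then show ?thesis using b that unfolding isZ_def by auto
  qed
  have estrict: "the (e \<zeta>) < the (e \<xi>)" if "\<zeta> < \<xi>" "\<xi> < \<eta>" "\<eta> \<in> dom e" for \<zeta> \<xi> \<eta>
  proof -
    from domE[OF that(3)] obtain z where z: "z \<in> P e \<eta>" ..
    then show ?thesis using strictZ[OF that(1,2) PD(2)[OF z]] PD(3)[OF z] that by auto
  qed
  have elim: "\<exists>\<zeta><\<xi>. the (e \<xi>) - d < the (e \<zeta>)" if "\<xi> < \<eta>" "\<eta> \<in> dom e" "is_lim \<xi>" "0 < d" for \<xi> \<eta> d
  proof -
    from domE[OF that(2)] obtain z where z: "z \<in> P e \<eta>" ..
    have "\<xi> \<in> dom (Rep_Z z)" using domZ[of \<xi> \<eta>] PD(2)[OF z] that(1) by simp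
    from limZ[OF this that(3,4)] show ?thesis using PD(3)[OF z] that(1) by auto
  qed
  have "\<exists>\<xi>. \<xi> \<notin> dom e"
  proof (rule ccontr)
    assume "\<nexists>\<xi>. \<xi> \<notin> dom e"
    then have "the (e \<zeta>) < the (e \<xi>)" if "\<zeta> < \<xi>" for \<zeta> \<xi>
      using estrict[OF that] omega1_no_max[of \<xi>] by blast
    then show False by (rule no_strict_mono_omega1_real)
  qed
  define \<delta> where "\<delta> = (LEAST \<xi>. \<xi> \<notin> dom e)"
  have "\<delta> \<notin> dom e" unfolding \<delta>_def using \<open>\<exists>\<xi>. \<xi> \<notin> dom e\<close> by (rule LeastI_ex)
  moreover have "\<xi> \<in> dom e" if "\<xi> < \<delta>" for \<xi> using that not_less_Least unfolding \<delta>_def by blast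
  ultimately have dom: "\<xi> \<in> dom e \<longleftrightarrow> \<xi> < \<delta>" for \<xi> using down by (metis linorder_neqE)
  have P\<delta>: "P e \<delta> = {}" using \<open>\<delta> \<notin> dom e\<close> unfolding dome by simp
  have "\<exists>q. q < \<delta>"
  proof -
    obtain z where z: "z \<in> S" using ne by blast
    obtain b :: omega1 where b: "\<And>a. b \<le> a" using Least_le[of "\<lambda>_. True"] by blast
    have "b \<in> dom (Rep_Z z)" using dom_Rep_Z[of z] b by auto
    then have "z \<in> P e b" using z b by (auto simp: P_def not_less[symmetric])
    then have "b \<in> dom e" unfolding dome by auto
    then show ?thesis unfolding dom by blast
  qed
  \<comment> \<open>A domain must have a last index. If \<open>e\<close> stops at a limit, the
    missing value is forced by continuity to be the supremum of the earlier ones.\<close>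
  define s where "s = (\<lambda>\<xi>. if \<xi> < \<delta> then e \<xi> else if \<xi> = \<delta> \<and> is_lim \<delta>
    then Some (SUP \<zeta>\<in>{..<\<delta>}. the (e \<zeta>)) else None)"
  have bdA: "bdd_above ((\<lambda>\<zeta>. the (e \<zeta>)) ` {..<\<delta>})"
    using e_u dom by (intro bdd_aboveI[of _ u]) auto
  have s_below: "s \<xi> = e \<xi>" if "\<xi> < \<delta>" for \<xi> using that by (simp add: s_def)
  have sZ: "\<exists>\<beta>. isZ s \<beta>"
  proof (cases "is_lim \<delta>")
    case True
    have st: "the (e \<zeta>) < the (e \<xi>)" if "\<zeta> < \<xi>" "\<xi> < \<delta>" for \<zeta> \<xi>
    proof -
      obtain \<eta> where "\<eta> < \<delta>" "\<xi> < \<eta>" using True \<open>\<xi> < \<delta>\<close> unfolding is_lim_def by blast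
      then show ?thesis using estrict[OF \<open>\<zeta> < \<xi>\<close>] dom by simp
    qed
    have sd: "the (s \<delta>) = (SUP \<zeta>\<in>{..<\<delta>}. the (e \<zeta>))" using True by (simp add: s_def)
    have "dom s = {..\<delta>}"
      using dom True by (auto simp: s_def dom_def le_less split: if_splits)
    moreover have "the (s \<zeta>) \<le> the (s \<delta>)" if "\<zeta> < \<delta>" for \<zeta>
      unfolding sd s_below[OF that] using that by (intro cSUP_upper bdA) auto
    moreover have "the (s \<zeta>) < the (s \<xi>)" if "\<zeta> < \<xi>" "\<xi> < \<delta>" for \<zeta> \<xi>
      using st that s_below by simp
    moreover have "\<exists>\<zeta><\<xi>. the (s \<xi>) - d < the (s \<zeta>)" if "\<xi> \<le> \<delta>" "is_lim \<xi>" "0 < d" for \<xi> d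
    proof (cases "\<xi> = \<delta>")
      case True
      have "the (s \<delta>) - d < (SUP \<zeta>\<in>{..<\<delta>}. the (e \<zeta>))" using sd that(3) by simp
      then obtain \<zeta> where "\<zeta> < \<delta>" "the (s \<delta>) - d < the (e \<zeta>)"
        using less_cSUP_iff[OF _ bdA] \<open>\<exists>q. q < \<delta>\<close> by auto
      then show ?thesis using s_below True by auto
    next
      case False
      then have "\<xi> < \<delta>" using \<open>\<xi> \<le> \<delta>\<close> by simp
      then obtain \<eta> where "\<xi> < \<eta>" "\<eta> < \<delta>" using True unfolding is_lim_def by blast
      then obtain \<zeta> where "\<zeta> < \<xi>" "the (e \<xi>) - d < the (e \<zeta>)"
        using elim[OF _ _ \<open>is_lim \<xi>\<close> \<open>0 < d\<close>, of \<eta>] unfolding dom by blast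
      then show ?thesis using s_below that(1) False by (intro exI[of _ \<zeta>]) auto
    qed
    ultimately show ?thesis unfolding isZ_def by blast
  next
    case False
    then obtain \<beta> where \<beta>: "\<beta> < \<delta>" "\<And>p. p < \<delta> \<Longrightarrow> p \<le> \<beta>"
      using \<open>\<exists>q. q < \<delta>\<close> unfolding is_lim_def by (metis not_le)
    have lt: "\<xi> < \<delta> \<longleftrightarrow> \<xi> \<le> \<beta>" for \<xi> using \<beta> by auto
    have P\<beta>: "P e \<beta> \<noteq> {}" using \<beta>(1) unfolding dom[symmetric] dome .
    have "dom s = {..\<beta>}"
      using dom False lt by (auto simp: s_def dom_def split: if_splits)
    moreover have "the (s \<zeta>) < the (s \<xi>)" if "\<zeta> < \<xi>" "\<xi> < \<beta>" for \<zeta> \<xi>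
      using estrict[OF that] dom lt s_below that by auto
    \<comment> \<open>An infimum need not exceed the earlier values strictly; here doubled last
      values arise.\<close>
    moreover have "the (s \<zeta>) \<le> the (s \<beta>)" if "\<zeta> < \<beta>" for \<zeta>
    proof -
      have "the (e \<zeta>) \<le> the (Rep_Z z \<beta>)" if "z \<in> P e \<beta>" for z
      proof -
        obtain \<gamma> where g: "isZ (Rep_Z z) \<gamma>" by (rule isZ_Rep_Z)
        then have "\<beta> \<le> \<gamma>" using PD(2)[OF that] unfolding isZ_def by auto
        then have "the (Rep_Z z \<zeta>) \<le> the (Rep_Z z \<beta>)" using isZ_mono[OF g] \<open>\<zeta> < \<beta>\<close> by simp
        then show ?thesis using PD(3)[OF that \<open>\<zeta> < \<beta>\<close>] by simp
      qed
      then have "the (e \<zeta>) \<le> the (e \<beta>)" unfolding val[OF P\<beta>] using P\<beta> by (intro cINF_greatest)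
      then show ?thesis using s_below lt that by simp
    qed
    moreover have "\<exists>\<zeta><\<xi>. the (s \<xi>) - d < the (s \<zeta>)" if "\<xi> \<le> \<beta>" "is_lim \<xi>" "0 < d" for \<xi> d
    proof (cases "\<xi> = \<beta>")
      case True
      obtain z where z: "z \<in> P e \<beta>" using P\<beta> by blast
      obtain \<zeta> where zz: "\<zeta> < \<beta>" "the (Rep_Z z \<beta>) - d < the (Rep_Z z \<zeta>)"
        using limZ[OF PD(2)[OF z] _ \<open>0 < d\<close>] \<open>is_lim \<xi>\<close> unfolding True by blast
      then have "the (e \<beta>) - d < the (e \<zeta>)" using e_le[OF z] PD(3)[OF z zz(1)] by simp
      then show ?thesis using s_below lt True zz(1) by auto
    next
      case False
      then have "\<xi> < \<beta>" using \<open>\<xi> \<le> \<beta>\<close> by simp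
      then obtain \<zeta> where "\<zeta> < \<xi>" "the (e \<xi>) - d < the (e \<zeta>)"
        using elim[OF _ _ \<open>is_lim \<xi>\<close> \<open>0 < d\<close>, of \<beta>] \<beta>(1) unfolding dom by blast
      then show ?thesis using s_below lt that(1) by (intro exI[of _ \<zeta>]) auto
    qed
    ultimately show ?thesis unfolding isZ_def by blast
  qed
  then obtain \<beta> where \<beta>: "isZ s \<beta>" by blast
  define w where "w = Abs_Z s"
  have Rw: "Rep_Z w = s" unfolding w_def using \<beta> by (rule Rep_Abs_Z)
  have "z \<le> w" if z: "z \<in> S" for z
  proof (rule ccontr)
    assume "\<not> z \<le> w"
    then have "w < z" by simp
    then obtain b \<alpha> where a: "\<forall>\<xi><\<alpha>. s \<xi> = Rep_Z z \<xi>" "Rep_Z z \<alpha> = Some b"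
      "s \<alpha> = None \<or> (\<exists>a. s \<alpha> = Some a \<and> b < a)"
      unfolding less_Z_iff first_diff_def Rw by blast
    show False
    proof (cases "\<alpha> < \<delta>")
      case True
      have "z \<in> P e \<alpha>" using z a s_below True by (auto simp: P_def)
      from e_le[OF this] show False using a(2,3) s_below[OF True] dom[of \<alpha>] True by auto
    next
      case False
      moreover have "\<alpha> \<in> dom (Rep_Z z)" using a(2) by blast
      ultimately have "\<delta> \<in> dom (Rep_Z z)" by (intro domZ[of \<delta> \<alpha>]) simp
      \<comment> \<open>A member of \<open>S\<close> that agrees with \<open>e\<close> up to
        \<open>\<delta>\<close> and goes on would have kept the recursion running.\<close>
      then have "z \<in> P e \<delta>" using z a(1) s_below False by (auto simp: P_def)
      then show False using P\<delta> by blast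
    qed
  qed
  moreover have "w \<le> v" if v: "\<forall>z\<in>S. z \<le> v" for v
  proof (rule ccontr)
    assume "\<not> w \<le> v"
    then have "v < w" by simp
    then obtain b \<alpha> where a: "\<forall>\<xi><\<alpha>. Rep_Z v \<xi> = s \<xi>" "s \<alpha> = Some b"
      "Rep_Z v \<alpha> = None \<or> (\<exists>a. Rep_Z v \<alpha> = Some a \<and> b < a)"
      unfolding less_Z_iff first_diff_def Rw by blast
    show False
    proof (cases "\<alpha> < \<delta>")
      case True
      then have ne\<alpha>: "P e \<alpha> \<noteq> {}" unfolding dom[symmetric] dome .
      have "\<exists>z\<in>P e \<alpha>. Rep_Z v \<alpha> = None \<or> the (Rep_Z z \<alpha>) < the (Rep_Z v \<alpha>)"
      proof (cases "Rep_Z v \<alpha> = None")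
        case False
        then have "(INF z\<in>P e \<alpha>. the (Rep_Z z \<alpha>)) < the (Rep_Z v \<alpha>)"
          using a(2,3) s_below[OF True] val[OF ne\<alpha>] by auto
        then show ?thesis using cINF_less_iff[OF ne\<alpha> bdd] by blast
      qed (use ne\<alpha> in blast)
      then obtain z where z: "z \<in> P e \<alpha>" "Rep_Z v \<alpha> = None \<or> the (Rep_Z z \<alpha>) < the (Rep_Z v \<alpha>)"
        by blast
      obtain r where r: "Rep_Z z \<alpha> = Some r" using PD(2)[OF z(1)] by blast
      have "first_diff (Rep_Z v) (Rep_Z z) r"
        unfolding first_diff_def using a(1) PD(3)[OF z(1)] s_below True r z(2)
        by (intro exI[of _ \<alpha>]) (cases "Rep_Z v \<alpha>"; auto)
      then have "v < z" unfolding less_Z_iff by blast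
      then show False using v PD(1)[OF z(1)] by auto
    next
      case False
      \<comment> \<open>The only value of \<open>s\<close> not produced by the recursion is the one
        added at a limit. As \<open>v\<close> agrees with \<open>s\<close> before it, continuity of
        \<open>v\<close> rules out a larger value of \<open>v\<close> there.\<close>
      then have al: "\<alpha> = \<delta>" "is_lim \<delta>" using a(2) by (auto simp: s_def split: if_splits)
      obtain \<gamma> where g: "isZ (Rep_Z v) \<gamma>" by (rule isZ_Rep_Z)
      have "\<delta> \<le> \<gamma>"
      proof (rule ccontr)
        assume "\<not> \<delta> \<le> \<gamma>"
        then have "\<gamma> < \<delta>" by simp
        then obtain q where "q < \<delta>" "\<gamma> < q" using al(2) unfolding is_lim_def by blast
        have "q \<notin> dom (Rep_Z v)" using g \<open>\<gamma> < q\<close> unfolding isZ_def by simp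
        moreover have "Rep_Z v q = e q" using a(1) al \<open>q < \<delta>\<close> s_below by simp
        ultimately show False using dom[of q] \<open>q < \<delta>\<close> by (simp add: domIff)
      qed
      then have vd: "\<delta> \<in> dom (Rep_Z v)" using g unfolding isZ_def by simp
      then have pos: "0 < the (Rep_Z v \<delta>) - b" using a(3) al by auto
      obtain \<zeta> where "\<zeta> < \<delta>" "the (Rep_Z v \<delta>) - (the (Rep_Z v \<delta>) - b) < the (Rep_Z v \<zeta>)"
        using limZ[OF vd al(2) pos] by blast
      moreover have "the (s \<zeta>) \<le> the (s \<delta>)" if "\<zeta> < \<delta>" for \<zeta>
      proof -
        have "\<delta> \<in> dom s" using a(2) al by blast
        then have "\<delta> \<le> \<beta>" using \<beta> unfolding isZ_def by simp
        then show ?thesis using isZ_mono[OF \<beta>, of \<zeta> \<delta>] that by simp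
      qed
      ultimately show False using a(1,2) al by force
    qed
  qed
  ultimately show ?thesis by blast
qed

section \<open>A strictly increasing map from \<open>Y sigma\<close> to \<open>Z\<close>\<close>

definition squash :: "rseq \<Rightarrow> rseq" where
  "squash x = (\<lambda>\<xi>. map_option arctan (x \<xi>))"

lemma isY_squash:
  assumes x: "isY x \<beta>"
  shows "isY (squash x) \<beta>"
proof -
  have d: "dom (squash x) = {..\<beta>}" and dx: "dom x = {..\<beta>}"
    using x by (auto simp: isY_def isZ_def squash_def dom_def)
  have v: "the (squash x \<xi>) = arctan (the (x \<xi>))" if "\<xi> \<le> \<beta>" for \<xi>
  proof -
    have "\<xi> \<in> dom x" using that dx by simp
    then show ?thesis by (auto simp: squash_def)
  qed
  have st: "the (squash x \<zeta>) < the (squash x \<xi>)" if "\<zeta> < \<xi>" "\<xi> \<le> \<beta>" for \<zeta> \<xi>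
    using x that by (cases "\<xi> = \<beta>") (auto simp: v isY_def isZ_def arctan_less_iff)
  have "\<exists>\<zeta><\<xi>. the (squash x \<xi>) - e < the (squash x \<zeta>)" if \<xi>: "\<xi> \<le> \<beta>" "is_lim \<xi>" "0 < e" for \<xi> e
  proof -
    let ?r = "the (x \<xi>)"
    have "isCont arctan ?r" by (rule isCont_arctan)
    then obtain d where d: "0 < d" "\<And>y. \<bar>y - ?r\<bar> < d \<Longrightarrow> \<bar>arctan y - arctan ?r\<bar> < e"
      using \<xi>(3) unfolding continuous_at_real_range real_norm_def by blast
    obtain \<zeta> where z: "\<zeta> < \<xi>" "?r - d < the (x \<zeta>)"
      using x \<xi> d(1) unfolding isY_def isZ_def by blast
    have "the (x \<zeta>) \<le> ?r" using isZ_mono[of x \<beta> \<zeta> \<xi>] x z(1) \<xi>(1) unfolding isY_def by simp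
    then have "\<bar>arctan (the (x \<zeta>)) - arctan ?r\<bar> < e" using z(2) by (intro d(2)) simp
    then show ?thesis using z(1) \<xi>(1) by (intro exI[of _ \<zeta>]) (auto simp: v)
  qed
  then show ?thesis using d st unfolding isY_def isZ_def by (auto simp: less_imp_le)
qed

lemma first_diff_squash: "first_diff x y b \<Longrightarrow> first_diff (squash x) (squash y) (arctan b)"
  unfolding first_diff_def squash_def by (elim exE conjE, intro exI conjI) (auto simp: arctan_less_iff)

lemma arctan_less_2: "arctan r < 2"
  using arctan_ubound[of r] pi_half_less_two by linarith

lemma arctan_gt_minus_2: "- 2 < arctan r"
  using arctan_lbound[of r] pi_half_less_two by linarith

lemma ran_squash: "ran (squash x) \<subseteq> {-2<..<2}"
  by (auto simp: ran_def squash_def arctan_less_2 arctan_gt_minus_2)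

text \<open>Every element of \<open>Y\<close> gets its own gap in \<open>Z\<close>: squeezing the values into \<open>(-2, 2)\<close> leaves
  room for the extra last value \<open>2\<close>.\<close>

lemma Y_gaps_in_Z:
  obtains \<phi> \<psi> :: "Y \<Rightarrow> Z" where "\<And>y. \<phi> y < \<psi> y" "\<And>x y. x < y \<Longrightarrow> \<psi> x < \<phi> y"
    "\<And>y. ran (Rep_Z (\<phi> y)) \<subseteq> {-2..2}" "\<And>y. ran (Rep_Z (\<psi> y)) \<subseteq> {-2..2}"
proof -
  let ?f = "\<lambda>y. squash (Rep_Y y)" and ?g = "\<lambda>y. cut_at (squash (Rep_Y y)) 2"
  have n2: "2 \<notin> ran (?f y)" for y using ran_squash[of "Rep_Y y"] by auto
  have Y: "\<exists>\<beta>. isY (?f y) \<beta>" for y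
    using isY_Rep_Y[of y] isY_squash by metis
  have Rf: "Rep_Z (Abs_Z (?f y)) = ?f y" for y
    using Y[of y] Rep_Abs_Z unfolding isY_def by blast
  have Rg: "Rep_Z (Abs_Z (?g y)) = ?g y" for y
    using Y[of y] isY_cut_at[OF _ n2[of y]] Rep_Abs_Z unfolding isY_def by blast
  have "Abs_Z (?f y) < Abs_Z (?g y)" for y
    using Y[of y] first_diff_cut_at[OF _ n2[of y]] unfolding less_Z_iff Rf Rg isY_def by blast
  moreover have "Abs_Z (?g x) < Abs_Z (?f y)" if "x < y" for x y
  proof -
    have "Z_of_Y x < Z_of_Y y" using that by (simp add: Z_of_Y_less)
    then obtain b where "first_diff (Rep_Y x) (Rep_Y y) b"
      unfolding less_Z_iff Rep_Z_of_Y by blast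
    then have d: "first_diff (?f x) (?f y) (arctan b)" by (rule first_diff_squash)
    have "first_diff (?g x) (?f y) (arctan b)"
      using Y[of x] Y[of y] cut_at_first_diff[OF _ n2[of x] _ d arctan_less_2] unfolding isY_def by blast
    then show ?thesis unfolding less_Z_iff Rf Rg by blast
  qed
  moreover have "ran (Rep_Z (Abs_Z (?f y))) \<subseteq> {-2..2}" for y
    unfolding Rf using ran_squash[of "Rep_Y y"] by auto
  moreover have "ran (Rep_Z (Abs_Z (?g y))) \<subseteq> {-2..2}" for y
  proof -
    have "ran (?g y) \<subseteq> insert 2 (ran (?f y))"
      by (auto simp: ran_def cut_at_def split: if_splits)
    also have "\<dots> \<subseteq> {-2..2}" using ran_squash[of "Rep_Y y"] by auto
    finally show ?thesis unfolding Rg .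
  qed
  ultimately show ?thesis
    using that[of "\<lambda>y. Abs_Z (?f y)" "\<lambda>y. Abs_Z (?g y)"] by simp
qed

text \<open>A single value above all others makes a small element of \<open>Z\<close>. It keeps the
  set whose supremum is taken nonempty even at the root of the tree.\<close>

lemma Z_below_bounded:
  obtains z :: Z where "ran (Rep_Z z) \<subseteq> {-2..3}" "\<And>w. ran (Rep_Z w) \<subseteq> {-2..2} \<Longrightarrow> z < w"
proof -
  obtain b :: omega1 where b: "\<And>a. b \<le> a" using Least_le[of "\<lambda>_. True"] by blast
  have nb: "\<not> a < b" for a using b[of a] by simp
  have "isZ [b \<mapsto> 3] b"
    using nb b by (auto simp: isZ_def is_lim_def dest: order.antisym)
  then have R: "Rep_Z (Abs_Z [b \<mapsto> 3]) = [b \<mapsto> 3]" by (rule Rep_Abs_Z)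
  have "Abs_Z [b \<mapsto> 3] < w" if "ran (Rep_Z w) \<subseteq> {-2..2}" for w
  proof -
    obtain \<beta> where "dom (Rep_Z w) = {..\<beta>}" using dom_Rep_Z[of w] by blast
    then have "b \<in> dom (Rep_Z w)" using b by simp
    then obtain r where r: "Rep_Z w b = Some r" by blast
    then have "r \<le> 2" using that by (auto simp: ran_def)
    then show ?thesis unfolding less_Z_iff first_diff_def R using r nb by (intro exI[of _ r] exI[of _ b]) auto
  qed
  then show ?thesis using that[of "Abs_Z [b \<mapsto> 3]"] R by auto
qed

text \<open>If \<open>y\<close> belongs to \<open>t\<close> but not to \<open>s\<close>, all of
  \<open>s\<close> lies below \<open>y\<close>, and the gap between \<open>\<phi> y\<close> and
  \<open>\<psi> y\<close> separates the two suprema.\<close>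

lemma sigma_Y_embeds_in_Z: "\<exists>\<rho> :: Y sigma \<Rightarrow> Z. strict_mono \<rho>"
proof -
  obtain \<phi> \<psi> :: "Y \<Rightarrow> Z" where gap: "\<And>y. \<phi> y < \<psi> y" "\<And>x y. x < y \<Longrightarrow> \<psi> x < \<phi> y"
    and ran: "\<And>y. ran (Rep_Z (\<phi> y)) \<subseteq> {-2..2}" "\<And>y. ran (Rep_Z (\<psi> y)) \<subseteq> {-2..2}"
    by (rule Y_gaps_in_Z) blast
  obtain z where z: "ran (Rep_Z z) \<subseteq> {-2..3}" "\<And>w. ran (Rep_Z w) \<subseteq> {-2..2} \<Longrightarrow> z < w"
    by (rule Z_below_bounded) blast
  have "\<exists>s. (\<forall>w\<in>insert z (\<psi> ` Rep_sigma t). w \<le> s) \<and>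
      (\<forall>v. (\<forall>w\<in>insert z (\<psi> ` Rep_sigma t). w \<le> v) \<longrightarrow> s \<le> v)" for t
  proof (rule Z_lub)
    show "ran (Rep_Z w) \<subseteq> {-2..3}" if "w \<in> insert z (\<psi> ` Rep_sigma t)" for w
      using that ran(2) z(1) by fastforce
  qed simp
  then obtain \<rho> where up: "\<And>t w. w \<in> insert z (\<psi> ` Rep_sigma t) \<Longrightarrow> w \<le> \<rho> t"
    and least: "\<And>t v. (\<And>w. w \<in> insert z (\<psi> ` Rep_sigma t) \<Longrightarrow> w \<le> v) \<Longrightarrow> \<rho> t \<le> v"
    by metis
  have "\<rho> s < \<rho> t" if st: "s < t" for s t
  proof -
    have le: "s \<le> t" using st by simp
    have "Rep_sigma s \<noteq> Rep_sigma t" using st by (auto simp: Rep_sigma_inject)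
    then obtain y where y: "y \<in> Rep_sigma t" "y \<notin> Rep_sigma s"
      using sigma_le_subset[OF le] by blast
    have "x < y" if "x \<in> Rep_sigma s" for x
      using sigma_le_down[OF le that y(1)] y(2) by (meson not_le)
    then have "\<rho> s \<le> \<phi> y"
      using z(2)[OF ran(1)] gap(2) by (intro least) (auto intro: less_imp_le)
    also have "\<phi> y < \<psi> y" by (rule gap)
    also have "\<psi> y \<le> \<rho> t" using y(1) by (intro up) auto
    finally show ?thesis .
  qed
  then show ?thesis unfolding strict_mono_def by blast
qed

section \<open>Well-ordered sets of reals as elements of \<open>Z\<close>\<close>

definition unused :: "real set \<Rightarrow> rseq \<Rightarrow> omega1 \<Rightarrow> real set" where
  "unused A e \<xi> = A - {r. \<exists>\<zeta><\<xi>. e \<zeta> = Some r}"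

text \<open>The increasing enumeration of \<open>A\<close> by countable ordinals: for well-ordered
  \<open>A\<close> the infimum is the least element not yet used.\<close>

definition enum :: "real set \<Rightarrow> rseq" where
  "enum A = (SOME e. \<forall>\<xi>. e \<xi> = (if unused A e \<xi> = {} then None else Some (Inf (unused A e \<xi>))))"

lemma enum: "enum A \<xi> = (if unused A (enum A) \<xi> = {} then None else Some (Inf (unused A (enum A) \<xi>)))"
proof -
  let ?G = "\<lambda>e \<xi>. if unused A e \<xi> = {} then None else Some (Inf (unused A e \<xi>))"
  have "\<exists>e. \<forall>\<xi>. e \<xi> = ?G e \<xi>"
  proof (rule ex_recursive_solution)
    show "wf {(x::omega1, y). x < y}" by (rule wf)
    show "?G f x = ?G g x" if "\<And>z. z < x \<Longrightarrow> f z = g z" for f g x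
    proof -
      have "unused A f x = unused A g x" unfolding unused_def using that by auto
      then show ?thesis by simp
    qed
  qed
  then have "\<forall>\<xi>. enum A \<xi> = ?G (enum A) \<xi>" unfolding enum_def by (rule someI_ex)
  then show ?thesis by blast
qed

lemma enum_None: "enum A \<xi> = None \<longleftrightarrow> unused A (enum A) \<xi> = {}"
  using enum[of A \<xi>] by (simp split: if_splits)

lemma enum_Some:
  assumes "well_ordered A" and "enum A \<xi> = Some r"
  shows "r \<in> unused A (enum A) \<xi>" and "\<And>c. c \<in> unused A (enum A) \<xi> \<Longrightarrow> r \<le> c"
proof -
  let ?U = "unused A (enum A) \<xi>"
  have r: "?U \<noteq> {}" "r = Inf ?U" using assms(2) enum[of A \<xi>] by (auto split: if_splits)
  have "?U \<subseteq> A" by (auto simp: unused_def)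
  then obtain b where b: "b \<in> ?U" "\<And>c. c \<in> ?U \<Longrightarrow> b \<le> c"
    using assms(1)[unfolded well_ordered_iff_least, rule_format, OF _ r(1)] by blast
  have "r = b" unfolding r(2) using b by (intro cInf_eq_minimum)
  then show "r \<in> ?U" "\<And>c. c \<in> ?U \<Longrightarrow> r \<le> c" using b by auto
qed

lemma enum_less:
  assumes A: "well_ordered A" and "\<zeta> < \<xi>" "enum A \<xi> = Some r"
  obtains q where "enum A \<zeta> = Some q" "q < r"
proof -
  have r: "r \<in> unused A (enum A) \<xi>" using enum_Some(1)[OF A assms(3)] .
  then have r': "r \<in> unused A (enum A) \<zeta>" using assms(2) by (auto simp: unused_def)
  then obtain q where q: "enum A \<zeta> = Some q" using enum_None[of A \<zeta>] by auto
  have "q \<le> r" using enum_Some(2)[OF A q r'] .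
  moreover have "q \<noteq> r" using r q assms(2) by (auto simp: unused_def)
  ultimately show ?thesis using that[OF q] by simp
qed

text \<open>If \<open>a\<close> were never reached, the enumeration would never stop and would map
  \<open>omega1\<close> strictly increasingly into the reals.\<close>

lemma enum_surj:
  assumes A: "well_ordered A" and a: "a \<in> A"
  obtains \<xi> where "enum A \<xi> = Some a"
proof (rule ccontr)
  assume "\<not> thesis"
  then have "enum A \<xi> \<noteq> Some a" for \<xi> using that by blast
  then have "a \<in> unused A (enum A) \<xi>" for \<xi> using a by (simp add: unused_def)
  then have S: "\<exists>r. enum A \<xi> = Some r" for \<xi> using enum_None[of A \<xi>] by auto
  have "the (enum A \<zeta>) < the (enum A \<xi>)" if "\<zeta> < \<xi>" for \<zeta> \<xi>
    using S[of \<xi>] enum_less[OF A that] by (metis option.sel)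
  then show False by (rule no_strict_mono_omega1_real)
qed

text \<open>By induction on the index, the enumeration up to the value \<open>r\<close> sees only
  elements not exceeding \<open>r\<close>. This turns comparisons of sets into comparisons of
  sequences.\<close>

lemma enum_agree:
  assumes A: "well_ordered A" and B: "well_ordered B" and "enum B \<xi> = Some r" "\<And>q. q \<le> r \<Longrightarrow> q \<in> A \<longleftrightarrow> q \<in> B"
  shows "enum A \<xi> = Some r"
  using assms(3,4)
proof (induction \<xi> arbitrary: r rule: less_induct)
  case (less \<xi>)
  have e: "enum A \<zeta> = enum B \<zeta>" if z: "\<zeta> < \<xi>" for \<zeta>
  proof -
    obtain q where q: "enum B \<zeta> = Some q" "q < r" using enum_less[OF B z less.prems(1)] .
    then have "enum A \<zeta> = Some q" using less.prems(2) by (intro less.IH[OF z]) auto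
    then show ?thesis using q by simp
  qed
  have un: "q \<in> unused A (enum A) \<xi> \<longleftrightarrow> q \<in> unused B (enum B) \<xi>" if "q \<le> r" for q
    using less.prems(2)[OF that] e by (auto simp: unused_def)
  have r: "r \<in> unused A (enum A) \<xi>"
    using un enum_Some(1)[OF B less.prems(1)] by blast
  then obtain q where q: "enum A \<xi> = Some q" using enum_None[of A \<xi>] by auto
  have "q \<le> r" using enum_Some(2)[OF A q r] .
  moreover have "r \<le> q"
    using un[OF calculation] enum_Some(1)[OF A q] enum_Some(2)[OF B less.prems(1)] by blast
  ultimately show ?case using q by simp
qed

text \<open>The nonempty well-ordered compact sets of reals, which are the ranges of the elements of
  \<open>Y\<close>. Closure under suprema makes the enumeration continuous and gives it a last
  value.\<close>

definition compact_wo :: "real set \<Rightarrow> bool" where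
  "compact_wo A \<longleftrightarrow> A \<noteq> {} \<and> bdd_above A \<and> well_ordered A \<and> (\<forall>B\<subseteq>A. B \<noteq> {} \<longrightarrow> Sup B \<in> A)"

lemma compact_wo_Sup: "compact_wo A \<Longrightarrow> Sup A \<in> A" "compact_wo A \<Longrightarrow> a \<in> A \<Longrightarrow> a \<le> Sup A"
  unfolding compact_wo_def by (auto intro: cSup_upper)

lemma isY_enum:
  assumes A: "compact_wo A"
  obtains \<beta> where "isY (enum A) \<beta>" "enum A \<beta> = Some (Sup A)"
proof -
  have w: "well_ordered A" using A by (simp add: compact_wo_def)
  obtain \<beta> where \<beta>: "enum A \<beta> = Some (Sup A)" using enum_surj[OF w compact_wo_Sup(1)[OF A]] .
  have inA: "r \<in> A" if "enum A \<xi> = Some r" for \<xi> r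
    using enum_Some(1)[OF w that] by (simp add: unused_def)
  have le: "\<xi> \<le> \<beta>" if "enum A \<xi> = Some r" for \<xi> r
  proof (rule ccontr)
    assume "\<not> \<xi> \<le> \<beta>"
    then have "\<beta> < \<xi>" by simp
    then have "Sup A < r" using enum_less[OF w _ that] \<beta> by fastforce
    then show False using compact_wo_Sup(2)[OF A inA[OF that]] by simp
  qed
  have dom: "\<exists>r. enum A \<xi> = Some r" if "\<xi> \<le> \<beta>" for \<xi>
    using that enum_less[OF w _ \<beta>] \<beta> by (metis le_less)
  have st: "the (enum A \<zeta>) < the (enum A \<xi>)" if "\<zeta> < \<xi>" "\<xi> \<le> \<beta>" for \<zeta> \<xi>
    using dom[OF that(2)] enum_less[OF w that(1)] by (metis option.sel)
  have lim: "\<exists>\<zeta><\<xi>. the (enum A \<xi>) - e < the (enum A \<zeta>)" if \<xi>: "\<xi> \<le> \<beta>" "is_lim \<xi>" "0 < e" for \<xi> e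
  proof (rule ccontr)
    assume n: "\<not> (\<exists>\<zeta><\<xi>. the (enum A \<xi>) - e < the (enum A \<zeta>))"
    let ?B = "(\<lambda>\<zeta>. the (enum A \<zeta>)) ` {..<\<xi>}"
    obtain r where r: "enum A \<xi> = Some r" using dom[OF \<xi>(1)] ..
    have sub: "?B \<subseteq> A"
    proof
      fix q assume "q \<in> ?B"
      then obtain \<zeta> where z: "\<zeta> < \<xi>" "q = the (enum A \<zeta>)" by blast
      have "\<zeta> \<le> \<beta>" using z(1) \<xi>(1) by simp
      then obtain q' where "enum A \<zeta> = Some q'" using dom[of \<zeta>] by blast
      then show "q \<in> A" using inA z by simp
    qed
    have ne: "?B \<noteq> {}" using \<xi>(2) unfolding is_lim_def by blast
    have "Sup ?B \<in> A" using A sub ne unfolding compact_wo_def by blast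
    moreover have "Sup ?B \<le> r - e"
      using n r by (intro cSup_least[OF ne]) (fastforce simp: not_less)
    ultimately have s: "Sup ?B < r" "Sup ?B \<in> A" using \<xi>(3) by auto
    \<comment> \<open>The supremum of the earlier values is an element of \<open>A\<close> below the
      value at \<open>\<xi>\<close>, so it was used before; but the values between that index and
      \<open>\<xi>\<close> exceed it.\<close>
    have "Sup ?B \<notin> unused A (enum A) \<xi>" using enum_Some(2)[OF w r, of "Sup ?B"] s(1) by auto
    then obtain \<zeta> where z: "\<zeta> < \<xi>" "enum A \<zeta> = Some (Sup ?B)" using s(2) by (auto simp: unused_def)
    then obtain p where p: "p < \<xi>" "\<zeta> < p" using \<xi>(2) unfolding is_lim_def by blast
    have "Sup ?B < the (enum A p)" using st[OF p(2)] p(1) \<xi>(1) z(2) by simp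
    moreover have "the (enum A p) \<le> Sup ?B"
      using p(1) sub A unfolding compact_wo_def by (intro cSup_upper) (auto intro: bdd_above_mono)
    ultimately show False by simp
  qed
  have "dom (enum A) = {..\<beta>}" using dom le by auto
  then have "isY (enum A) \<beta>" using st lim unfolding isY_def isZ_def by (auto simp: less_imp_le)
  then show ?thesis using that \<beta> by blast
qed

text \<open>The flag says whether the last value is doubled, that is, whether the result lies outside \<open>Y\<close>.\<close>

definition enumZ :: "real set \<Rightarrow> bool \<Rightarrow> rseq" where
  "enumZ A f = (\<lambda>\<xi>. if enum A \<xi> = None \<and> f \<and> (\<forall>\<zeta><\<xi>. enum A \<zeta> \<noteq> None) then Some (Sup A)
     else enum A \<xi>)"

lemma isZ_enumZ:
  assumes A: "compact_wo A"
  obtains \<beta> where "isZ (enumZ A f) \<beta>" "enumZ A f \<beta> = Some (Sup A)" "isY (enumZ A f) \<beta> \<longleftrightarrow> \<not> f"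
proof -
  obtain \<beta> where \<beta>: "isY (enum A) \<beta>" "enum A \<beta> = Some (Sup A)" using isY_enum[OF A] .
  have dom: "enum A \<xi> \<noteq> None \<longleftrightarrow> \<xi> \<le> \<beta>" for \<xi>
  proof -
    have "\<xi> \<in> dom (enum A) \<longleftrightarrow> \<xi> \<le> \<beta>" using \<beta>(1) unfolding isY_def isZ_def by simp
    then show ?thesis by (simp add: domIff)
  qed
  show ?thesis
  proof (cases f)
    case False
    then have "enumZ A f = enum A" by (auto simp: enumZ_def)
    then show ?thesis using that[of \<beta>] \<beta> False by (simp add: isY_def)
  next
    case True
    obtain \<sigma> where s: "\<beta> < \<sigma>" "\<And>\<eta>. \<eta> < \<sigma> \<longleftrightarrow> \<eta> \<le> \<beta>" by (rule omega1_next[of \<beta>]) blast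
    have e: "enumZ A f \<xi> = (if \<xi> \<le> \<beta> then enum A \<xi> else if \<xi> = \<sigma> then Some (Sup A) else None)" for \<xi>
    proof -
      have "\<not> \<xi> \<le> \<beta> \<Longrightarrow> (\<forall>\<zeta><\<xi>. \<zeta> \<le> \<beta>) \<longleftrightarrow> \<xi> = \<sigma>"
        unfolding s(2)[symmetric] by (auto simp: not_less le_less)
      moreover have "enum A \<xi> = None \<longleftrightarrow> \<not> \<xi> \<le> \<beta>" using dom[of \<xi>] by blast
      ultimately show ?thesis unfolding enumZ_def dom using True by simp
    qed
    have "\<not> \<sigma> \<le> \<beta>" using s(1) by simp
    then have es: "enumZ A f \<sigma> = Some (Sup A)" by (simp add: e)
    have eb: "enumZ A f \<xi> = enum A \<xi>" if "\<xi> \<le> \<beta>" for \<xi> using that by (simp add: e)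
    \<comment> \<open>The extra index is a successor, so doubling the last value cannot harm
      continuity.\<close>
    have nl: "\<not> is_lim \<sigma>" using s unfolding is_lim_def by (meson not_le)
    have "dom (enumZ A f) = {..\<sigma>}"
      using dom s by (auto simp: e le_less split: if_splits)
    moreover have "the (enumZ A f \<zeta>) < the (enumZ A f \<xi>)" if "\<zeta> < \<xi>" "\<xi> < \<sigma>" for \<zeta> \<xi>
    proof -
      have "\<xi> \<le> \<beta>" "\<zeta> \<le> \<beta>" using that s by auto
      then show ?thesis using \<beta>(1) that(1) eb unfolding isY_def isZ_def by (cases "\<xi> = \<beta>") auto
    qed
    moreover have "the (enumZ A f \<zeta>) \<le> the (enumZ A f \<sigma>)" if "\<zeta> < \<sigma>" for \<zeta>
      using that s eb es \<beta> isZ_mono[of "enum A" \<beta> \<zeta> \<beta>] unfolding isY_def by auto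
    moreover have "\<exists>\<zeta><\<xi>. the (enumZ A f \<xi>) - d < the (enumZ A f \<zeta>)"
      if "\<xi> \<le> \<sigma>" "is_lim \<xi>" "0 < d" for \<xi> d
    proof -
      have "\<xi> \<noteq> \<sigma>" using that(2) nl by blast
      then have "\<xi> < \<sigma>" using that(1) by simp
      then have x: "\<xi> \<le> \<beta>" unfolding s(2) .
      have "isZ (enum A) \<beta>" using \<beta>(1) by (simp add: isY_def)
      then have "\<exists>\<zeta><\<xi>. the (enum A \<xi>) - d < the (enum A \<zeta>)"
        unfolding isZ_def using x that by simp
      then obtain \<zeta> where "\<zeta> < \<xi>" "the (enum A \<xi>) - d < the (enum A \<zeta>)" by blast
      then show ?thesis using x eb by (intro exI[of _ \<zeta>]) auto
    qed
    ultimately have Z: "isZ (enumZ A f) \<sigma>" unfolding isZ_def by blast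
    have "\<not> isY (enumZ A f) \<sigma>"
      using es eb[of \<beta>] \<beta>(2) s(1) unfolding isY_def by auto
    then show ?thesis using that[OF Z es] True by simp
  qed
qed

text \<open>Here \<open>d\<close> is the least element in which the two sets differ. If
  \<open>A\<close> is doubled, \<open>d\<close> must not lie above all of \<open>A\<close>: the
  repeated \<open>Sup A\<close> could then stand, as a smaller value, where \<open>B\<close> has
  \<open>d\<close>. Hence the condition on \<open>f\<close>.\<close>

lemma first_diff_enumZ_new:
  assumes A: "compact_wo A" and B: "compact_wo B" and d: "d \<in> B" "d \<notin> A"
    and agree: "\<And>r. r < d \<Longrightarrow> r \<in> A \<longleftrightarrow> r \<in> B" and f: "f \<Longrightarrow> d < Sup A"
  shows "first_diff (enumZ A f) (enumZ B g) d"
proof -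
  have w: "well_ordered A" "well_ordered B" using A B by (auto simp: compact_wo_def)
  obtain \<alpha> where al: "enum B \<alpha> = Some d" using enum_surj[OF w(2) d(1)] .
  have below: "enum A \<xi> = enum B \<xi> \<and> enum B \<xi> \<noteq> None" if x: "\<xi> < \<alpha>" for \<xi>
  proof -
    obtain q where q: "enum B \<xi> = Some q" "q < d" using enum_less[OF w(2) x al] .
    then have "enum A \<xi> = Some q" using agree by (intro enum_agree[OF w q(1)]) auto
    then show ?thesis using q by simp
  qed
  have "enumZ A f \<alpha> = None \<or> (\<exists>a. enumZ A f \<alpha> = Some a \<and> d < a)"
  proof (cases "enum A \<alpha>")
    case None
    then show ?thesis using f by (auto simp: enumZ_def)
  next
    case (Some r)
    have "d < r"
    proof (rule ccontr)
      assume "\<not> d < r"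
      moreover have "r \<in> A" using enum_Some(1)[OF w(1) Some] by (simp add: unused_def)
      ultimately have "r < d" using d(2) by (cases "r = d") auto
      then have "enum B \<alpha> = Some r" using agree by (intro enum_agree[OF w(2,1) Some]) auto
      then show False using al \<open>r < d\<close> by simp
    qed
    then show ?thesis using Some by (simp add: enumZ_def)
  qed
  moreover have "enumZ A f \<xi> = enumZ B g \<xi>" if "\<xi> < \<alpha>" for \<xi>
    using below[OF that] by (auto simp: enumZ_def)
  moreover have "enumZ B g \<alpha> = Some d" using al by (simp add: enumZ_def)
  ultimately show ?thesis unfolding first_diff_def by (intro exI[of _ \<alpha>]) blast
qed

text \<open>One index past the enumeration of \<open>B\<close> the doubled sequence repeats
  \<open>Sup B\<close>, while the sequence of \<open>A\<close> has ended or shows an element above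
  \<open>Sup B\<close>.\<close>

lemma first_diff_enumZ_doubled:
  assumes A: "compact_wo A" and B: "compact_wo B" and init: "B = A \<inter> {..Sup B}" and f: "A = B \<Longrightarrow> \<not> f"
  shows "first_diff (enumZ A f) (enumZ B True) (Sup B)"
proof -
  have w: "well_ordered A" "well_ordered B" using A B by (auto simp: compact_wo_def)
  obtain \<beta> where \<beta>: "isY (enum B) \<beta>" "enum B \<beta> = Some (Sup B)" using isY_enum[OF B] .
  have dom: "enum B \<xi> \<noteq> None \<longleftrightarrow> \<xi> \<le> \<beta>" for \<xi>
  proof -
    have "\<xi> \<in> dom (enum B) \<longleftrightarrow> \<xi> \<le> \<beta>" using \<beta>(1) unfolding isY_def isZ_def by simp
    then show ?thesis by (simp add: domIff)
  qed
  obtain \<sigma> where s: "\<beta> < \<sigma>" "\<And>\<eta>. \<eta> < \<sigma> \<longleftrightarrow> \<eta> \<le> \<beta>" by (rule omega1_next[of \<beta>]) blast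
  have inB: "r \<in> B" if "enum B \<xi> = Some r" for \<xi> r
    using enum_Some(1)[OF w(2) that] by (simp add: unused_def)
  have init': "q \<in> B \<longleftrightarrow> q \<in> A \<and> q \<le> Sup B" for q by (subst init) simp
  have agree: "q \<in> A \<longleftrightarrow> q \<in> B" if "q \<le> Sup B" for q using init'[of q] that by simp
  have eq: "enum A \<xi> = enum B \<xi>" if "\<xi> \<le> \<beta>" for \<xi>
  proof -
    have "enum B \<xi> \<noteq> None" using dom[of \<xi>] that by simp
    then obtain r where r: "enum B \<xi> = Some r" by blast
    have "r \<le> Sup B" using compact_wo_Sup(2)[OF B inB[OF r]] .
    then have "enum A \<xi> = Some r" using agree by (intro enum_agree[OF w r]) auto
    then show ?thesis using r by simp
  qed
  have used: "\<exists>\<zeta><\<sigma>. enum A \<zeta> = Some r" if "r \<in> B" for r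
  proof -
    from enum_surj[OF w(2) that] obtain \<zeta> where z: "enum B \<zeta> = Some r" .
    then have "\<zeta> \<le> \<beta>" using dom[of \<zeta>] by auto
    then show ?thesis using eq[of \<zeta>] z s(2) by (intro exI[of _ \<zeta>]) auto
  qed
  have "enumZ A f \<sigma> = None \<or> (\<exists>a. enumZ A f \<sigma> = Some a \<and> Sup B < a)"
  proof (cases "enum A \<sigma>")
    case None
    have "A \<subseteq> B"
    proof
      fix a assume "a \<in> A"
      then obtain \<zeta> where z: "enum A \<zeta> = Some a" using enum_surj[OF w(1)] by blast
      have "\<not> \<sigma> < \<zeta>"
      proof
        assume "\<sigma> < \<zeta>"
        from enum_less[OF w(1) this z] show False using None by auto
      qed
      moreover have "\<zeta> \<noteq> \<sigma>" using None z by auto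
      ultimately have "\<zeta> < \<sigma>" by simp
      then have "\<zeta> \<le> \<beta>" unfolding s(2) .
      then show "a \<in> B" using eq z inB by auto
    qed
    then have "\<not> f" using f init' by blast
    then show ?thesis using None by (simp add: enumZ_def)
  next
    case (Some r)
    have "r \<in> A - {r. \<exists>\<zeta><\<sigma>. enum A \<zeta> = Some r}"
      using enum_Some(1)[OF w(1) Some] unfolding unused_def .
    then have "r \<in> A" "r \<notin> B" using used by blast+
    then have "Sup B < r" using init'[of r] by simp
    then show ?thesis using Some by (simp add: enumZ_def)
  qed
  note top = this
  have "enum B \<sigma> = None" using dom[of \<sigma>] s(1) by auto
  moreover have "\<forall>\<zeta><\<sigma>. enum B \<zeta> \<noteq> None" unfolding dom s(2) by simp
  ultimately have "enumZ B True \<sigma> = Some (Sup B)" by (simp add: enumZ_def)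
  moreover have "enumZ A f \<xi> = enumZ B True \<xi>" if "\<xi> < \<sigma>" for \<xi>
  proof -
    have "\<xi> \<le> \<beta>" using that unfolding s(2) .
    then show ?thesis using eq[of \<xi>] dom[of \<xi>] by (auto simp: enumZ_def)
  qed
  ultimately show ?thesis unfolding first_diff_def using top by (intro exI[of _ \<sigma>]) blast
qed

section \<open>Hausdorff trees and their function spaces\<close>

lemma tree_least:
  fixes t :: "'a::tree"
  assumes "Q \<noteq> {}" "Q \<subseteq> {..t}"
  obtains q where "q \<in> Q" "\<And>p. p \<in> Q \<Longrightarrow> q \<le> p"
  using well_ordered_atMost[of t, unfolded well_ordered_iff_least, rule_format, OF assms(2,1)] by blast

lemma tree_comparable:
  fixes t :: "'a::tree"
  assumes "p \<le> t" "q \<le> t"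
  shows "p \<le> q \<or> q \<le> p"
proof -
  have "{p, q} \<noteq> {}" "{p, q} \<subseteq> {..t}" using assms by auto
  then obtain m where "m \<in> {p, q}" "\<And>s. s \<in> {p, q} \<Longrightarrow> m \<le> s" by (rule tree_least) blast
  then show ?thesis by auto
qed

lemma wf_less_tree: "wf {(x::'a::tree, y). x < y}"
  unfolding wf_eq_minimal
proof (intro allI impI)
  fix Q and q :: 'a assume q: "q \<in> Q"
  have "Q \<inter> {..q} \<noteq> {}" "Q \<inter> {..q} \<subseteq> {..q}" using q by auto
  then obtain m where m: "m \<in> Q \<inter> {..q}" "\<And>p. p \<in> Q \<inter> {..q} \<Longrightarrow> m \<le> p"
    by (rule tree_least) blast
  have "p \<notin> Q" if "p < m" for p
  proof
    assume "p \<in> Q"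
    then have "p \<in> Q \<inter> {..q}" using m(1) that by auto
    then show False using m(2) that by (meson leD)
  qed
  then show "\<exists>z\<in>Q. \<forall>y. (y, z) \<in> {(x, y). x < y} \<longrightarrow> y \<notin> Q" using m(1) by blast
qed

definition succ_of :: "'a::order \<Rightarrow> 'a \<Rightarrow> bool" where
  "succ_of r s \<longleftrightarrow> r < s \<and> (\<forall>q<s. q \<le> r)"

lemma tree_cases:
  fixes s :: "'a::tree"
  obtains (minimal) "\<And>q. \<not> q < s" | (succ) r where "succ_of r s" | (lim) "is_lim s"
proof -
  consider "\<And>q. \<not> q < s" | "is_lim s" | r where "r < s" "\<And>p. p < s \<Longrightarrow> \<not> r < p"
    unfolding is_lim_def by blast
  then show thesis
  proof cases
    case 3
    have "p \<le> r" if "p < s" for p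
      using tree_comparable[of p s r] 3 that by (metis le_less less_imp_le)
    then show thesis using succ[of r] 3(1) by (simp add: succ_of_def)
  qed (use minimal lim in blast)+
qed

lemma succ_of_not_lim: "succ_of r s \<Longrightarrow> \<not> is_lim s"
  unfolding succ_of_def is_lim_def by (meson leD)

lemma succ_of_less_iff: "succ_of r s \<Longrightarrow> q < s \<longleftrightarrow> q \<le> r"
  unfolding succ_of_def by (auto intro: le_less_trans)

lemma succ_of_unique: "succ_of r s \<Longrightarrow> succ_of r' s \<Longrightarrow> r = r'"
  unfolding succ_of_def by (meson order.antisym)

lemma succ_of_le: "succ_of r s \<Longrightarrow> q \<le> s \<Longrightarrow> q \<le> r \<or> q = s"
  unfolding succ_of_def by (auto simp: le_less)

lemma imm_succs_succ_of:
  fixes t :: "'a::tree"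
  assumes "u \<in> imm_succs t"
  shows "succ_of t u"
  unfolding succ_of_def
proof (intro conjI allI impI)
  show "t < u" using assms by (simp add: imm_succs_def)
  fix q assume "q < u"
  then show "q \<le> t"
    using tree_comparable[of q u t] assms by (auto simp: imm_succs_def le_less)
qed

text \<open>Limit nodes are determined by their predecessors, the usual criterion for the interval
  topology of a tree to be Hausdorff.\<close>

class hausdorff_tree = interval_topology_tree +
  assumes limit_unique: "(\<exists>q. q < t) \<Longrightarrow> (\<And>q. q < t \<Longrightarrow> \<exists>p. p < t \<and> q < p) \<Longrightarrow>
    (\<And>s. s < t \<Longrightarrow> s \<le> a) \<Longrightarrow> t \<le> a"

lemma lim_le:
  fixes t :: "'a::hausdorff_tree"
  assumes "is_lim t" "\<And>s. s < t \<Longrightarrow> s \<le> a"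
  shows "t \<le> a"
proof (rule limit_unique)
  show "\<exists>q. q < t" "\<And>q. q < t \<Longrightarrow> \<exists>p. p < t \<and> q < p"
    using assms(1) unfolding is_lim_def by blast+
qed (rule assms(2))

lemma sigma_initial:
  fixes t :: "'a::linorder sigma"
  assumes D: "D \<subseteq> Rep_sigma t" "\<And>a b. a \<in> D \<Longrightarrow> b \<in> Rep_sigma t \<Longrightarrow> b \<le> a \<Longrightarrow> b \<in> D"
  obtains s where "Rep_sigma s = D" "s \<le> t"
proof -
  have "well_ordered (Rep_sigma t)" using Rep_sigma[of t] by simp
  then have "well_ordered D" unfolding well_ordered_iff_least using D(1) by (meson subset_trans)
  then have R: "Rep_sigma (Abs_sigma D) = D" by (simp add: Abs_sigma_inverse)
  moreover have "Abs_sigma D \<le> t"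
    unfolding less_eq_sigma_def initial_segment_def R using D by blast
  ultimately show thesis by (rule that)
qed

text \<open>A limit \<open>t\<close> has no largest element \<open>x\<close>, since \<open>t\<close>
  without \<open>x\<close> would be an immediate predecessor. So every element of \<open>t\<close>
  already lies in a proper initial segment of \<open>t\<close>, to which the assumption on
  \<open>a\<close> applies.\<close>

instance sigma :: (linorder) hausdorff_tree
proof
  fix t a :: "'a sigma"
  assume "\<exists>q. q < t" "\<And>q. q < t \<Longrightarrow> \<exists>p. p < t \<and> q < p"
  then have lim: "is_lim t" unfolding is_lim_def by blast
  assume below: "\<And>s. s < t \<Longrightarrow> s \<le> a"
  have "x \<in> Rep_sigma a \<and> (\<forall>b\<in>Rep_sigma a. b \<le> x \<longrightarrow> b \<in> Rep_sigma t)" if x: "x \<in> Rep_sigma t" for x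
  proof -
    obtain s where s: "Rep_sigma s = {y \<in> Rep_sigma t. y \<le> x}" "s \<le> t"
      by (rule sigma_initial[of "{y \<in> Rep_sigma t. y \<le> x}" t]) auto
    have "s \<noteq> t"
    proof
      assume "s = t"
      then have max: "y \<le> x" if "y \<in> Rep_sigma t" for y using s(1) that by blast
      obtain r where r: "Rep_sigma r = Rep_sigma t - {x}" "r \<le> t"
        by (rule sigma_initial[of "Rep_sigma t - {x}" t]) (use max in \<open>auto intro: order.antisym\<close>)
      then have "r < t" using x by (auto simp: le_less)
      then obtain p where p: "p < t" "r < p" using lim unfolding is_lim_def by blast
      have "Rep_sigma r \<subseteq> Rep_sigma p" "Rep_sigma p \<subseteq> Rep_sigma t"
        using sigma_le_subset[of r p] sigma_le_subset[of p t] p by auto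
      then have "Rep_sigma p = Rep_sigma r \<or> Rep_sigma p = Rep_sigma t" using r(1) by blast
      then show False using p by (auto simp: Rep_sigma_inject)
    qed
    then have sa: "s \<le> a" using s(2) by (intro below) simp
    have xs: "x \<in> Rep_sigma s" using s(1) x by simp
    then show ?thesis
      using sigma_le_subset[OF sa xs] sigma_le_down[OF sa xs] sigma_le_subset[OF s(2)] by blast
  qed
  then show "t \<le> a" unfolding less_eq_sigma_def initial_segment_def by blast
qed

section \<open>Neighbourhoods and compactness in the interval topology\<close>

lemma open_atMost_tree: "open {..t :: 'a::interval_topology_tree}"
  and open_Compl_atMost_tree: "open (- {..t :: 'a::interval_topology_tree})"
  unfolding open_interval_topology by (auto intro: generate_topology.Basis)

text \<open>Intervals ending in \<open>t\<close> form a neighbourhood base at \<open>t\<close>. The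
  property is traced through the generation of the topology; the real case is the complement of some
  \<open>{..a}\<close>.\<close>

lemma tree_nhd:
  fixes t :: "'a::hausdorff_tree"
  assumes "open U" "t \<in> U"
  shows "{..t} \<subseteq> U \<or> (\<exists>r<t. {..t} - {..r} \<subseteq> U)"
proof -
  have "generate_topology (range atMost \<union> range (\<lambda>t::'a. - {..t})) U"
    using assms(1) unfolding open_interval_topology .
  then show ?thesis using assms(2)
  proof (induction U rule: generate_topology.induct)
    case UNIV
    then show ?case by simp
  next
    case (Int a b)
    then have "{..t} \<subseteq> a \<or> (\<exists>r<t. {..t} - {..r} \<subseteq> a)" "{..t} \<subseteq> b \<or> (\<exists>r<t. {..t} - {..r} \<subseteq> b)"
      by auto
    then consider "{..t} \<subseteq> a \<inter> b" | r where "r < t" "{..t} - {..r} \<subseteq> a \<inter> b"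
      | r q where "r < t" "q < t" "{..t} - {..r} \<subseteq> a" "{..t} - {..q} \<subseteq> b" by blast
    then show ?case
    proof cases
      case 3
      then have "r \<le> q \<or> q \<le> r" using tree_comparable[of r t q] by simp
      then have "{..t} - {..q} \<subseteq> a \<inter> b \<or> {..t} - {..r} \<subseteq> a \<inter> b"
        using 3 by (auto dest: order_trans)
      then show ?thesis using 3 by blast
    qed blast+
  next
    case (UN K)
    then obtain k where "k \<in> K" "t \<in> k" by blast
    then show ?case using UN.IH[of k] by blast
  next
    case (Basis s)
    then consider a where "s = {..a}" | a where "s = - {..a}" by auto
    then show ?case
    proof cases
      case 1
      then show ?thesis using Basis.prems by (auto intro: order_trans)
    next
      case (2 a)
      \<comment> \<open>The first node \<open>q\<close> on the way to \<open>t\<close> that is not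
        below \<open>a\<close> cannot be a limit, by the Hausdorff property. So the interval
        starting with \<open>q\<close> is all of \<open>{..t}\<close> or begins right after the
        predecessor of \<open>q\<close>.\<close>
      let ?Q = "{s \<in> {..t}. \<not> s \<le> a}"
      have "?Q \<noteq> {}" "?Q \<subseteq> {..t}" using 2 Basis.prems by auto
      then obtain q where q: "q \<in> ?Q" "\<And>p. p \<in> ?Q \<Longrightarrow> q \<le> p" by (rule tree_least) blast
      have below: "s \<le> a" if "s < q" for s
      proof (rule ccontr)
        assume "\<not> s \<le> a"
        moreover have "s \<le> t" using that q(1) by (auto intro: order_trans less_imp_le)
        ultimately have "q \<le> s" using q(2) by simp
        then show False using that by (meson leD)
      qed
      have above: "\<not> s \<le> a" if "q \<le> s" for s using q(1) that by (auto dest: order_trans)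
      show ?thesis
      proof (cases q rule: tree_cases)
        case minimal
        have "q \<le> s" if "s \<le> t" for s
          using tree_comparable[of s t q] that q(1) minimal[of s] by (auto simp: le_less)
        then show ?thesis using above 2 by auto
      next
        case (succ r)
        have "q \<le> s" if "s \<le> t" "\<not> s \<le> r" for s
          using tree_comparable[of s t q] that q(1) succ_of_less_iff[OF succ] by (auto simp: le_less)
        then have "{..t} - {..r} \<subseteq> s" using above 2 by auto
        moreover have "r < t" using succ q(1) by (auto simp: succ_of_def intro: less_le_trans)
        ultimately show ?thesis by blast
      next
        case lim
        then have "q \<le> a" using below by (rule lim_le)
        then show ?thesis using q(1) by simp
      qed
    qed
  qed
qed

text \<open>Well-founded induction: a neighbourhood of \<open>t\<close> covers everything above some
  \<open>r < t\<close>, and \<open>{..r}\<close> is already compact.\<close>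

lemma compact_atMost_tree: "compact {..t :: 'a::hausdorff_tree}"
  using wf_less_tree
proof (induction t rule: wf_induct_rule)
  case (less t)
  show ?case
  proof (rule compactI)
    fix C :: "'a set set" assume C: "\<forall>c\<in>C. open c" "{..t} \<subseteq> \<Union>C"
    then obtain U where U: "U \<in> C" "t \<in> U" by blast
    consider "{..t} \<subseteq> U" | r where "r < t" "{..t} - {..r} \<subseteq> U"
      using tree_nhd[of U t] C(1) U by blast
    then show "\<exists>C'\<subseteq>C. finite C' \<and> {..t} \<subseteq> \<Union>C'"
    proof cases
      case 1
      then show ?thesis using U(1) by (intro exI[of _ "{U}"]) auto
    next
      case (2 r)
      have "compact {..r}" using less 2(1) by simp
      moreover have "{..r} \<subseteq> \<Union>C" using C(2) 2(1) by (auto intro: order_trans less_imp_le)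
      ultimately obtain D where D: "D \<subseteq> C" "finite D" "{..r} \<subseteq> \<Union>D"
        using C(1) compactE[of "{..r}" C] by metis
      then show ?thesis using U(1) 2(2) by (intro exI[of _ "insert U D"]) auto
    qed
  qed
qed

section \<open>Elements of \<open>C0\<close> supported in \<open>{..t}\<close>, and averages\<close>

abbreviation val :: "'a::topological_space C0 \<Rightarrow> 'a \<Rightarrow> real" where
  "val x s \<equiv> apply_bcontfun (Rep_C0 x) s"

lemma val_simps [simp]:
  "val (x + y) s = val x s + val y s" "val (x - y) s = val x s - val y s"
  "val (a *\<^sub>R x) s = a * val x s" "val 0 s = 0" "val (- x) s = - val x s"
  by (simp_all add: Rep_C0_simps)

lemma abs_val_le_norm: "\<bar>val x s\<bar> \<le> norm x"
  using norm_bounded[of "Rep_C0 x" s] by (simp add: norm_C0_def)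

lemma norm_C0_le:
  fixes x :: "'a::topological_space C0"
  assumes "\<And>s. \<bar>val x s\<bar> \<le> B"
  shows "norm x \<le> B"
  using assms by (auto simp: norm_C0_def intro!: norm_bound)

lemma val_sum [simp]: "val (sum f I) s = (\<Sum>i\<in>I. val (f i) s)"
  by (induction I rule: infinite_finite_induct) auto

text \<open>The continuous nondecreasing functions on \<open>{..t}\<close>: non-limit nodes are
  isolated there, so continuity means approximation from below at limits.\<close>

definition level_fun :: "('a::tree \<Rightarrow> real) \<Rightarrow> 'a \<Rightarrow> bool" where
  "level_fun F t \<longleftrightarrow> (\<forall>q s. q \<le> s \<longrightarrow> s \<le> t \<longrightarrow> F q \<le> F s) \<and>
     (\<forall>s\<le>t. is_lim s \<longrightarrow> (\<forall>e>0. \<exists>q<s. F s - e < F q))"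

text \<open>Extension by zero is continuous because \<open>{..t}\<close> is open and closed, and
  vanishes at infinity because \<open>{..t}\<close> is compact.\<close>

lemma level_fun_C0:
  fixes F :: "'a::hausdorff_tree \<Rightarrow> real"
  assumes F: "level_fun F t"
  obtains x :: "'a C0" where "\<And>s. val x s = (if s \<le> t then F s else 0)"
proof -
  let ?g = "\<lambda>s. if s \<le> t then F s else 0"
  have near: "\<exists>U. open U \<and> s \<in> U \<and> (\<forall>p\<in>U. dist (?g p) (?g s) < e)" if e: "0 < e" for s and e :: real
  proof (cases "s \<le> t")
    case False
    then show ?thesis using e by (intro exI[of _ "- {..t}"]) (auto simp: open_Compl_atMost_tree)
  next
    case True
    have diffop: "open ({..s} - {..r})" for r :: 'a
      unfolding Diff_eq by (intro open_Int open_atMost_tree open_Compl_atMost_tree)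
    show ?thesis
    proof (cases s rule: tree_cases)
      case minimal
      then have "{..s} = {s}" by (auto simp: le_less)
      then show ?thesis using e open_atMost_tree[of s] by (intro exI[of _ "{s}"]) auto
    next
      case (succ r)
      then have "{..s} - {..r} = {s}" using succ_of_le[OF succ] by (auto simp: succ_of_def dest: leD)
      then show ?thesis using e diffop[of r] by (intro exI[of _ "{s}"]) auto
    next
      case lim
      then obtain r where r: "r < s" "F s - e < F r" using F True e unfolding level_fun_def by blast
      have "dist (?g p) (?g s) < e" if p: "p \<in> {..s} - {..r}" for p
      proof -
        have "r \<le> p" using tree_comparable[of r s p] p r(1) by auto
        then have "F r \<le> F p" "F p \<le> F s" using F True p unfolding level_fun_def by (auto dest: order_trans)
        then show ?thesis using p True r(2) by (auto simp: dist_real_def dest: order_trans)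
      qed
      then show ?thesis using diffop[of r] r(1) by (intro exI[of _ "{..s} - {..r}"]) (auto dest: leD)
    qed
  qed
  have "continuous_on UNIV ?g"
    unfolding continuous_on_def
  proof (intro ballI tendstoI)
    fix s and e :: real assume "0 < e"
    from near[OF this, of s] show "\<forall>\<^sub>F p in at s. dist (?g p) (?g s) < e"
      unfolding eventually_at_topological by blast
  qed
  moreover have van: "vanishes_at_infinity ?g"
    unfolding vanishes_at_infinity_def
    by (intro allI impI exI[of _ "{..t}"]) (auto simp: compact_atMost_tree)
  ultimately have "?g \<in> bcontfun" by (rule vanishes_at_infinity_bcontfun)
  then have B: "apply_bcontfun (Bcontfun ?g) = ?g" by (rule Bcontfun_inverse)
  then have "Rep_C0 (Abs_C0 (Bcontfun ?g)) = Bcontfun ?g"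
    using van by (intro Abs_C0_inverse) simp
  then have "val (Abs_C0 (Bcontfun ?g)) s = ?g s" for s using B by simp
  then show thesis by (rule that)
qed

text \<open>For a non-limit \<open>s\<close> the part of \<open>{..t}\<close> from \<open>s\<close>
  on is open and closed.\<close>

lemma tail_indicator_C0:
  fixes t :: "'a::hausdorff_tree"
  assumes s: "\<not> is_lim s"
  obtains h :: "'a C0" where "\<And>q. val h q = (if s \<le> q \<and> q \<le> t then 1 else 0)"
proof -
  have "level_fun (\<lambda>q. if s \<le> q then 1 else 0) t"
    unfolding level_fun_def
  proof (intro conjI allI impI)
    fix p q :: 'a assume "p \<le> q" "q \<le> t"
    then show "(if s \<le> p then 1 else 0) \<le> ((if s \<le> q then 1 else 0) :: real)"
      by (auto dest: order_trans)
  next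
    fix q :: 'a and e :: real assume q: "q \<le> t" "is_lim q" "0 < e"
    then obtain p where p: "p < q" unfolding is_lim_def by blast
    show "\<exists>p<q. (if s \<le> q then 1 else 0) - e < (if s \<le> p then 1 else 0)"
    proof (cases "s \<le> q")
      case True
      then have "s < q" using s q(2) by (auto simp: le_less)
      then show ?thesis using q(3) by (intro exI[of _ s]) auto
    next
      case False
      then show ?thesis using q(3) p by (intro exI[of _ p]) auto
    qed
  qed
  then obtain h :: "'a C0" where "\<And>q. val h q = (if q \<le> t then if s \<le> q then 1 else 0 else 0)"
    by (rule level_fun_C0) blast
  then show thesis by (intro that[of h]) auto
qed

text \<open>At each point at most one of the differences \<open>x n - F\<close> is nonzero, so their
  sum stays bounded by \<open>R\<close> however many there are.\<close>

lemma C0_disjoint_average: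
  fixes F :: "'a::topological_space C0" and x :: "nat \<Rightarrow> 'a C0"
  assumes disj: "\<And>m n s. m < K \<Longrightarrow> n < K \<Longrightarrow> val (x m - F) s \<noteq> 0 \<Longrightarrow> val (x n - F) s \<noteq> 0 \<Longrightarrow> m = n"
    and bd: "\<And>n. n < K \<Longrightarrow> norm (x n - F) \<le> R" and K: "0 < K" and R: "0 \<le> R"
  shows "norm ((1 / real K) *\<^sub>R (\<Sum>n<K. x n) - F) \<le> R / real K"
proof (rule norm_C0_le)
  fix s
  let ?S = "\<Sum>n<K. val (x n - F) s"
  have "\<bar>?S\<bar> \<le> R"
  proof (cases "\<exists>m<K. val (x m - F) s \<noteq> 0")
    case True
    then obtain m where m: "m < K" "val (x m - F) s \<noteq> 0" by blast
    have "?S = (\<Sum>n\<in>{m}. val (x n - F) s)"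
    proof (rule sum.mono_neutral_right)
      show "\<forall>n\<in>{..<K} - {m}. val (x n - F) s = 0" using disj[OF m(1) _ m(2)] by blast
    qed (use m in auto)
    then show ?thesis using abs_val_le_norm[of "x m - F" s] bd[OF m(1)] by simp
  next
    case False
    then have "?S = 0" by (intro sum.neutral) auto
    then show ?thesis using R by simp
  qed
  moreover have "val ((1 / real K) *\<^sub>R (\<Sum>n<K. x n) - F) s = ?S / real K"
    using K by (simp add: sum_subtractf field_simps)
  ultimately show "\<bar>val ((1 / real K) *\<^sub>R (\<Sum>n<K. x n) - F) s\<bar> \<le> R / real K"
    by (simp only: abs_divide abs_of_nat) (simp add: divide_right_mono)
qed

section \<open>The profile of a norm\<close>

text \<open>Nothing is prescribed above \<open>t\<close>. The value zero at nodes incomparable with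
  \<open>t\<close> is what later makes extensions beyond different immediate successors disjointly
  supported outside the common branch.\<close>

definition exts :: "('a::interval_topology_tree \<Rightarrow> real) \<Rightarrow> 'a \<Rightarrow> 'a C0 set" where
  "exts F t = {x. (\<forall>s\<le>t. val x s = F s) \<and> (\<forall>s. \<not> s \<le> t \<longrightarrow> \<not> t \<le> s \<longrightarrow> val x s = 0)}"

text \<open>Only values on a branch through \<open>s\<close> matter, where \<open>q < s\<close>
  fails exactly if \<open>s \<le> q\<close>.\<close>

definition const_from :: "('a::order \<Rightarrow> real) \<Rightarrow> 'a \<Rightarrow> real \<Rightarrow> 'a \<Rightarrow> real" where
  "const_from F s b = (\<lambda>q. if q < s then F q else b)"

lemma exts_cong: "(\<And>s. s \<le> t \<Longrightarrow> F s = G s) \<Longrightarrow> exts F t = exts G t"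
  unfolding exts_def by auto

lemma exts_antimono: "r \<le> t \<Longrightarrow> exts F t \<subseteq> exts F r"
proof
  fix x assume rt: "r \<le> t" and x: "x \<in> exts F t"
  have "val x s = 0" if "\<not> s \<le> r" "\<not> r \<le> s" for s
  proof -
    have "\<not> s \<le> t" using tree_comparable[of s t r] rt that by blast
    moreover have "\<not> t \<le> s" using rt that(2) by (auto dest: order_trans)
    ultimately show ?thesis using x by (simp add: exts_def)
  qed
  then show "x \<in> exts F r" using x rt by (auto simp: exts_def dest: order_trans)
qed

lemma const_from_succ:
  assumes "succ_of r s"
  shows "const_from F s (F r) = const_from F r (F r)"
  using succ_of_less_iff[OF assms] by (auto simp: const_from_def le_less fun_eq_iff)

lemma const_from_self: "s \<le> t \<Longrightarrow> const_from F t (F t) s = F s"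
  by (auto simp: const_from_def le_less)

lemma const_from_top: "s \<le> t \<Longrightarrow> const_from F s b t = b"
  by (auto simp: const_from_def dest: leD)

lemma level_fun_mono: "level_fun F t \<Longrightarrow> q \<le> s \<Longrightarrow> s \<le> t \<Longrightarrow> F q \<le> F s"
  by (simp add: level_fun_def)

lemma level_fun_subset: "level_fun F t \<Longrightarrow> s \<le> t \<Longrightarrow> level_fun F s"
  unfolding level_fun_def by (meson order_trans)

lemma level_fun_step:
  assumes "\<And>q. q < s \<Longrightarrow> level_fun F q" "\<And>q. q < s \<Longrightarrow> F q \<le> F s"
    and "\<And>e. is_lim s \<Longrightarrow> 0 < e \<Longrightarrow> \<exists>q<s. F s - e < F q"
  shows "level_fun F s"
  unfolding level_fun_def
proof (intro conjI allI impI)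
  fix p q assume "p \<le> q" "q \<le> s"
  then show "F p \<le> F q"
    using assms(1)[of q] assms(2)[of p] by (cases "q = s"; cases "p = s") (auto simp: level_fun_def le_less)
next
  fix q and e :: real assume "q \<le> s" "is_lim q" "0 < e"
  then show "\<exists>p<q. F q - e < F p"
    using assms(1)[of q] assms(3)[of e] by (cases "q = s") (auto simp: level_fun_def le_less)
qed

lemma level_fun_const_from:
  assumes F: "level_fun F s" and st: "s \<le> t"
  shows "level_fun (const_from F s (F s)) t"
  unfolding level_fun_def
proof (intro conjI allI impI)
  fix p q assume pq: "p \<le> q" "q \<le> t"
  show "const_from F s (F s) p \<le> const_from F s (F s) q"
    using pq level_fun_mono[OF F, of p q] level_fun_mono[OF F, of p s]
    by (auto simp: const_from_def dest: le_less_trans)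
next
  fix q and e :: real assume q: "q \<le> t" "is_lim q" "0 < e"
  show "\<exists>p<q. const_from F s (F s) q - e < const_from F s (F s) p"
  proof (cases "q \<le> s")
    case True
    then obtain p where p: "p < q" "F q - e < F p" using F q unfolding level_fun_def by blast
    have "p < s" using p(1) True by (rule less_le_trans)
    then show ?thesis using p True const_from_self[of q s F] by (auto simp: const_from_def)
  next
    case False
    then have "s < q" using tree_comparable[OF q(1) st] by (auto simp: le_less)
    then show ?thesis using q(3) by (intro exI[of _ s]) (auto simp: const_from_def)
  qed
qed

section \<open>Extensions of small norm, for a fixed equivalent norm\<close>

locale equiv_norm =
  fixes N :: "'a::hausdorff_tree C0 \<Rightarrow> real" and c C :: real
  assumes c: "0 < c" and C: "0 < C"
    and triangle: "N (x + y) \<le> N x + N y"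
    and scale: "N (a *\<^sub>R x) = \<bar>a\<bar> * N x"
    and lower: "c * norm x \<le> N x"
    and upper: "N x \<le> C * norm x"
begin

lemma N_zero: "N 0 = 0"
  using scale[of 0 0] by simp

lemma N_sum: "N (sum x I) \<le> (\<Sum>i\<in>I. N (x i))"
proof (induction I rule: infinite_finite_induct)
  case (insert i I)
  then show ?case using triangle[of "x i" "sum x I"] by simp
qed (simp_all add: N_zero)

text \<open>
  The slope \<open>c / 2\<close> is smaller than \<open>c\<close>, so that admissible functions are bounded, and positive, so
  that raising the last value of a function that is admissible and tight costs something.
\<close>

definition admissible :: "('a \<Rightarrow> real) \<Rightarrow> 'a \<Rightarrow> bool" where
  "admissible F t \<longleftrightarrow> (\<forall>e>0. \<exists>x\<in>exts F t. N x < 1 + c / 2 * F t + e)"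

text \<open>Admissible and tight together say that the infimum of \<open>N\<close> over
  \<open>exts F t\<close> is exactly \<open>1 + c / 2 * F t\<close>.\<close>

definition tight :: "('a \<Rightarrow> real) \<Rightarrow> 'a \<Rightarrow> bool" where
  "tight F t \<longleftrightarrow> (\<forall>x\<in>exts F t. 1 + c / 2 * F t \<le> N x)"

lemma admissibleI:
  "(\<And>e. 0 < e \<Longrightarrow> \<exists>x\<in>exts F t. N x < 1 + c / 2 * F t + e) \<Longrightarrow> admissible F t"
  unfolding admissible_def by blast

lemma admissible_cong: "(\<And>s. s \<le> t \<Longrightarrow> F s = G s) \<Longrightarrow> admissible F t = admissible G t"
  unfolding admissible_def using exts_cong[of t F G] by simp

lemma tight_cong: "(\<And>s. s \<le> t \<Longrightarrow> F s = G s) \<Longrightarrow> tight F t = tight G t"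
  unfolding tight_def using exts_cong[of t F G] by simp

lemma admissible_antimono:
  assumes "admissible F t" "r \<le> t" "F r = F t"
  shows "admissible F r"
  using assms exts_antimono[OF assms(2), of F] unfolding admissible_def by (metis subsetD)

text \<open>\<open>c * F t \<le> c * norm x \<le> N x\<close> is compared with
  \<open>1 + c / 2 * F t\<close>; the difference of the slopes \<open>c\<close> and
  \<open>c / 2\<close> gives the bound.\<close>

lemma admissible_bound:
  assumes "admissible F t"
  shows "F t \<le> 2 / c"
proof -
  have "c * F t \<le> 1 + c / 2 * F t"
  proof (rule field_le_epsilon)
    fix e :: real assume "0 < e"
    then obtain x where x: "x \<in> exts F t" "N x < 1 + c / 2 * F t + e"
      using assms unfolding admissible_def by blast
    have "F t = val x t" using x(1) by (simp add: exts_def)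
    then have "F t \<le> norm x" using abs_val_le_norm[of x t] by simp
    then have "c * F t \<le> c * norm x" using c by simp
    then show "c * F t \<le> 1 + c / 2 * F t + e" using lower[of x] x(2) by linarith
  qed
  then show ?thesis using c by (simp add: field_simps)
qed

text \<open>Adding the difference of the two functions, extended by zero outside
  \<open>{..t}\<close>, leaves \<open>x\<close> unchanged beyond \<open>t\<close> and costs at most
  \<open>C * \<delta>\<close>.\<close>

lemma exts_shift:
  assumes x: "x \<in> exts B t" and A: "level_fun A t" and B: "level_fun B t"
    and close: "\<And>s. s \<le> t \<Longrightarrow> \<bar>A s - B s\<bar> \<le> \<delta>" and "0 \<le> \<delta>"
  obtains y where "y \<in> exts A t" "N y \<le> N x + C * \<delta>"
proof -
  obtain a where a: "\<And>s. val a s = (if s \<le> t then A s else 0)" using level_fun_C0[OF A] by blast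
  obtain b where b: "\<And>s. val b s = (if s \<le> t then B s else 0)" using level_fun_C0[OF B] by blast
  have "norm (a - b) \<le> \<delta>" using close \<open>0 \<le> \<delta>\<close> by (intro norm_C0_le) (simp add: a b)
  then have "C * norm (a - b) \<le> C * \<delta>" using C by simp
  then have "N (x + (a - b)) \<le> N x + C * \<delta>"
    using triangle[of x "a - b"] upper[of "a - b"] by linarith
  moreover have "x + (a - b) \<in> exts A t" using x by (auto simp: exts_def a b)
  ultimately show thesis using that by blast
qed

text \<open>Adding a multiple of the indicator of the tail from \<open>s\<close> needs no continuity
  of \<open>F\<close>, so this can be used while the value at \<open>s\<close> is still being
  chosen.\<close>

lemma exts_raise:
  assumes x: "x \<in> exts (const_from F s b) t" and s: "s \<le> t" "\<not> is_lim s" and \<delta>: "0 \<le> \<delta>"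
  obtains y where "y \<in> exts (const_from F s (b + \<delta>)) t" "N y \<le> N x + C * \<delta>"
proof -
  obtain h :: "'a C0" where h: "\<And>q. val h q = (if s \<le> q \<and> q \<le> t then 1 else 0)"
    using tail_indicator_C0[OF s(2)] by blast
  have "norm h \<le> 1" by (intro norm_C0_le) (simp add: h)
  then have "\<bar>\<delta>\<bar> * norm h \<le> \<delta>" using mult_left_mono[of "norm h" 1 \<delta>] \<delta> by simp
  then have "norm (\<delta> *\<^sub>R h) \<le> \<delta>" by simp
  then have "C * norm (\<delta> *\<^sub>R h) \<le> C * \<delta>" using C by simp
  then have "N (x + \<delta> *\<^sub>R h) \<le> N x + C * \<delta>"
    using triangle[of x "\<delta> *\<^sub>R h"] upper[of "\<delta> *\<^sub>R h"] by linarith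
  moreover have "val (x + \<delta> *\<^sub>R h) q = const_from F s (b + \<delta>) q" if "q \<le> t" for q
  proof (cases "q < s")
    case True
    then have "\<not> s \<le> q" by (meson leD)
    then show ?thesis using x that True by (simp add: exts_def h const_from_def)
  next
    case False
    then have "s \<le> q" using tree_comparable[OF that s(1)] by (auto simp: le_less)
    then show ?thesis using x that False by (simp add: exts_def h const_from_def)
  qed
  then have "x + \<delta> *\<^sub>R h \<in> exts (const_from F s (b + \<delta>)) t"
    using x by (auto simp: exts_def h)
  ultimately show thesis using that by blast
qed

text \<open>A raise is due after the tight node \<open>r\<close>, but the value stays. The first
  such \<open>s\<close> is where the greedy construction stops.\<close>

definition stagnates :: "('a \<Rightarrow> real) \<Rightarrow> 'a \<Rightarrow> bool" where
  "stagnates F s \<longleftrightarrow> (\<exists>r. succ_of r s \<and> tight F r \<and> F s = F r)"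

text \<open>The nodes at which a value is chosen anew. Minimal nodes are among them, since the last
  two clauses are vacuous there.\<close>

definition jump :: "('a \<Rightarrow> real) \<Rightarrow> 'a \<Rightarrow> bool" where
  "jump F s \<longleftrightarrow> \<not> is_lim s \<and> (\<forall>q<s. \<not> stagnates F q) \<and> (\<forall>r. succ_of r s \<longrightarrow> tight F r)"

text \<open>
  The values chosen at jumps depend on \<open>t\<close>: they may only decrease when \<open>t\<close> grows, which makes the
  sequences of values increase in \<open>Z\<close>.
\<close>

definition prof :: "'a \<Rightarrow> 'a \<Rightarrow> real" where
  "prof t = (SOME F. \<forall>s. F s =
     (if jump F s then Sup {b. admissible (const_from F s b) t} else Sup (F ` {..<s})))"

lemma stagnates_cong:
  assumes "\<And>q. q \<le> s \<Longrightarrow> F q = G q"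
  shows "stagnates F s = stagnates G s"
proof -
  have "(succ_of r s \<and> tight F r \<and> F s = F r) = (succ_of r s \<and> tight G r \<and> G s = G r)" for r
    using tight_cong[of r F G] assms by (auto simp: succ_of_def dest: order_trans less_imp_le)
  then show ?thesis unfolding stagnates_def by simp
qed

lemma jump_cong:
  assumes "\<And>q. q < s \<Longrightarrow> F q = G q"
  shows "jump F s = jump G s"
proof -
  have "stagnates F q = stagnates G q" if "q < s" for q
    using assms that by (intro stagnates_cong) (auto dest: le_less_trans)
  moreover have "tight F r = tight G r" if "succ_of r s" for r
    using assms that by (intro tight_cong) (auto simp: succ_of_def dest: le_less_trans)
  ultimately show ?thesis unfolding jump_def by auto
qed

section \<open>Admissibility and tightness of the profile\<close>

lemma prof_rec:
  "prof t s = (if jump (prof t) s then Sup {b. admissible (const_from (prof t) s b) t}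
     else Sup (prof t ` {..<s}))"
proof -
  let ?G = "\<lambda>F s. if jump F s then Sup {b. admissible (const_from F s b) t} else Sup (F ` {..<s})"
  have "\<exists>F. \<forall>s. F s = ?G F s"
  proof (rule ex_recursive_solution[OF wf_less_tree])
    fix F G :: "'a \<Rightarrow> real" and s assume eq: "\<And>z. z < s \<Longrightarrow> F z = G z"
    have "const_from F s = const_from G s" using eq by (auto simp: const_from_def fun_eq_iff)
    moreover have "F ` {..<s} = G ` {..<s}" using eq by auto
    ultimately show "?G F s = ?G G s" using jump_cong[of s F G, OF eq] by simp
  qed
  then have "\<forall>s. prof t s = ?G (prof t) s" unfolding prof_def by (rule someI_ex)
  then show ?thesis by blast
qed

lemma prof_jump: "jump (prof t) s \<Longrightarrow> prof t s = Sup {b. admissible (const_from (prof t) s b) t}"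
  using prof_rec[of t s] by simp

lemma prof_no_jump: "\<not> jump (prof t) s \<Longrightarrow> prof t s = Sup (prof t ` {..<s})"
  using prof_rec[of t s] by simp

lemma minimal_jump: "(\<And>q. \<not> q < s) \<Longrightarrow> jump F s"
  unfolding jump_def is_lim_def succ_of_def by blast

lemma prof_no_jump_succ:
  assumes "\<not> jump (prof t) s" "succ_of r s" "level_fun (prof t) r"
  shows "prof t s = prof t r"
  unfolding prof_no_jump[OF assms(1)]
proof (rule cSup_eq_maximum)
  show "prof t r \<in> prof t ` {..<s}" using assms(2) by (auto simp: succ_of_def)
  show "x \<le> prof t r" if "x \<in> prof t ` {..<s}" for x
    using that level_fun_mono[OF assms(3)] by (auto simp: succ_of_less_iff[OF assms(2)])
qed

lemma admissible_values:
  assumes "s \<le> t"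
  shows "bdd_above {b. admissible (const_from F s b) t}"
  using admissible_bound const_from_top[OF assms] by (intro bdd_aboveI[of _ "2 / c"]) fastforce

text \<open>An extension for some \<open>b\<close> close to the supremum is raised by the remaining
  distance; a distance below \<open>e / (2 * C)\<close> makes this cost less than
  \<open>e / 2\<close>.\<close>

lemma admissible_Sup:
  assumes s: "s \<le> t" "\<not> is_lim s" and ne: "{b. admissible (const_from F s b) t} \<noteq> {}"
  shows "admissible (const_from F s (Sup {b. admissible (const_from F s b) t})) t"
proof (rule admissibleI)
  let ?B = "{b. admissible (const_from F s b) t}"
  fix e :: real assume e: "0 < e"
  have "Sup ?B - e / (2 * C) < Sup ?B" using e C by simp
  then obtain b where b: "b \<in> ?B" "Sup ?B - e / (2 * C) < b" using less_cSupD[OF ne] by blast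
  have bS: "b \<le> Sup ?B" using b(1) by (rule cSup_upper[OF _ admissible_values[OF s(1)]])
  have "0 < e / 2" using e by simp
  moreover have "admissible (const_from F s b) t" using b(1) by simp
  ultimately obtain x where x: "x \<in> exts (const_from F s b) t" "N x < 1 + c / 2 * b + e / 2"
    unfolding admissible_def const_from_top[OF s(1)] by blast
  obtain y where y: "y \<in> exts (const_from F s (b + (Sup ?B - b))) t" "N y \<le> N x + C * (Sup ?B - b)"
    using exts_raise[OF x(1) s, of "Sup ?B - b"] bS by auto
  have "Sup ?B - b < e / (2 * C)" using b(2) by simp
  then have "C * (Sup ?B - b) < e / 2" using C by (simp add: field_simps)
  moreover have "c / 2 * b \<le> c / 2 * Sup ?B" using bS c by simp
  ultimately have "N y < 1 + c / 2 * Sup ?B + e" using x(2) y(2) by linarith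
  then show "\<exists>x\<in>exts (const_from F s (Sup ?B)) t. N x < 1 + c / 2 * const_from F s (Sup ?B) t + e"
    using y(1) unfolding const_from_top[OF s(1)] by auto
qed

text \<open>The claims are proved by one induction because they depend on each other. Admissibility
  is stated over \<open>t\<close> for the function frozen from \<open>s\<close> on, so that it says
  something about \<open>s\<close> before the later values are known.\<close>

lemma prof_props:
  assumes "s \<le> t"
  shows "0 \<le> prof t s \<and> level_fun (prof t) s \<and> prof t s \<le> 2 / c \<and>
    admissible (const_from (prof t) s (prof t s)) t"
  using assms
proof (induction s rule: wf_induct_rule[OF wf_less_tree])
  case (1 s)
  let ?F = "prof t"
  have IH: "0 \<le> ?F q" "level_fun ?F q" "?F q \<le> 2 / c" "admissible (const_from ?F q (?F q)) t"
    if "q < s" for q using 1 that by (auto dest: order_trans[OF less_imp_le])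
  show ?case
  proof (cases "jump ?F s")
    case True
    let ?B = "{b. admissible (const_from ?F s b) t}"
    have nl: "\<not> is_lim s" using True by (simp add: jump_def)
    \<comment> \<open>A candidate that is not below the earlier values: at a minimal node it is
      \<open>0\<close>, with the zero function as extension; after \<open>r\<close> it is the old
      value, since freezing at \<open>r\<close> and at \<open>s\<close> then gives the same
      function.\<close>
    have "\<exists>b\<in>?B. 0 \<le> b \<and> (\<forall>q<s. ?F q \<le> b)"
    proof (cases s rule: tree_cases)
      case minimal
      have "admissible (const_from ?F s 0) t"
        unfolding admissible_def const_from_top[OF 1(2)]
        using minimal by (intro allI impI bexI[of _ 0]) (auto simp: N_zero exts_def const_from_def)
      then show ?thesis using minimal by (intro bexI[of _ 0]) auto
    next
      case (succ r)
      then have "r < s" by (simp add: succ_of_def)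
      note r = IH[OF this]
      show ?thesis
        using r const_from_succ[OF succ, of ?F] level_fun_mono[OF r(2)] succ_of_less_iff[OF succ]
        by (intro bexI[of _ "?F r"]) auto
    next
      case lim
      then show ?thesis using nl by simp
    qed
    then obtain b where b: "b \<in> ?B" "0 \<le> b" "\<And>q. q < s \<Longrightarrow> ?F q \<le> b" by blast
    have adm: "admissible (const_from ?F s (?F s)) t"
      unfolding prof_jump[OF True] using b(1) by (intro admissible_Sup 1(2) nl) blast
    have "b \<le> ?F s"
      unfolding prof_jump[OF True] using b(1) by (rule cSup_upper[OF _ admissible_values[OF 1(2)]])
    then have up: "?F q \<le> ?F s" if "q < s" for q using b(3)[OF that] by simp
    have "level_fun ?F s" by (rule level_fun_step) (use IH(2) nl up in auto)
    then show ?thesis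
      using adm \<open>b \<le> ?F s\<close> b(2) admissible_bound[OF adm] const_from_top[OF 1(2), of ?F] by simp
  next
    case False
    show ?thesis
    proof (cases s rule: tree_cases)
      case minimal
      then show ?thesis using False minimal_jump by blast
    next
      case (succ r)
      then have rs: "r < s" by (simp add: succ_of_def)
      note r = IH[OF this]
      have eq: "?F s = ?F r" using prof_no_jump_succ[OF False succ r(2)] .
      have up: "?F q \<le> ?F s" if "q < s" for q
        using level_fun_mono[OF r(2)] that unfolding eq succ_of_less_iff[OF succ] by simp
      have "level_fun ?F s" by (rule level_fun_step) (use IH(2) succ_of_not_lim[OF succ] up in auto)
      then show ?thesis using r const_from_succ[OF succ, of ?F] eq by simp
    next
      case lim
      have Fs: "?F s = Sup (?F ` {..<s})" by (rule prof_no_jump[OF False])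
      have ne: "?F ` {..<s} \<noteq> {}" using lim unfolding is_lim_def by blast
      have bdd: "bdd_above (?F ` {..<s})" using IH(3) by (intro bdd_aboveI[of _ "2 / c"]) auto
      have up: "?F q \<le> ?F s" if "q < s" for q
        unfolding Fs using that by (intro cSup_upper bdd) auto
      have app: "\<exists>q<s. ?F s - e < ?F q" if "0 < e" for e
      proof -
        have "?F s - e < Sup (?F ` {..<s})" using Fs that by simp
        from less_cSupD[OF ne this] show ?thesis by auto
      qed
      have lev: "level_fun ?F s" by (rule level_fun_step) (use IH(2) up app in auto)
      have "?F s \<le> 2 / c" unfolding Fs using IH(3) by (intro cSup_least[OF ne]) auto
      moreover have "0 \<le> ?F s"
        using lim IH(1) up unfolding is_lim_def by (meson order_trans)
      moreover have "admissible (const_from ?F s (?F s)) t"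
        unfolding admissible_def const_from_top[OF 1(2)]
      proof (intro allI impI)
        fix e :: real assume e: "0 < e"
        \<comment> \<open>The functions frozen at \<open>q\<close> and at \<open>s\<close> differ by
          at most \<open>?F s - ?F q\<close>, so an almost optimal extension of the former is
          shifted to one of the latter.\<close>
        have "0 < e / (2 * C)" using e C by simp
        from app[OF this] obtain q where q: "q < s" "?F s - e / (2 * C) < ?F q" by blast
        have qt: "q \<le> t" using q(1) 1(2) by simp
        have "0 < e / 2" using e by simp
        then obtain x where x: "x \<in> exts (const_from ?F q (?F q)) t" "N x < 1 + c / 2 * ?F q + e / 2"
          using IH(4)[OF q(1)] unfolding admissible_def const_from_top[OF qt] by blast
        have "\<bar>const_from ?F s (?F s) p - const_from ?F q (?F q) p\<bar> \<le> ?F s - ?F q" if "p \<le> t" for p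
        proof -
          have "p < q \<or> q \<le> p" using tree_comparable[OF that qt] by (auto simp: le_less)
          then consider "p < q" | "\<not> p < q" "q \<le> p" "p < s" | "\<not> p < q" "\<not> p < s"
            by (auto dest: leD)
          then show ?thesis
          proof cases
            case 1
            then have "p < s" using q(1) by simp
            then show ?thesis using 1 up[OF q(1)] by (simp add: const_from_def)
          next
            case 2
            then show ?thesis
              using level_fun_mono[OF lev, of q p] level_fun_mono[OF lev, of p s]
              by (simp add: const_from_def)
          next
            case 3
            then show ?thesis using up[OF q(1)] by (simp add: const_from_def)
          qed
        qed
        then obtain y where y: "y \<in> exts (const_from ?F s (?F s)) t" "N y \<le> N x + C * (?F s - ?F q)"
          using exts_shift[OF x(1) level_fun_const_from[OF lev 1(2)]
              level_fun_const_from[OF IH(2)[OF q(1)] qt], of "?F s - ?F q"] up[OF q(1)] by auto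
        have "?F s - ?F q < e / (2 * C)" using q(2) by simp
        then have "C * (?F s - ?F q) < e / 2" using C by (simp add: field_simps)
        moreover have "c / 2 * ?F q \<le> c / 2 * ?F s" using up[OF q(1)] c by simp
        ultimately have "N y < 1 + c / 2 * ?F s + e" using x(2) y(2) by linarith
        then show "\<exists>x\<in>exts (const_from ?F s (?F s)) t. N x < 1 + c / 2 * ?F s + e" using y(1) by blast
      qed
      ultimately show ?thesis using lev by blast
    qed
  qed
qed

lemma prof_level: "level_fun (prof t) t"
  using prof_props[of t t] by simp

lemma prof_mono: "q \<le> s \<Longrightarrow> s \<le> t \<Longrightarrow> prof t q \<le> prof t s"
  using level_fun_mono[OF prof_level] .

lemma prof_admissible: "s \<le> t \<Longrightarrow> admissible (const_from (prof t) s (prof t s)) t"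
  using prof_props by blast

text \<open>At a jump, an extension of smaller norm would leave room for a value beyond the supremum
  of the admissible ones. At other nodes the bound is inherited from below, at limits by
  approximation.\<close>

lemma prof_tight:
  assumes "s \<le> t" "x \<in> exts (const_from (prof t) s (prof t s)) t"
  shows "1 + c / 2 * prof t s \<le> N x"
  using assms
proof (induction s arbitrary: x rule: wf_induct_rule[OF wf_less_tree])
  case (1 s)
  let ?F = "prof t"
  have IH: "1 + c / 2 * ?F q \<le> N x" if "q < s" "x \<in> exts (const_from ?F q (?F q)) t" for q x
    using 1 that by (auto dest: order_trans[OF less_imp_le])
  show ?case
  proof (cases "jump ?F s")
    case True
    show ?thesis
    proof (rule ccontr)
      assume n: "\<not> 1 + c / 2 * ?F s \<le> N x"
      \<comment> \<open>The whole slack of \<open>x\<close> is spent on raising the value.\<close>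
      define \<delta> where "\<delta> = (1 + c / 2 * ?F s - N x) / C"
      have d: "0 < \<delta>" using n C by (simp add: \<delta>_def)
      have "\<not> is_lim s" using True by (simp add: jump_def)
      then obtain y where y: "y \<in> exts (const_from ?F s (?F s + \<delta>)) t" "N y \<le> N x + C * \<delta>"
        using exts_raise[OF 1(3,2)] d by (metis less_imp_le)
      have "C * \<delta> = 1 + c / 2 * ?F s - N x" using C by (simp add: \<delta>_def)
      then have "N y \<le> 1 + c / 2 * ?F s" using y(2) by simp
      also have "\<dots> \<le> 1 + c / 2 * (?F s + \<delta>)" using d c by simp
      finally have "N y \<le> 1 + c / 2 * (?F s + \<delta>)" .
      then have "admissible (const_from ?F s (?F s + \<delta>)) t"
        unfolding admissible_def const_from_top[OF 1(2)]
        using y(1) by (intro allI impI bexI[of _ y]) auto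
      then have "?F s + \<delta> \<le> ?F s"
        by (subst (2) prof_jump[OF True]) (intro cSup_upper admissible_values[OF 1(2)], simp)
      then show False using d by simp
    qed
  next
    case False
    show ?thesis
    proof (cases s rule: tree_cases)
      case minimal
      then show ?thesis using False minimal_jump by blast
    next
      case (succ r)
      then have rs: "r < s" by (simp add: succ_of_def)
      have "level_fun ?F r" using prof_props[of r t] rs 1(2) by simp
      from prof_no_jump_succ[OF False succ this] show ?thesis
        using IH[OF rs, of x] 1(3) const_from_succ[OF succ, of ?F] by simp
    next
      case lim
      have lev: "level_fun ?F s" using prof_props[OF 1(2)] by simp
      show ?thesis
      proof (rule field_le_epsilon)
        fix e :: real assume e: "0 < e"
        \<comment> \<open>\<open>C\<close> pays for the shift, and \<open>c\<close> for the change
          of the lower bound, whose slope is only \<open>c / 2\<close>.\<close>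
        have "0 < e / (C + c)" using e C c by simp
        then obtain q where q: "q < s" "?F s - e / (C + c) < ?F q"
          using lev lim unfolding level_fun_def by blast
        have qt: "q \<le> t" using q(1) 1(2) by simp
        have qs: "?F q \<le> ?F s" using level_fun_mono[OF lev] q(1) by simp
        have lq: "level_fun ?F q" using level_fun_subset[OF lev less_imp_le[OF q(1)]] .
        have "\<bar>const_from ?F q (?F q) p - const_from ?F s (?F s) p\<bar> \<le> ?F s - ?F q" if "p \<le> t" for p
        proof -
          have "p < q \<or> q \<le> p" using tree_comparable[OF that qt] by (auto simp: le_less)
          then consider "p < q" | "\<not> p < q" "q \<le> p" "p < s" | "\<not> p < q" "\<not> p < s"
            by (auto dest: leD)
          then show ?thesis
          proof cases
            case 1
            then have "p < s" using q(1) by simp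
            then show ?thesis using 1 qs by (simp add: const_from_def)
          next
            case 2
            then show ?thesis
              using level_fun_mono[OF lev, of q p] level_fun_mono[OF lev, of p s]
              by (simp add: const_from_def)
          next
            case 3
            then show ?thesis using qs by (simp add: const_from_def)
          qed
        qed
        then obtain y where y: "y \<in> exts (const_from ?F q (?F q)) t" "N y \<le> N x + C * (?F s - ?F q)"
          using exts_shift[OF 1(3) level_fun_const_from[OF lq qt]
              level_fun_const_from[OF lev 1(2)], of "?F s - ?F q"] qs by auto
        have "?F s - ?F q < e / (C + c)" using q(2) by simp
        then have "(C + c) * (?F s - ?F q) < e" using C c by (simp add: field_simps)
        moreover have "c / 2 * (?F s - ?F q) \<le> c * (?F s - ?F q)"
          using c qs by (intro mult_right_mono) auto
        ultimately have "C * (?F s - ?F q) + c / 2 * (?F s - ?F q) < e" by (simp add: distrib_right)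
        moreover have "1 + c / 2 * ?F q \<le> N y" using IH[OF q(1) y(1)] .
        ultimately show "1 + c / 2 * ?F s \<le> N x + e" using y(2) by (simp add: right_diff_distrib)
      qed
    qed
  qed
qed

lemma prof_exts_self: "exts (const_from (prof t) t (prof t t)) t = exts (prof t) t"
  by (intro exts_cong const_from_self)

lemma prof_admissible_top: "admissible (prof t) t"
proof -
  have "admissible (const_from (prof t) t (prof t t)) t \<longleftrightarrow> admissible (prof t) t"
    by (intro admissible_cong const_from_self)
  then show ?thesis using prof_admissible[of t t] by simp
qed

lemma prof_tight_top: "tight (prof t) t"
  unfolding tight_def using prof_tight[of t t] prof_exts_self by simp

end

section \<open>From profiles to \<open>Z\<close>\<close>

context equiv_norm begin

definition levels :: "'a \<Rightarrow> real set" where "levels t = prof t ` {..t}"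

definition stuck :: "'a \<Rightarrow> bool" where "stuck t \<longleftrightarrow> (\<exists>q\<le>t. stagnates (prof t) q)"

definition rho_seq :: "'a \<Rightarrow> rseq" where "rho_seq t = enumZ (levels t) (stuck t)"

definition rho :: "'a \<Rightarrow> Z" where "rho t = Abs_Z (rho_seq t)"

lemma Sup_levels: "Sup (levels t) = prof t t"
  unfolding levels_def by (rule cSup_eq_maximum) (auto intro: prof_mono)

lemma prof_in_levels: "s \<le> t \<Longrightarrow> prof t s \<in> levels t"
  by (simp add: levels_def)

lemma levels_le: "b \<in> levels t \<Longrightarrow> b \<le> prof t t"
  by (auto simp: levels_def intro: prof_mono)

lemma prof_bound: "prof t t \<le> 2 / c"
  using prof_props[of t t] by simp

text \<open>Well-ordering is inherited from \<open>{..t}\<close> through first nodes. If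
  \<open>Sup B\<close> is not in \<open>B\<close>, the first node at which the profile reaches
  \<open>Sup B\<close> is a limit, and left continuity gives equality there.\<close>

lemma compact_wo_levels: "compact_wo (levels t)"
  unfolding compact_wo_def well_ordered_iff_least
proof (intro conjI allI impI)
  let ?F = "prof t"
  show "levels t \<noteq> {}" by (auto simp: levels_def)
  show bdd: "bdd_above (levels t)" using levels_le by (rule bdd_aboveI)
  fix B assume B: "B \<subseteq> levels t" "B \<noteq> {}"
  show "\<exists>b\<in>B. \<forall>d\<in>B. b \<le> d"
  proof -
    have "{s \<in> {..t}. ?F s \<in> B} \<noteq> {}" "{s \<in> {..t}. ?F s \<in> B} \<subseteq> {..t}"
      using B by (auto simp: levels_def)
    then obtain m where m: "m \<in> {s \<in> {..t}. ?F s \<in> B}"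
      "\<And>p. p \<in> {s \<in> {..t}. ?F s \<in> B} \<Longrightarrow> m \<le> p" by (rule tree_least) blast
    have "?F m \<le> b" if "b \<in> B" for b
    proof -
      from that B(1) obtain p where p: "p \<le> t" "b = ?F p" by (auto simp: levels_def)
      then have "m \<le> p" using m(2)[of p] that by simp
      then show ?thesis using prof_mono p by simp
    qed
    then show ?thesis using m(1) by blast
  qed
  show "Sup B \<in> levels t"
  proof (cases "Sup B \<in> B")
    case False
    have bB: "bdd_above B" using bdd B(1) by (rule bdd_above_mono)
    have lt: "b < Sup B" if "b \<in> B" for b
      using cSup_upper[OF that bB] that False by (cases "b = Sup B") auto
    have "Sup B \<le> ?F t" using B levels_le by (intro cSup_least) auto
    then have "{s \<in> {..t}. Sup B \<le> ?F s} \<noteq> {}" "{s \<in> {..t}. Sup B \<le> ?F s} \<subseteq> {..t}" by auto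
    then obtain s where s: "s \<in> {s \<in> {..t}. Sup B \<le> ?F s}"
      "\<And>p. p \<in> {s \<in> {..t}. Sup B \<le> ?F s} \<Longrightarrow> s \<le> p" by (rule tree_least) blast
    have st: "s \<le> t" using s(1) by simp
    have below: "?F p < Sup B" if "p < s" for p
    proof (rule ccontr)
      assume "\<not> ?F p < Sup B"
      moreover have "p \<le> t" using that st by simp
      ultimately have "s \<le> p" using s(2)[of p] by simp
      then show False using that by (meson leD)
    qed
    have idx: "\<exists>p<s. b = ?F p" if b: "b \<in> B" for b
    proof -
      obtain p where p: "p \<le> t" "b = ?F p" using b B(1) by (auto simp: levels_def)
      have "\<not> s \<le> p"
      proof
        assume "s \<le> p"
        then have "?F s \<le> ?F p" using p(1) by (rule prof_mono)
        then show False using s(1) lt[OF b] p(2) by simp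
      qed
      then show ?thesis using tree_comparable[OF p(1) st] p(2) by (auto simp: le_less)
    qed
    have "is_lim s"
    proof (cases s rule: tree_cases)
      case minimal
      then show ?thesis using idx B(2) by blast
    next
      case (succ r)
      then have "r < s" by (simp add: succ_of_def)
      have "Sup B \<le> ?F r"
      proof (rule cSup_least[OF B(2)])
        fix b assume "b \<in> B"
        then obtain p where p: "p < s" "b = ?F p" using idx by blast
        have "p \<le> r" using p(1) unfolding succ_of_less_iff[OF succ] .
        moreover have "r \<le> t" using \<open>r < s\<close> st by simp
        ultimately show "b \<le> ?F r" unfolding p(2) by (rule prof_mono)
      qed
      then show ?thesis using below[OF \<open>r < s\<close>] by simp
    qed
    then have app: "\<exists>q<s. ?F s - e < ?F q" if "0 < e" for e
      using prof_level[of t] st that unfolding level_fun_def by blast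
    have "?F s \<le> Sup B"
    proof (rule field_le_epsilon)
      fix e :: real assume "0 < e"
      from app[OF this] obtain q where "q < s" "?F s - e < ?F q" by blast
      then show "?F s \<le> Sup B + e" using below[of q] by linarith
    qed
    then have "?F s = Sup B" using s(1) by simp
    then show ?thesis using prof_in_levels[OF st] by simp
  qed (use B in blast)
qed

section \<open>Monotonicity of \<open>rho\<close>\<close>

lemma Rep_rho: "Rep_Z (rho t) = rho_seq t"
proof -
  obtain \<beta> where "isZ (rho_seq t) \<beta>"
    unfolding rho_seq_def by (rule isZ_enumZ[OF compact_wo_levels])
  then show ?thesis unfolding rho_def by (rule Rep_Abs_Z)
qed

text \<open>After a stagnation there are no jumps, so each later value is a supremum of values that
  do not exceed the stagnant one.\<close>

lemma stagnates_const:
  assumes q: "stagnates (prof t) q" "q \<le> s" "s \<le> t"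
  shows "prof t s = prof t q"
  using q(2,3)
proof (induction s rule: wf_induct_rule[OF wf_less_tree])
  case (1 s)
  show ?case
  proof (cases "s = q")
    case False
    then have qs: "q < s" using 1(2) by simp
    then have "\<not> jump (prof t) s" using q(1) unfolding jump_def by blast
    then have "prof t s = Sup (prof t ` {..<s})" by (rule prof_no_jump)
    also have "\<dots> = prof t q"
    proof (rule cSup_eq_maximum)
      show "prof t q \<in> prof t ` {..<s}" using qs by blast
      fix x assume "x \<in> prof t ` {..<s}"
      then obtain p where p: "p < s" "x = prof t p" by blast
      have "p \<le> t" "q \<le> t" using p(1) qs 1(3) by auto
      then have "p \<le> q \<or> q \<le> p" by (rule tree_comparable)
      then show "x \<le> prof t q"
        using 1(1)[of p] p \<open>p \<le> t\<close> \<open>q \<le> t\<close> prof_mono[of p q t] by auto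
    qed
    finally show ?thesis .
  qed simp
qed

text \<open>Values at nodes without a jump depend on earlier values only, so the first difference
  occurs at a jump. There \<open>t'\<close> has the smaller supremum, because what is admissible
  over \<open>t'\<close> is admissible over \<open>t\<close>.\<close>

lemma first_difference:
  assumes tt': "t \<le> t'" and ne: "\<exists>s\<le>t. prof t s \<noteq> prof t' s"
  obtains s where "s \<le> t" "\<And>q. q < s \<Longrightarrow> prof t q = prof t' q" "prof t' s < prof t s"
    "jump (prof t) s" "jump (prof t') s"
proof -
  let ?Q = "{s \<in> {..t}. prof t s \<noteq> prof t' s}"
  have "?Q \<noteq> {}" "?Q \<subseteq> {..t}" using ne by auto
  then obtain s where s: "s \<in> ?Q" "\<And>p. p \<in> ?Q \<Longrightarrow> s \<le> p" by (rule tree_least) blast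
  have st: "s \<le> t" and st': "s \<le> t'" using s(1) tt' by auto
  have eq: "prof t q = prof t' q" if "q < s" for q
  proof (rule ccontr)
    assume "prof t q \<noteq> prof t' q"
    then have "s \<le> q" using s(2)[of q] that st by simp
    then show False using that by (meson leD)
  qed
  have j: "jump (prof t) s = jump (prof t') s" using eq by (rule jump_cong)
  have J: "jump (prof t) s"
  proof (rule ccontr)
    assume n: "\<not> jump (prof t) s"
    have "prof t ` {..<s} = prof t' ` {..<s}" using eq by auto
    then have "prof t s = prof t' s" using prof_no_jump[of t s] prof_no_jump[of t' s] n j by simp
    then show False using s(1) by simp
  qed
  have cf: "const_from (prof t') s = const_from (prof t) s"
    using eq by (auto simp: const_from_def fun_eq_iff)
  have "prof t' s \<le> prof t s"
    unfolding prof_jump[OF J] prof_jump[OF J[unfolded j]] cf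
  proof (rule cSup_subset_mono)
    show "{b. admissible (const_from (prof t) s b) t'} \<noteq> {}"
      using prof_admissible[OF st'] unfolding cf by blast
    show "bdd_above {b. admissible (const_from (prof t) s b) t}" by (rule admissible_values[OF st])
    show "{b. admissible (const_from (prof t) s b) t'} \<subseteq> {b. admissible (const_from (prof t) s b) t}"
      using admissible_antimono[OF _ tt'] const_from_top[OF st] const_from_top[OF st'] by auto
  qed
  then show thesis using that[of s] st eq J j s(1) by auto
qed

text \<open>The value of the later profile at the first difference either is a level that
  \<open>t\<close> lacks, or repeats the preceding level. In the second case \<open>t'\<close>
  stagnates at \<open>s\<close>, its levels are an initial part of those of \<open>t\<close>, and
  its last value is doubled.\<close>

lemma first_diff_rho_seq:
  assumes tt': "t \<le> t'" and s: "s \<le> t" "\<And>q. q < s \<Longrightarrow> prof t q = prof t' q" "prof t' s < prof t s"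
    and J: "jump (prof t') s"
  shows "first_diff (rho_seq t) (rho_seq t') (prof t' s)"
proof -
  let ?F = "prof t" and ?G = "prof t'" and ?d = "prof t' s"
  have st': "s \<le> t'" using s(1) tt' by simp
  have split: "q < s \<or> s \<le> q" if "q \<le> t'" for q
    using tree_comparable[OF that st'] by (auto simp: le_less)
  have above: "?F s \<le> ?F q" "?d < ?F q" if "q \<le> t" "s \<le> q" for q
    using prof_mono[OF that(2,1)] s(3) by auto
  have above': "?d \<le> ?G q" if "q \<le> t'" "s \<le> q" for q
    using prof_mono[OF that(2,1)] .
  have dG: "?d \<in> levels t'" using prof_in_levels[OF st'] .
  show ?thesis
  proof (cases "\<exists>p<s. ?G p = ?d")
    case False
    have dF: "?d \<notin> levels t"
    proof
      assume "?d \<in> levels t"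
      then obtain q where q: "q \<le> t" "?d = ?F q" by (auto simp: levels_def)
      have "q < s \<or> s \<le> q" using split[of q] q(1) tt' by simp
      then show False using False above(2)[OF q(1)] q(2) s(2)[of q] by auto
    qed
    have agree: "r \<in> levels t \<longleftrightarrow> r \<in> levels t'" if r: "r < ?d" for r
    proof
      assume "r \<in> levels t"
      then obtain q where q: "q \<le> t" "r = ?F q" by (auto simp: levels_def)
      have "q < s" using split[of q] q tt' above(2)[OF q(1)] r by force
      then show "r \<in> levels t'" using q s(2) tt' by (auto simp: levels_def)
    next
      assume "r \<in> levels t'"
      then obtain q where q: "q \<le> t'" "r = ?G q" by (auto simp: levels_def)
      have qs: "q < s" using split[OF q(1)] q above'[OF q(1)] r by force
      then have "q \<le> t" using s(1) by simp
      then show "r \<in> levels t" using prof_in_levels q(2) s(2)[OF qs] by metis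
    qed
    have "?d < Sup (levels t)" unfolding Sup_levels using above(2)[OF order_refl s(1)] .
    then show ?thesis
      unfolding rho_seq_def by (intro first_diff_enumZ_new compact_wo_levels dG dF agree)
  next
    case True
    then obtain p where p: "p < s" "?G p = ?d" by blast
    \<comment> \<open>\<open>p < s\<close> excludes a minimal node, and a jump excludes a
      limit.\<close>
    obtain r where succ: "succ_of r s"
    proof (cases s rule: tree_cases)
      case lim
      then show ?thesis using J by (simp add: jump_def)
    qed (use p that in blast)+
    have rs: "r < s" using succ by (simp add: succ_of_def)
    have "p \<le> r" using p(1) unfolding succ_of_less_iff[OF succ] .
    then have "?G p \<le> ?G r" using rs st' by (intro prof_mono) auto
    moreover have "?G r \<le> ?d" using rs st' by (intro prof_mono) auto
    ultimately have Gr: "?G r = ?d" using p(2) by simp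
    have stag: "stagnates ?G s" using J succ Gr unfolding stagnates_def jump_def by auto
    have cst: "?G q = ?d" if "q \<le> t'" "s \<le> q" for q using stagnates_const[OF stag that(2,1)] .
    have stuck: "stuck t'" unfolding stuck_def using stag st' by blast
    have Sup: "Sup (levels t') = ?d" unfolding Sup_levels using cst[OF order_refl st'] .
    have init: "levels t' = levels t \<inter> {..?d}"
    proof (intro equalityI subsetI)
      fix x assume "x \<in> levels t'"
      then obtain q where q: "q \<le> t'" "x = ?G q" by (auto simp: levels_def)
      have "\<exists>q<s. x = ?G q" using split[OF q(1)] q cst[OF q(1)] Gr rs by metis
      then obtain q where q: "q < s" "x = ?G q" by blast
      then have "q \<le> t" "x = ?F q" using s by auto
      moreover have "x \<le> ?d" unfolding q(2) using q(1) st' by (intro prof_mono) auto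
      ultimately show "x \<in> levels t \<inter> {..?d}" by (auto simp: levels_def)
    next
      fix x assume "x \<in> levels t \<inter> {..?d}"
      then obtain q where q: "q \<le> t" "x = ?F q" "x \<le> ?d" by (auto simp: levels_def)
      then have "q < s" using split[of q] above(2)[of q] tt' by force
      then show "x \<in> levels t'" using q s(2) tt' by (auto simp: levels_def)
    qed
    have "?F s \<in> levels t" using s(1) by (rule prof_in_levels)
    moreover have "?F s \<notin> levels t'" unfolding init using s(3) by simp
    ultimately have ne: "levels t \<noteq> levels t'" by blast
    have "levels t' = levels t \<inter> {..Sup (levels t')}" unfolding Sup by (rule init)
    then have "first_diff (enumZ (levels t) (stuck t)) (enumZ (levels t') True) (Sup (levels t'))"
      using ne by (intro first_diff_enumZ_doubled compact_wo_levels) blast+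
    then show ?thesis unfolding rho_seq_def Sup using stuck by simp
  qed
qed

lemma levels_subset:
  assumes "t \<le> t'" "\<And>s. s \<le> t \<Longrightarrow> prof t s = prof t' s"
  shows "levels t \<subseteq> levels t'"
proof
  fix x assume "x \<in> levels t"
  then obtain s where s: "s \<le> t" "x = prof t s" by (auto simp: levels_def)
  then have "s \<le> t'" using assms(1) by simp
  then show "x \<in> levels t'" using prof_in_levels s assms(2)[of s] by metis
qed

text \<open>The construction has already stopped below \<open>t\<close>, so the profile of
  \<open>t'\<close> is constant from \<open>t\<close> on and adds no level.\<close>

lemma rho_extend_stuck:
  assumes tt': "t \<le> t'" and eq: "\<And>s. s \<le> t \<Longrightarrow> prof t s = prof t' s" and st: "stuck t"
  shows "rho_seq t = rho_seq t'" and "prof t' t' = prof t t"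
proof -
  obtain q where q: "q \<le> t" "stagnates (prof t) q" using st unfolding stuck_def by blast
  have "stagnates (prof t) q = stagnates (prof t') q"
    using eq q(1) by (intro stagnates_cong) auto
  then have q': "stagnates (prof t') q" using q by simp
  have qt': "q \<le> t'" using q(1) tt' by simp
  have cst: "prof t' s = prof t t" if "s \<le> t'" "t \<le> s" for s
  proof -
    have "q \<le> s" using q(1) that by simp
    then have "prof t' s = prof t' q" using stagnates_const[OF q' _ that(1)] by simp
    also have "\<dots> = prof t q" using eq q(1) by simp
    also have "\<dots> = prof t t" using stagnates_const[OF q(2,1)] by simp
    finally show ?thesis .
  qed
  have "levels t' \<subseteq> levels t"
  proof
    fix x assume "x \<in> levels t'"
    then obtain s where s: "s \<le> t'" "x = prof t' s" by (auto simp: levels_def)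
    from tree_comparable[OF s(1) tt'] show "x \<in> levels t"
    proof
      assume "s \<le> t"
      then show ?thesis using eq prof_in_levels[of s t] s(2) by simp
    next
      assume "t \<le> s"
      then show ?thesis using cst[OF s(1)] prof_in_levels[of t t] s(2) by simp
    qed
  qed
  then have "levels t' = levels t" using levels_subset[OF tt' eq] by blast
  moreover have "stuck t'" unfolding stuck_def using q' qt' by blast
  ultimately show "rho_seq t = rho_seq t'" unfolding rho_seq_def using st by simp
  show "prof t' t' = prof t t" using cst tt' by simp
qed

text \<open>The least new level gives the first difference; if there is none, the doubling of the
  last level does, as soon as \<open>t'\<close> is stuck.\<close>

lemma rho_extend:
  assumes tt': "t \<le> t'" and eq: "\<And>s. s \<le> t \<Longrightarrow> prof t s = prof t' s" and st: "\<not> stuck t"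
  shows "levels t' = levels t \<and> \<not> stuck t' \<or> (\<exists>b\<in>levels t'. first_diff (rho_seq t) (rho_seq t') b)"
proof (cases "levels t' = levels t")
  case True
  have "first_diff (rho_seq t) (rho_seq t') (Sup (levels t'))" if "stuck t'"
  proof -
    have "levels t' = levels t \<inter> {..Sup (levels t')}"
      unfolding True Sup_levels using levels_le by blast
    then have "first_diff (enumZ (levels t) (stuck t)) (enumZ (levels t') True) (Sup (levels t'))"
      using st by (intro first_diff_enumZ_doubled compact_wo_levels) blast+
    then show ?thesis unfolding rho_seq_def using that by simp
  qed
  then show ?thesis using True compact_wo_Sup(1)[OF compact_wo_levels[of t']] by blast
next
  case False
  have sub: "levels t \<subseteq> levels t'" using tt' eq by (rule levels_subset)
  then have "levels t' - levels t \<noteq> {}" "levels t' - levels t \<subseteq> levels t'" using False by auto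
  then obtain d where d: "d \<in> levels t' - levels t" "\<And>b. b \<in> levels t' - levels t \<Longrightarrow> d \<le> b"
    using compact_wo_levels[of t'] unfolding compact_wo_def well_ordered_iff_least by meson
  have "first_diff (rho_seq t) (rho_seq t') d"
    unfolding rho_seq_def
  proof (intro first_diff_enumZ_new compact_wo_levels)
    show "r \<in> levels t \<longleftrightarrow> r \<in> levels t'" if "r < d" for r
      using sub d(2)[of r] that by auto
  qed (use d st in auto)
  then show ?thesis using d(1) by blast
qed

lemma rho_less_or_eq:
  assumes "t \<le> t'"
  shows "rho t = rho t' \<or> (\<exists>b\<in>levels t'. first_diff (rho_seq t) (rho_seq t') b)"
proof (cases "\<exists>s\<le>t. prof t s \<noteq> prof t' s")
  case True
  obtain s where s: "s \<le> t" "\<And>q. q < s \<Longrightarrow> prof t q = prof t' q" "prof t' s < prof t s"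
    "jump (prof t) s" "jump (prof t') s"
    using first_difference[OF assms True] by metis
  have "s \<le> t'" using s(1) assms by simp
  then show ?thesis using first_diff_rho_seq[OF assms s(1-3,5)] prof_in_levels by blast
next
  case False
  then have eq: "\<And>s. s \<le> t \<Longrightarrow> prof t s = prof t' s" by blast
  show ?thesis
  proof (cases "stuck t")
    case True
    then show ?thesis using rho_extend_stuck(1)[OF assms eq] by (simp add: rho_def)
  next
    case False
    from rho_extend[OF assms eq this] show ?thesis
      using False by (auto simp: rho_def rho_seq_def)
  qed
qed

lemma mono_rho: "mono rho"
proof (rule monoI)
  fix t t' :: 'a assume "t \<le> t'"
  from rho_less_or_eq[OF this] show "rho t \<le> rho t'"
  proof
    assume "\<exists>b\<in>levels t'. first_diff (rho_seq t) (rho_seq t') b"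
    then have "rho t < rho t'" unfolding less_Z_iff Rep_rho by blast
    then show ?thesis by simp
  qed simp
qed

text \<open>A profile is tight at its own top. So if the profile of \<open>u\<close> continues that
  of \<open>t\<close>, a raise is due at \<open>u\<close>: either it happens or \<open>u\<close> is
  stuck. The bound on \<open>b\<close> will exclude approximants with arbitrarily large cut values,
  so that Kurepa's node must be stuck.\<close>

lemma rho_succ_diff:
  assumes u: "succ_of t u" and st: "\<not> stuck t"
  obtains b where "b \<le> 2 / c" "first_diff (rho_seq t) (rho_seq u) b"
proof -
  have tu: "t \<le> u" using u by (simp add: succ_of_def less_imp_le)
  have "\<exists>b\<in>levels u. first_diff (rho_seq t) (rho_seq u) b"
  proof (cases "\<exists>s\<le>t. prof t s \<noteq> prof u s")
    case True
    obtain s where s: "s \<le> t" "\<And>q. q < s \<Longrightarrow> prof t q = prof u q" "prof u s < prof t s"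
      "jump (prof t) s" "jump (prof u) s"
      using first_difference[OF tu True] by metis
    have "s \<le> u" using s(1) tu by simp
    then show ?thesis using first_diff_rho_seq[OF tu s(1-3,5)] prof_in_levels by blast
  next
    case False
    then have eq: "\<And>s. s \<le> t \<Longrightarrow> prof t s = prof u s" by blast
    have tight: "tight (prof u) t" using prof_tight_top[of t] tight_cong[of t "prof t" "prof u"] eq by simp
    have "\<not> (levels u = levels t \<and> \<not> stuck u)"
    proof
      assume a: "levels u = levels t \<and> \<not> stuck u"
      then have "prof u u \<le> prof t t" using prof_in_levels[of u u] levels_le[of "prof u u" t] by simp
      moreover have "prof u t \<le> prof u u" using tu by (intro prof_mono) auto
      ultimately have "prof u u = prof u t" using eq[of t] by simp
      then have "stagnates (prof u) u" unfolding stagnates_def using u tight by blast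
      then show False using a unfolding stuck_def by blast
    qed
    then show ?thesis using rho_extend[OF tu eq st] by blast
  qed
  then obtain b where "b \<in> levels u" "first_diff (rho_seq t) (rho_seq u) b" by blast
  then show thesis using that[of b] levels_le[of b u] prof_bound[of u] by simp
qed

section \<open>Averages over immediate successors, and the contradiction with smoothness\<close>

text \<open>By \<open>nd\<close>, if the profile of \<open>u\<close> parts from that of
  \<open>t\<close> at all, it does so at a value not below \<open>k\<close>. Its almost optimal
  extensions can therefore be shifted by at most \<open>prof t t - k\<close> to extensions of
  \<open>prof t\<close>.\<close>

lemma near_extension:
  assumes st: "stuck t" and u: "succ_of t u" and k: "k \<le> prof t t"
    and nd: "\<And>b. b < k \<Longrightarrow> \<not> first_diff (rho_seq t) (rho_seq u) b" and e: "0 < e"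
  obtains x where "\<And>s. s \<le> t \<Longrightarrow> val x s = prof t s" "\<And>s. \<not> s \<le> t \<Longrightarrow> \<not> u \<le> s \<Longrightarrow> val x s = 0"
    "N x < 1 + c / 2 * prof t t + C * (prof t t - k) + e"
proof -
  let ?F = "prof t" and ?G = "prof u" and ?a = "prof t t"
  have tu: "t \<le> u" using u by (simp add: succ_of_def less_imp_le)
  have off: "val x s = 0" if "x \<in> exts H u" "\<not> s \<le> t" "\<not> u \<le> s" for x s H
    using that succ_of_le[OF u, of s] by (auto simp: exts_def)
  have Ck: "0 \<le> C * (?a - k)" using C k by simp
  show thesis
  proof (cases "\<exists>s\<le>t. ?F s \<noteq> ?G s")
    case True
    obtain s where s: "s \<le> t" "\<And>q. q < s \<Longrightarrow> ?F q = ?G q" "?G s < ?F s" "jump ?F s" "jump ?G s"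
      using first_difference[OF tu True] by metis
    have su: "s \<le> u" using s(1) tu by simp
    have kb: "k \<le> ?G s" using nd first_diff_rho_seq[OF tu s(1-3,5)] by (meson not_le)
    have ba: "?G s \<le> ?a" using s(3) prof_mono[OF s(1) order_refl] by simp
    obtain x where x: "x \<in> exts (const_from ?G s (?G s)) u" "N x < 1 + c / 2 * ?G s + e"
      using prof_admissible[OF su] e unfolding admissible_def const_from_top[OF su] by blast
    have "\<bar>const_from ?F t ?a q - const_from ?G s (?G s) q\<bar> \<le> ?a - k" if "q \<le> u" for q
    proof (cases "q < s")
      case True
      then have "q < t" using s(1) by simp
      then show ?thesis using True s(2) k by (simp add: const_from_def)
    next
      case False
      then have "s \<le> q" using tree_comparable[OF that su] by (auto simp: le_less)
      \<comment> \<open>From \<open>s\<close> on both functions take values between \<open>k\<close>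
        and \<open>?a\<close>.\<close>
      have "?F s \<le> const_from ?F t ?a q" "const_from ?F t ?a q \<le> ?a"
        using \<open>s \<le> q\<close> prof_mono[of s q t] prof_mono[of q t t] prof_mono[OF s(1) order_refl]
        by (auto simp: const_from_def)
      then show ?thesis using False s(3) kb by (simp add: const_from_def)
    qed
    moreover have "level_fun (const_from ?G s (?G s)) u"
      using prof_props[OF su] by (intro level_fun_const_from su) simp
    ultimately obtain y where y: "y \<in> exts (const_from ?F t ?a) u" "N y \<le> N x + C * (?a - k)"
      using exts_shift[OF x(1) level_fun_const_from[OF prof_level tu], of "?a - k"] k by auto
    show thesis
    proof (rule that[of y])
      show "val y q = ?F q" if "q \<le> t" for q
        using y(1) that tu const_from_self[OF that, of ?F] by (auto simp: exts_def dest: order_trans)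
      show "val y q = 0" if "\<not> q \<le> t" "\<not> u \<le> q" for q using off[OF y(1) that] .
      have "c / 2 * ?G s \<le> c / 2 * ?a" using ba c by simp
      then show "N y < 1 + c / 2 * ?a + C * (?a - k) + e" using x(2) y(2) by linarith
    qed
  next
    case False
    then have eq: "\<And>s. s \<le> t \<Longrightarrow> ?F s = ?G s" by blast
    have "?G u = ?a" using rho_extend_stuck(2)[OF tu eq st] .
    then obtain x where x: "x \<in> exts ?G u" "N x < 1 + c / 2 * ?a + e"
      using prof_admissible_top[of u] e unfolding admissible_def by fastforce
    show thesis
    proof (rule that[of x])
      show "val x q = ?F q" if "q \<le> t" for q
        using x(1) that tu eq[OF that] by (auto simp: exts_def dest: order_trans)
      show "val x q = 0" if "\<not> q \<le> t" "\<not> u \<le> q" for q using off[OF x(1) that] .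
      show "N x < 1 + c / 2 * ?a + C * (?a - k) + e" using x(2) Ck by linarith
    qed
  qed
qed

text \<open>Extensions over different successors agree with \<open>f\<close> on \<open>{..t}\<close>
  and have disjoint supports elsewhere. So the average of many of them is uniformly close to
  \<open>f\<close>, while its norm does not exceed their common bound.\<close>

lemma fan_average:
  assumes st: "stuck t" and u: "inj u" "\<And>n::nat. succ_of t (u n)"
    and k: "\<And>n. k n \<le> prof t t" "\<And>e. 0 < e \<Longrightarrow> \<forall>\<^sub>F n in sequentially. prof t t - e < k n"
    and nd: "\<And>n b. b < k n \<Longrightarrow> \<not> first_diff (rho_seq t) (rho_seq (u n)) b"
    and f: "\<And>s. val f s = (if s \<le> t then prof t s else 0)"
  shows "N f \<le> 1 + c / 2 * prof t t"
proof (rule field_le_epsilon)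
  let ?a = "prof t t"
  fix e :: real assume e: "0 < e"
  \<comment> \<open>One third of \<open>e\<close> is for the extensions not being optimal, one third
    for the shift to \<open>prof t\<close>, and the last third for averaging.\<close>
  define T where "T = 1 + c / 2 * ?a + 2 * e / 3"
  have "0 < e / (3 * C)" using e C by simp
  from k(2)[OF this] obtain n0 where n0: "\<And>n. n0 \<le> n \<Longrightarrow> ?a - e / (3 * C) < k n"
    unfolding eventually_sequentially by blast
  have "\<exists>x. (\<forall>s\<le>t. val x s = prof t s) \<and> (\<forall>s. \<not> s \<le> t \<longrightarrow> \<not> u (n0 + n) \<le> s \<longrightarrow> val x s = 0) \<and> N x < T" for n
  proof -
    have pos: "0 < e / 3" using e by simp
    obtain x where x: "\<And>s. s \<le> t \<Longrightarrow> val x s = prof t s"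
      "\<And>s. \<not> s \<le> t \<Longrightarrow> \<not> u (n0 + n) \<le> s \<Longrightarrow> val x s = 0"
      "N x < 1 + c / 2 * ?a + C * (?a - k (n0 + n)) + e / 3"
      by (rule near_extension[OF st u(2)[of "n0 + n"] k(1)[of "n0 + n"] nd pos]) blast+
    have "?a - k (n0 + n) < e / (3 * C)" using n0[of "n0 + n"] by simp
    then have "C * (?a - k (n0 + n)) < e / 3" using C by (simp add: field_simps)
    then have "N x < T" using x(3) unfolding T_def by linarith
    then show ?thesis using x by blast
  qed
  then obtain x where x: "\<And>n s. s \<le> t \<Longrightarrow> val (x n) s = prof t s"
    "\<And>n s. \<not> s \<le> t \<Longrightarrow> \<not> u (n0 + n) \<le> s \<Longrightarrow> val (x n) s = 0" "\<And>n. N (x n) < T" by metis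
  define R where "R = T / c + norm f"
  have nx: "norm (x n - f) \<le> R" for n
  proof -
    have "c * norm (x n) \<le> T" using lower[of "x n"] x(3)[of n] by simp
    then have "norm (x n) \<le> T / c" using c by (simp add: field_simps)
    then show ?thesis using norm_triangle_ineq4[of "x n" f] unfolding R_def by simp
  qed
  have R: "0 \<le> R" using nx[of 0] norm_ge_zero[of "x 0 - f"] by linarith
  \<comment> \<open>So many terms that the distance \<open>R / real K\<close> of the average from
    \<open>f\<close> costs less than \<open>e / 3\<close> in \<open>N\<close>.\<close>
  obtain K' :: nat where K': "3 * C * R / e < real K'" using reals_Archimedean2 by blast
  define K where "K = Suc K'"
  have K: "0 < K" "3 * C * R / e < real K" using K' by (auto simp: K_def)
  let ?avg = "(1 / real K) *\<^sub>R (\<Sum>n<K. x n)"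
  have "norm (?avg - f) \<le> R / real K"
  proof (rule C0_disjoint_average[OF _ nx K(1) R])
    fix m n s assume mn: "val (x m - f) s \<noteq> 0" "val (x n - f) s \<noteq> 0"
    have ab: "\<not> s \<le> t \<and> u (n0 + i) \<le> s" if "val (x i - f) s \<noteq> 0" for i
      using that x(1)[of s i] x(2)[of s i] f[of s] by (cases "s \<le> t") auto
    let ?p = "u (n0 + m)" and ?q = "u (n0 + n)"
    have "?p \<le> ?q \<or> ?q \<le> ?p" using tree_comparable[of ?p s ?q] ab mn by blast
    \<comment> \<open>Distinct immediate successors of \<open>t\<close> are incomparable, so no node
      lies above two of them.\<close>
    moreover have "\<not> p < q" if "succ_of t p" "succ_of t q" for p q
    proof
      assume "p < q"
      then have "p \<le> t" using that(2) by (simp add: succ_of_def)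
      then show False using that(1) unfolding succ_of_def by (meson leD)
    qed
    ultimately have "?p = ?q" using u(2) by (metis le_less)
    then show "m = n" using u(1) by (simp add: inj_eq)
  qed
  then have "N (f - ?avg) \<le> C * (R / real K)"
    using upper[of "f - ?avg"] mult_left_mono[of "norm (f - ?avg)" "R / real K" C] C
    by (simp add: norm_minus_commute)
  moreover have "C * (R / real K) < e / 3" using K e by (simp add: field_simps)
  moreover have "N ?avg \<le> T"
  proof -
    have "N (\<Sum>n<K. x n) \<le> (\<Sum>n<K. N (x n))" by (rule N_sum)
    also have "\<dots> \<le> (\<Sum>n<K. T)" using x(3) by (intro sum_mono) (auto intro: less_imp_le)
    finally have "N (\<Sum>n<K. x n) \<le> real K * T" by simp
    moreover have "N ?avg = N (\<Sum>n<K. x n) / real K" by (simp add: scale)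
    ultimately show ?thesis using K(1) by (simp add: divide_le_eq mult.commute)
  qed
  moreover have "N f \<le> N ?avg + N (f - ?avg)" using triangle[of ?avg "f - ?avg"] by simp
  ultimately show "N f \<le> 1 + c / 2 * ?a + e" unfolding T_def by linarith
qed

text \<open>
  On the interval \<open>[q,t]\<close> above a stagnation point, tightness below forces derivative \<open>0\<close>, whereas
  the maximality of the value chosen at \<open>q\<close> forces derivative at least \<open>c / 2\<close>.
\<close>

lemma stuck_not_gateaux:
  assumes st: "stuck t" and f: "\<And>s. val f s = (if s \<le> t then prof t s else 0)"
    and le: "N f \<le> 1 + c / 2 * prof t t"
  shows "\<not> gateaux_smooth N"
proof
  assume smooth: "gateaux_smooth N"
  let ?F = "prof t" and ?a = "prof t t"
  have "{q \<in> {..t}. stagnates ?F q} \<noteq> {}" "{q \<in> {..t}. stagnates ?F q} \<subseteq> {..t}"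
    using st by (auto simp: stuck_def)
  \<comment> \<open>The first stagnation point: no stagnation precedes it, so \<open>q\<close> is
    still a jump and its value is a supremum of admissible ones.\<close>
  then obtain q where q: "q \<in> {q \<in> {..t}. stagnates ?F q}"
    "\<And>p. p \<in> {q \<in> {..t}. stagnates ?F q} \<Longrightarrow> q \<le> p" by (rule tree_least) blast
  have qt: "q \<le> t" and qs: "stagnates ?F q" using q(1) by auto
  obtain r where r: "succ_of r q" "tight ?F r" "?F q = ?F r" using qs unfolding stagnates_def by blast
  have rq: "r < q" using r(1) by (simp add: succ_of_def)
  have cst: "?F s = ?a" if "q \<le> s" "s \<le> t" for s
    using stagnates_const[OF qs that] stagnates_const[OF qs qt] by simp
  have J: "jump ?F q"
    unfolding jump_def
  proof (intro conjI allI impI)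
    show "\<not> is_lim q" using succ_of_not_lim[OF r(1)] .
    show "\<not> stagnates ?F p" if "p < q" for p
    proof
      assume "stagnates ?F p"
      then have "q \<le> p" using q(2)[of p] that qt by simp
      then show False using that by (meson leD)
    qed
    show "tight ?F r'" if "succ_of r' q" for r' using succ_of_unique[OF that r(1)] r(2) by simp
  qed
  obtain h :: "'a C0" where h: "\<And>s. val h s = (if q \<le> s \<and> s \<le> t then 1 else 0)"
    using tail_indicator_C0[OF succ_of_not_lim[OF r(1)]] by blast
  \<comment> \<open>\<open>h\<close> vanishes on \<open>{..r}\<close>, so
    \<open>f + l *\<^sub>R h\<close> extends the profile beyond the tight node \<open>r\<close> for
    \<open>l\<close> of either sign.\<close>
  have low: "1 + c / 2 * ?a \<le> N (f + l *\<^sub>R h)" for l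
  proof -
    have rt: "r \<le> t" using rq qt by simp
    have "f + l *\<^sub>R h \<in> exts ?F r"
      unfolding exts_def
    proof (intro CollectI conjI allI impI)
      fix s assume s: "s \<le> r"
      then have "\<not> q \<le> s" using rq by (meson leD le_less_trans)
      then show "val (f + l *\<^sub>R h) s = ?F s" using s rt by (auto simp: f h dest: order_trans)
    next
      fix s assume "\<not> s \<le> r" "\<not> r \<le> s"
      then have "\<not> s \<le> t" using tree_comparable[of s t r] rt by blast
      then show "val (f + l *\<^sub>R h) s = 0" by (simp add: f h)
    qed
    then show ?thesis using r(2,3) cst[OF order_refl qt] unfolding tight_def by auto
  qed
  \<comment> \<open>A smaller norm would make \<open>?a + l\<close> an admissible value at
    \<open>q\<close>, above the supremum chosen there.\<close>
  have high: "1 + c / 2 * (?a + l) \<le> N (f + l *\<^sub>R h)" if l: "0 < l" for l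
  proof (rule ccontr)
    assume n: "\<not> 1 + c / 2 * (?a + l) \<le> N (f + l *\<^sub>R h)"
    have "f + l *\<^sub>R h \<in> exts (const_from ?F q (?a + l)) t"
      unfolding exts_def
    proof (intro CollectI conjI allI impI)
      fix s assume s: "s \<le> t"
      then have "s < q \<or> q \<le> s" using tree_comparable[OF s qt] by (auto simp: le_less)
      then show "val (f + l *\<^sub>R h) s = const_from ?F q (?a + l) s"
        using s cst[of s] by (auto simp: f h const_from_def dest: leD)
    qed (simp add: f h)
    then have "admissible (const_from ?F q (?a + l)) t"
      unfolding admissible_def const_from_top[OF qt] using n
      by (intro allI impI bexI[of _ "f + l *\<^sub>R h"]) auto
    then have "?a + l \<le> ?F q"
      unfolding prof_jump[OF J] by (intro cSup_upper admissible_values[OF qt]) simp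
    then show False using l cst[OF order_refl qt] by simp
  qed
  have Nf: "N f = 1 + c / 2 * ?a" using low[of 0] le by simp
  moreover have "0 \<le> c / 2 * ?a" using prof_props[of t t] c by simp
  ultimately have "f \<noteq> 0" using N_zero by auto
  then obtain D :: "'a C0 \<Rightarrow>\<^sub>L real"
    where D: "((\<lambda>r. (N (f + r *\<^sub>R h) - N f) / r) \<longlongrightarrow> blinfun_apply D h) (at 0)"
    using smooth unfolding gateaux_smooth_def by blast
  have "blinfun_apply D h \<le> 0"
  proof (rule tendsto_upperbound)
    show "((\<lambda>r. (N (f + r *\<^sub>R h) - N f) / r) \<longlongrightarrow> blinfun_apply D h) (at_left 0)"
      using D by (rule tendsto_within_subset) simp
    have "(N (f + l *\<^sub>R h) - N f) / l \<le> 0" if "l < 0" for l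
      using low[of l] that unfolding Nf by (intro divide_nonneg_neg) simp_all
    then show "\<forall>\<^sub>F r in at_left 0. (N (f + r *\<^sub>R h) - N f) / r \<le> 0"
      unfolding eventually_at_filter by (intro always_eventually) auto
  qed simp
  moreover have "c / 2 \<le> blinfun_apply D h"
  proof (rule tendsto_lowerbound)
    show "((\<lambda>r. (N (f + r *\<^sub>R h) - N f) / r) \<longlongrightarrow> blinfun_apply D h) (at_right 0)"
      using D by (rule tendsto_within_subset) simp
    have "c / 2 \<le> (N (f + l *\<^sub>R h) - N f) / l" if "0 < l" for l
      using high[OF that] that unfolding Nf by (simp add: pos_le_divide_eq distrib_left)
    then show "\<forall>\<^sub>F r in at_right 0. c / 2 \<le> (N (f + r *\<^sub>R h) - N f) / r"
      unfolding eventually_at_filter by (intro always_eventually) auto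
  qed simp
  ultimately show False using c by simp
qed

end

text \<open>Kurepa's node for \<open>rho\<close> is stuck, since otherwise cut values beyond
  \<open>2 / c\<close> contradict the bound on parting values. The approximants from above then
  provide the successors of \<open>t\<close> over which averages are taken.\<close>

lemma no_gateaux_smooth_norm:
  fixes N :: "Y sigma C0 \<Rightarrow> real"
  assumes N: "equivalent_norm N"
  shows "\<not> gateaux_smooth N"
proof -
  obtain c C where cC: "0 < c" "0 < C" "\<And>x. c * norm x \<le> N x \<and> N x \<le> C * norm x"
    using N unfolding equivalent_norm_def by blast
  interpret equiv_norm N c C
    by unfold_locales (use N cC in \<open>auto simp: equivalent_norm_def\<close>)
  obtain t where t: "\<And>y x. rho t < Z_of_Y y \<Longrightarrow> x \<in> Rep_sigma t \<Longrightarrow> x < y"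
    "\<And>y. rho t < Z_of_Y y \<Longrightarrow> rho (add_top t y) \<le> Z_of_Y y"
    using kurepa_maximal[OF mono_rho strict_mono_Z_of_Y] by metis
  obtain \<beta> where \<beta>: "isZ (rho_seq t) \<beta>" "rho_seq t \<beta> = Some (Sup (levels t))"
    "isY (rho_seq t) \<beta> \<longleftrightarrow> \<not> stuck t"
    unfolding rho_seq_def by (rule isZ_enumZ[OF compact_wo_levels]) blast
  have top: "the (rho_seq t \<beta>) = prof t t" using \<beta>(2) Sup_levels by simp
  obtain k y where y: "\<And>n. rho t < Z_of_Y (y n)" "inj y"
    and less: "\<And>n w b. first_diff (rho_seq t) (Rep_Z w) b \<Longrightarrow> b < k n \<Longrightarrow> Z_of_Y (y n) < w"
    and k: "\<And>b. \<not> stuck t \<or> b < prof t t \<Longrightarrow> \<forall>\<^sub>F n in sequentially. b < k n"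
      "\<And>n. \<not> stuck t \<or> k n < prof t t"
    using approximation_from_above[of "rho t" \<beta>] \<beta>(1,3) top unfolding Rep_rho by metis
  define u where "u n = add_top t (y n)" for n
  have below: "x < y n" if "x \<in> Rep_sigma t" for x n using t(1)[OF y(1) that] .
  have u: "succ_of t (u n)" for n
    unfolding u_def by (intro imm_succs_succ_of add_top_imm_succ below)
  have inj: "inj u"
  proof (rule injI)
    fix m n assume "u m = u n"
    then have "y m \<in> insert (y n) (Rep_sigma t)"
      unfolding u_def using Rep_add_top[of t, OF below] by (metis insertI1)
    then have "y m = y n" using below by blast
    then show "m = n" using y(2) by (simp add: inj_eq)
  qed
  \<comment> \<open>A parting value below \<open>k n\<close> would put \<open>rho (u n)\<close>
    above \<open>Z_of_Y (y n)\<close>, against the choice of \<open>t\<close>.\<close>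
  have nd: "\<not> first_diff (rho_seq t) (rho_seq (u n)) b" if "b < k n" for n b
  proof
    assume "first_diff (rho_seq t) (rho_seq (u n)) b"
    then have "Z_of_Y (y n) < rho (u n)" using that by (intro less) (simp_all add: Rep_rho)
    then show False using t(2)[OF y(1)] unfolding u_def by (meson leD)
  qed
  show ?thesis
  proof (cases "stuck t")
    case False
    then have "\<forall>\<^sub>F n in sequentially. 2 / c < k n" using k(1) by blast
    then obtain n where n: "2 / c < k n" unfolding eventually_sequentially by blast
    obtain b where "b \<le> 2 / c" "first_diff (rho_seq t) (rho_seq (u n)) b"
      by (rule rho_succ_diff[OF u False])
    then show ?thesis using nd[of b n] n by simp
  next
    case True
    obtain f :: "Y sigma C0" where f: "\<And>s. val f s = (if s \<le> t then prof t s else 0)"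
      using level_fun_C0[OF prof_level] by blast
    have "N f \<le> 1 + c / 2 * prof t t"
    proof (rule fan_average[OF True inj u _ _ nd f])
      show "k n \<le> prof t t" for n using k(2)[of n] True by simp
      show "\<forall>\<^sub>F n in sequentially. prof t t - e < k n" if "0 < e" for e using k(1) that by simp
    qed
    then show ?thesis by (rule stuck_not_gateaux[OF True f])
  qed
qed

theorem proposition4:
  shows "(\<exists>\<rho> :: Y sigma \<Rightarrow> Z. strict_mono \<rho>) \<and>
    (\<forall>\<rho> :: Y sigma \<Rightarrow> Z. mono \<rho> \<longrightarrow> (\<exists>t. Z_bad \<rho> t)) \<and>
    \<not> (\<exists>N :: Y sigma C0 \<Rightarrow> real. equivalent_norm N \<and> gateaux_smooth N)"
  using sigma_Y_embeds_in_Z mono_has_Z_bad_point no_gateaux_smooth_norm by blast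

end
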